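(* Let $R\ge0$. Then the following statements are equivalent: (i) $V$ is strongly nuclear. (ii) $\mathrm{T}^\bullet_{R^-}(V)$ is strongly nuclear. (iii) $\mathcal{W}_{R^-}(V)$ is strongly nuclear.
   Context: $\mathbb{K}=\mathbb{R}$ or $\mathbb{C}$, and $V=V_{\mathbf 0}\oplus V_{\mathbf 1}$ is a $\mathbb{Z}_2$-graded Hausdorff locally convex $\mathbb{K}$-vector space such that the projections onto $V_{\mathbf 0}$ and $V_{\mathbf 1}$ are continuous. $S_n$ acts from the right on $V^{\otimes n}$ by $(v_1\otimes\cdots\otimes v_n)\triangleleft\sigma=\pm\, v_{\sigma(1)}\otimes\cdots\otimes v_{\sigma(n)}$ for homogeneous $v_i$, where $\pm$ is the Koszul sign ($-1$ to the number of pairs $i<j$ with $\sigma(i)>\sigma(j)$ and $v_{\sigma(i)},v_{\sigma(j)}$ both odd). $\mathcal{S}_n(v)=\frac1{n!}\sum_{\sigma} v\triangleleft\sigma$, $\mathrm{S}^n(V)=\operatorname{im}\mathcal{S}_n\subseteq V^{\otimes n}$, $\mathrm{S}^0(V)=\mathbb{K}$, and $\mathrm{S}^\bullet(V)=\bigoplus_n\mathrm{S}^n(V)\subseteq\mathrm{T}^\bullet(V)=\bigoplus_n V^{\otimes n}$. For a continuous seminorm $p$ on $V$ let $p^n=p\otimes\cdots\otimes p$ be the projective tensor seminorm on $V^{\otimes n}$ ($p^0=|\cdot|$), and for $R\in\mathbb{R}$ set $p_R(v)=\sum_{n\ge0}p^n(v_n)\,n!^R$ for $v=\sum_n v_n$,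 $v_n\in V^{\otimes n}$. $\mathrm{T}^\bullet_{R^-}(V)$ is $\mathrm{T}^\bullet(V)$ with the locally convex topology defined by all seminorms $p_{R-\epsilon}$ with $\epsilon>0$ and $p$ a continuous seminorm on $V$. The locally convex space $\mathcal{W}_{R^-}(V)$ is $\mathrm{S}^\bullet(V)$ with the subspace topology from $\mathrm{T}^\bullet_{R^-}(V)$. Strongly nuclear means: for every continuous seminorm $p$ there is a continuous seminorm $q\ge p$ such that the canonical map $\iota_{qp}\colon V_q\to V_p$ (where $V_p$ is the Banach space completion of $V/\ker p$ with the quotient norm $\|\cdot\|_p$) has a representation $\iota_{qp}(v)=\sum_{i=1}^\infty\epsilon^i(v)e_i$ with $\epsilon^i\in V_q'$, $e_i\in V_p$ and $\sum_i(\|\epsilon^i\|_q\|e_i\|_p)^\alpha<\infty$ for all $\alpha>0$, where $\|\epsilon^i\|_q$ is the dual norm. *)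

theory Defs
  imports
    "HOL-Analysis.Analysis"
    "HOL-Combinatorics.Permutations"
    "HOL-Library.Function_Algebras"
begin

section \<open>Locally convex spaces over the real or complex numbers\<close>

text \<open>The axiom says that the normed field is, up to isometric isomorphism, \<open>\<real>\<close> or \<open>\<complex>\<close>.\<close>

class real_or_complex = real_normed_field +
  assumes real_or_complex:
    "\<exists>f :: 'a \<Rightarrow> complex.
       (\<forall>x y. f (x + y) = f x + f y) \<and> (\<forall>x y. f (x * y) = f x * f y) \<and>
       (\<forall>r x. f (scaleR r x) = scaleR r (f x)) \<and> (\<forall>x. norm (f x) = norm x) \<and>
       (range f = \<real> \<or> range f = UNIV)"

instance real :: real_or_complex
proof
  show "\<exists>f :: real \<Rightarrow> complex.
       (\<forall>x y. f (x + y) = f x + f y) \<and> (\<forall>x y. f (x * y) = f x * f y) \<and>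
       (\<forall>r x. f (scaleR r x) = scaleR r (f x)) \<and> (\<forall>x. norm (f x) = norm x) \<and>
       (range f = \<real> \<or> range f = UNIV)"
    by (rule exI[of _ complex_of_real]) (auto simp: Reals_def scaleR_conv_of_real)
qed

instance complex :: real_or_complex
proof
  show "\<exists>f :: complex \<Rightarrow> complex.
       (\<forall>x y. f (x + y) = f x + f y) \<and> (\<forall>x y. f (x * y) = f x * f y) \<and>
       (\<forall>r x. f (scaleR r x) = scaleR r (f x)) \<and> (\<forall>x. norm (f x) = norm x) \<and>
       (range f = \<real> \<or> range f = UNIV)"
    by (rule exI[of _ id]) auto
qed

locale hausdorff_lcs = vector_space smul
  for smul :: "'k::real_or_complex \<Rightarrow> 'v::ab_group_add \<Rightarrow> 'v" +
  fixes X :: "'v topology"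
  assumes topspace_UNIV: "topspace X = UNIV"
    and Hausdorff: "Hausdorff_space X"
    and continuous_add: "continuous_map (prod_topology X X) X (\<lambda>(x, y). x + y)"
    and continuous_scale: "continuous_map (prod_topology euclidean X) X (\<lambda>(c, x). smul c x)"
    and locally_convex:
      "openin X U \<Longrightarrow> 0 \<in> U \<Longrightarrow>
        \<exists>W. openin X W \<and> 0 \<in> W \<and> W \<subseteq> U \<and>
          (\<forall>x\<in>W. \<forall>y\<in>W. \<forall>t\<in>{0..1}. smul (of_real t) x + smul (of_real (1 - t)) y \<in> W)"

text \<open>Seminorms are functions on the ambient type that are only looked at on the carrier \<open>S\<close>.\<close>

definition seminorm_on :: "('k::real_or_complex \<Rightarrow> 'v::ab_group_add \<Rightarrow> 'v) \<Rightarrow> 'v set \<Rightarrow> ('v \<Rightarrow> real) \<Rightarrow> bool" where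
  "seminorm_on smul S p \<longleftrightarrow>
     (\<forall>x\<in>S. 0 \<le> p x) \<and>
     (\<forall>x\<in>S. \<forall>y\<in>S. p (x + y) \<le> p x + p y) \<and>
     (\<forall>c. \<forall>x\<in>S. p (smul c x) = norm c * p x)"

definition continuous_seminorm :: "('k::real_or_complex \<Rightarrow> 'v::ab_group_add \<Rightarrow> 'v) \<Rightarrow> 'v topology \<Rightarrow> ('v \<Rightarrow> real) \<Rightarrow> bool" where
  "continuous_seminorm smul X p \<longleftrightarrow>
     seminorm_on smul (topspace X) p \<and> continuous_map X euclideanreal p"

definition seminorm_topology :: "'v::ab_group_add set \<Rightarrow> ('v \<Rightarrow> real) set \<Rightarrow> 'v topology" where
  "seminorm_topology S P =
     topology_generated_by (insert S {{y \<in> S. p (y - x) < e} |p x e. p \<in> P \<and> x \<in> S \<and> 0 < e})"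


section \<open>The Banach spaces associated with a seminorm\<close>

record ('k, 'e) normed_sp =
  ns_carrier :: "'e set"
  ns_add :: "'e \<Rightarrow> 'e \<Rightarrow> 'e"
  ns_zero :: "'e"
  ns_smul :: "'k \<Rightarrow> 'e \<Rightarrow> 'e"
  ns_norm :: "'e \<Rightarrow> real"

definition ns_dist :: "('k::real_or_complex, 'e) normed_sp \<Rightarrow> 'e \<Rightarrow> 'e \<Rightarrow> real" where
  "ns_dist E x y = ns_norm E (ns_add E x (ns_smul E (-1) y))"

fun ns_partial_sum :: "('k, 'e) normed_sp \<Rightarrow> (nat \<Rightarrow> 'e) \<Rightarrow> nat \<Rightarrow> 'e" where
  "ns_partial_sum E f 0 = ns_zero E"
| "ns_partial_sum E f (Suc n) = ns_add E (ns_partial_sum E f n) (f n)"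

definition ns_sums :: "('k::real_or_complex, 'e) normed_sp \<Rightarrow> (nat \<Rightarrow> 'e) \<Rightarrow> 'e \<Rightarrow> bool" where
  "ns_sums E f s \<longleftrightarrow> (\<lambda>n. ns_dist E (ns_partial_sum E f n) s) \<longlonglongrightarrow> 0"

definition ns_dual :: "('k::real_or_complex, 'e) normed_sp \<Rightarrow> ('e \<Rightarrow> 'k) set" where
  "ns_dual E = {f.
     (\<forall>x\<in>ns_carrier E. \<forall>y\<in>ns_carrier E. f (ns_add E x y) = f x + f y) \<and>
     (\<forall>c. \<forall>x\<in>ns_carrier E. f (ns_smul E c x) = c * f x) \<and>
     (\<exists>C. \<forall>x\<in>ns_carrier E. norm (f x) \<le> C * ns_norm E x)}"

definition ns_dual_norm :: "('k::real_or_complex, 'e) normed_sp \<Rightarrow> ('e \<Rightarrow> 'k) \<Rightarrow> real" where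
  "ns_dual_norm E f = Sup {norm (f x) |x. x \<in> ns_carrier E \<and> ns_norm E x \<le> 1}"

text \<open>
  The operations on cosets and on classes of Cauchy sequences below are unions over all
  choices of representatives; since they are well defined on classes, all members of such a
  union coincide.
\<close>

definition ker_coset :: "'v::ab_group_add set \<Rightarrow> ('v \<Rightarrow> real) \<Rightarrow> 'v \<Rightarrow> 'v set" where
  "ker_coset S p x = {x + z |z. z \<in> S \<and> p z = 0}"

definition ker_quotient ::
  "('k::real_or_complex \<Rightarrow> 'v::ab_group_add \<Rightarrow> 'v) \<Rightarrow> 'v set \<Rightarrow> ('v \<Rightarrow> real) \<Rightarrow> ('k, 'v set) normed_sp" where
  "ker_quotient smul S p =
     \<lparr> ns_carrier = ker_coset S p ` S,
       ns_add = (\<lambda>A B. \<Union>a\<in>A. \<Union>b\<in>B. ker_coset S p (a + b)),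
       ns_zero = ker_coset S p 0,
       ns_smul = (\<lambda>c A. \<Union>a\<in>A. ker_coset S p (smul c a)),
       ns_norm = (\<lambda>A. Inf (p ` A)) \<rparr>"

definition cauchy_seqs :: "('k::real_or_complex, 'e) normed_sp \<Rightarrow> (nat \<Rightarrow> 'e) set" where
  "cauchy_seqs E = {x. (\<forall>n. x n \<in> ns_carrier E) \<and>
     (\<forall>e>0. \<exists>M. \<forall>m\<ge>M. \<forall>n\<ge>M. ns_dist E (x m) (x n) < e)}"

definition cauchy_equiv :: "('k::real_or_complex, 'e) normed_sp \<Rightarrow> ((nat \<Rightarrow> 'e) \<times> (nat \<Rightarrow> 'e)) set" where
  "cauchy_equiv E = {(x, y). x \<in> cauchy_seqs E \<and> y \<in> cauchy_seqs E \<and>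
     (\<lambda>n. ns_dist E (x n) (y n)) \<longlonglongrightarrow> 0}"

definition completion :: "('k::real_or_complex, 'e) normed_sp \<Rightarrow> ('k, (nat \<Rightarrow> 'e) set) normed_sp" where
  "completion E =
     \<lparr> ns_carrier = cauchy_seqs E // cauchy_equiv E,
       ns_add = (\<lambda>A B. \<Union>x\<in>A. \<Union>y\<in>B. cauchy_equiv E `` {\<lambda>n. ns_add E (x n) (y n)}),
       ns_zero = cauchy_equiv E `` {\<lambda>_. ns_zero E},
       ns_smul = (\<lambda>c A. \<Union>x\<in>A. cauchy_equiv E `` {\<lambda>n. ns_smul E c (x n)}),
       ns_norm = (\<lambda>A. THE r. \<exists>x\<in>A. (\<lambda>n. ns_norm E (x n)) \<longlonglongrightarrow> r) \<rparr>"

definition seminorm_banach ::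
  "('k::real_or_complex \<Rightarrow> 'v::ab_group_add \<Rightarrow> 'v) \<Rightarrow> 'v set \<Rightarrow> ('v \<Rightarrow> real) \<Rightarrow> ('k, (nat \<Rightarrow> 'v set) set) normed_sp" where
  "seminorm_banach smul S p = completion (ker_quotient smul S p)"

text \<open>
  For \<open>p \<le> q\<close>, the canonical map from the Banach space of \<open>q\<close> to that of \<open>p\<close>: the continuous
  extension of \<open>v + ker q \<mapsto> v + ker p\<close>, obtained by applying that map to the terms of Cauchy
  sequences.
\<close>

definition canonical_map ::
  "('k::real_or_complex \<Rightarrow> 'v::ab_group_add \<Rightarrow> 'v) \<Rightarrow> 'v set \<Rightarrow> ('v \<Rightarrow> real) \<Rightarrow>
    (nat \<Rightarrow> 'v set) set \<Rightarrow> (nat \<Rightarrow> 'v set) set" where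
  "canonical_map smul S p A =
     (\<Union>x\<in>A. cauchy_equiv (ker_quotient smul S p) `` {\<lambda>n. \<Union>a\<in>x n. ker_coset S p a})"

definition strongly_nuclear ::
  "('k::real_or_complex \<Rightarrow> 'v::ab_group_add \<Rightarrow> 'v) \<Rightarrow> 'v topology \<Rightarrow> bool" where
  "strongly_nuclear smul X \<longleftrightarrow>
     (\<forall>p. continuous_seminorm smul X p \<longrightarrow>
       (\<exists>q. continuous_seminorm smul X q \<and> (\<forall>x\<in>topspace X. p x \<le> q x) \<and>
         (let Vp = seminorm_banach smul (topspace X) p;
              Vq = seminorm_banach smul (topspace X) q
          in \<exists>\<epsilon> e.
               (\<forall>i::nat. \<epsilon> i \<in> ns_dual Vq \<and> e i \<in> ns_carrier Vp) \<and>
               (\<forall>v\<in>ns_carrier Vq.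
                  ns_sums Vp (\<lambda>i. ns_smul Vp (\<epsilon> i v) (e i)) (canonical_map smul (topspace X) p v)) \<and>
               (\<forall>\<alpha>>0. summable (\<lambda>i. (ns_dual_norm Vq (\<epsilon> i) * ns_norm Vp (e i)) powr \<alpha>)))))"


section \<open>Tensor powers\<close>

definition fscale :: "('k \<Rightarrow> 'a \<Rightarrow> 'a) \<Rightarrow> 'k \<Rightarrow> ('x \<Rightarrow> 'a) \<Rightarrow> ('x \<Rightarrow> 'a)" where
  "fscale s c f = (\<lambda>x. s c (f x))"

definition multilinear ::
  "('k::field \<Rightarrow> 'v::ab_group_add \<Rightarrow> 'v) \<Rightarrow> ('k \<Rightarrow> 'w::ab_group_add \<Rightarrow> 'w) \<Rightarrow> nat \<Rightarrow> ('v list \<Rightarrow> 'w) \<Rightarrow> bool" where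
  "multilinear s1 s2 n f \<longleftrightarrow>
     (\<forall>vs i. length vs = n \<and> i < n \<longrightarrow> Vector_Spaces.linear s1 s2 (\<lambda>x. f (vs[i := x])))"

text \<open>
  Over a field, the tensor power of degree \<open>n\<close> embeds into the dual of the space of
  \<open>n\<close>-linear forms, and we realise it there: \<open>tensor smul [v\<^sub>1, \<dots>, v\<^sub>n]\<close> stands for
  \<open>v\<^sub>1 \<otimes> \<dots> \<otimes> v\<^sub>n\<close> and is the evaluation of forms at \<open>v\<^sub>1, \<dots>, v\<^sub>n\<close>. The theorems
  \<open>multilinear_tensor\<close> and \<open>tensor_power_universal\<close> below give the universal property. In
  degree \<open>0\<close> every function is a form, and the tensor power is the line spanned by
  \<open>tensor smul []\<close>, the unit of the tensor algebra.
\<close>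

type_synonym ('k, 'v) tens = "('v list \<Rightarrow> 'k) \<Rightarrow> 'k"

definition tensor :: "('k::field \<Rightarrow> 'v::ab_group_add \<Rightarrow> 'v) \<Rightarrow> 'v list \<Rightarrow> ('k, 'v) tens" where
  "tensor smul vs = (\<lambda>\<phi>. if multilinear smul (*) (length vs) \<phi> then \<phi> vs else 0)"

definition tensor_power :: "('k::field \<Rightarrow> 'v::ab_group_add \<Rightarrow> 'v) \<Rightarrow> nat \<Rightarrow> ('k, 'v) tens set" where
  "tensor_power smul n = module.span (fscale (*)) {tensor smul vs |vs. length vs = n}"

definition tensor_algebra :: "('k::field \<Rightarrow> 'v::ab_group_add \<Rightarrow> 'v) \<Rightarrow> (nat \<Rightarrow> ('k, 'v) tens) set" where
  "tensor_algebra smul = {t. (\<forall>n. t n \<in> tensor_power smul n) \<and> finite {n. t n \<noteq> 0}}"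

abbreviation tensor_scale :: "'k::field \<Rightarrow> (nat \<Rightarrow> ('k, 'v) tens) \<Rightarrow> (nat \<Rightarrow> ('k, 'v) tens)" where
  "tensor_scale \<equiv> fscale (fscale (*))"

text \<open>
  The scalar coefficients in the representations matter in degree \<open>0\<close> only, where they make
  the seminorm of \<open>c\<close> times the unit equal to the absolute value of \<open>c\<close>.
\<close>

definition projective_power ::
  "('k::real_or_complex \<Rightarrow> 'v::ab_group_add \<Rightarrow> 'v) \<Rightarrow> ('v \<Rightarrow> real) \<Rightarrow> nat \<Rightarrow> ('k, 'v) tens \<Rightarrow> real" where
  "projective_power smul p n t =
     Inf {(\<Sum>vs\<in>A. norm (c vs) * (\<Prod>v\<leftarrow>vs. p v)) |A c.
            finite A \<and> (\<forall>vs\<in>A. length vs = n) \<and>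
            t = (\<Sum>vs\<in>A. fscale (*) (c vs) (tensor smul vs))}"

definition tensor_seminorm ::
  "('k::real_or_complex \<Rightarrow> 'v::ab_group_add \<Rightarrow> 'v) \<Rightarrow> real \<Rightarrow> ('v \<Rightarrow> real) \<Rightarrow> (nat \<Rightarrow> ('k, 'v) tens) \<Rightarrow> real" where
  "tensor_seminorm smul R p t = (\<Sum>n. projective_power smul p n (t n) * fact n powr R)"

definition tensor_topology ::
  "('k::real_or_complex \<Rightarrow> 'v::ab_group_add \<Rightarrow> 'v) \<Rightarrow> 'v topology \<Rightarrow> real \<Rightarrow> (nat \<Rightarrow> ('k, 'v) tens) topology" where
  "tensor_topology smul X R =
     seminorm_topology (tensor_algebra smul)
       {tensor_seminorm smul (R - \<epsilon>) p |\<epsilon> p. 0 < \<epsilon> \<and> continuous_seminorm smul X p}"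


section \<open>The graded symmetric algebra\<close>

text \<open>\<open>G False\<close> is the even and \<open>G True\<close> the odd part.\<close>

definition component :: "(bool \<Rightarrow> 'v::ab_group_add set) \<Rightarrow> bool \<Rightarrow> 'v \<Rightarrow> 'v" where
  "component G b v = (THE x. x \<in> G b \<and> v - x \<in> G (\<not> b))"

locale Z2_graded_lcs = hausdorff_lcs smul X
  for smul :: "'k::real_or_complex \<Rightarrow> 'v::ab_group_add \<Rightarrow> 'v" and X :: "'v topology" +
  fixes G :: "bool \<Rightarrow> 'v set"
  assumes subspace_G: "subspace (G b)"
    and direct_sum: "\<exists>!x. x \<in> G False \<and> v - x \<in> G True"
    and continuous_component: "continuous_map X X (component G b)"

definition koszul_sign :: "(nat \<Rightarrow> nat) \<Rightarrow> bool list \<Rightarrow> 'k::field" where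
  "koszul_sign \<sigma> \<epsilon> =
     (-1) ^ card {(i, j). i < j \<and> j < length \<epsilon> \<and> \<sigma> j < \<sigma> i \<and> \<epsilon> ! \<sigma> i \<and> \<epsilon> ! \<sigma> j}"

text \<open>
  The right action of \<open>\<sigma>\<close> on the tensor power of degree \<open>n\<close>. It is linear, and
  \<open>koszul_action_tensor\<close> below shows that on tensors of homogeneous vectors it is given by
  the usual formula, which determines it.
\<close>

definition koszul_action ::
  "('k::field \<Rightarrow> 'v::ab_group_add \<Rightarrow> 'v) \<Rightarrow> (bool \<Rightarrow> 'v set) \<Rightarrow> nat \<Rightarrow> (nat \<Rightarrow> nat) \<Rightarrow> ('k, 'v) tens \<Rightarrow> ('k, 'v) tens" where
  "koszul_action smul G n \<sigma> t =
     (\<lambda>\<phi>. if multilinear smul (*) n \<phi>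
          then t (\<lambda>vs. \<Sum>\<epsilon> | length \<epsilon> = n.
                    koszul_sign \<sigma> \<epsilon> * \<phi> (permute_list \<sigma> (map2 (component G) \<epsilon> vs)))
          else 0)"

definition symmetrizer ::
  "('k::field_char_0 \<Rightarrow> 'v::ab_group_add \<Rightarrow> 'v) \<Rightarrow> (bool \<Rightarrow> 'v set) \<Rightarrow> nat \<Rightarrow> ('k, 'v) tens \<Rightarrow> ('k, 'v) tens" where
  "symmetrizer smul G n t =
     fscale (*) (1 / fact n) (\<Sum>\<sigma> | \<sigma> permutes {..<n}. koszul_action smul G n \<sigma> t)"

definition symmetric_power ::
  "('k::field_char_0 \<Rightarrow> 'v::ab_group_add \<Rightarrow> 'v) \<Rightarrow> (bool \<Rightarrow> 'v set) \<Rightarrow> nat \<Rightarrow> ('k, 'v) tens set" where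
  "symmetric_power smul G n = symmetrizer smul G n ` tensor_power smul n"

definition symmetric_algebra ::
  "('k::field_char_0 \<Rightarrow> 'v::ab_group_add \<Rightarrow> 'v) \<Rightarrow> (bool \<Rightarrow> 'v set) \<Rightarrow> (nat \<Rightarrow> ('k, 'v) tens) set" where
  "symmetric_algebra smul G = {t. (\<forall>n. t n \<in> symmetric_power smul G n) \<and> finite {n. t n \<noteq> 0}}"

definition weyl_topology ::
  "('k::real_or_complex \<Rightarrow> 'v::ab_group_add \<Rightarrow> 'v) \<Rightarrow> 'v topology \<Rightarrow> (bool \<Rightarrow> 'v set) \<Rightarrow> real \<Rightarrow>
    (nat \<Rightarrow> ('k, 'v) tens) topology" where
  "weyl_topology smul X G R = subtopology (tensor_topology smul X R) (symmetric_algebra smul G)"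


section \<open>Adequacy of the tensor power and of the action\<close>

lemma vector_space_fscale:
  assumes "vector_space s" shows "vector_space (fscale s)"
proof -
  interpret vector_space s by fact
  show ?thesis
    by unfold_locales (auto simp: fscale_def fun_eq_iff algebra_simps)
qed

lemma vector_space_mult: "vector_space ((*) :: 'k::field \<Rightarrow> 'k \<Rightarrow> 'k)"
  by unfold_locales (auto simp: algebra_simps)

lemma vector_space_tens: "vector_space (fscale (*) :: 'k::field \<Rightarrow> ('k, 'v) tens \<Rightarrow> ('k, 'v) tens)"
  by (intro vector_space_fscale vector_space_mult)

lemma linearI':
  assumes "vector_space s1" "vector_space s2"
    "\<And>x y. f (x + y) = f x + f y" "\<And>c x. f (s1 c x) = s2 c (f x)"
  shows "Vector_Spaces.linear s1 s2 f"
proof -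
  interpret a: vector_space s1 by fact
  interpret b: vector_space s2 by fact
  show ?thesis by unfold_locales (simp_all add: assms)
qed

lemma linear_add': "Vector_Spaces.linear s1 s2 f \<Longrightarrow> f (x + y) = f x + f y"
  and linear_scale': "Vector_Spaces.linear s1 s2 f \<Longrightarrow> f (s1 c x) = s2 c (f x)"
  unfolding Vector_Spaces.linear_def module_hom_def module_hom_axioms_def by blast+

theorem multilinear_tensor:
  assumes "vector_space smul"
  shows "multilinear smul (fscale (*)) n (tensor smul)"
  unfolding multilinear_def
proof (intro allI impI)
  fix vs :: "'b list" and i assume A: "length vs = n \<and> i < n"
  have *: "Vector_Spaces.linear smul (*) (\<lambda>x. \<phi> (vs[i := x]))"
    if "multilinear smul (*) n \<phi>" for \<phi> :: "'b list \<Rightarrow> 'a"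
    using that A by (auto simp: multilinear_def)
  show "Vector_Spaces.linear smul (fscale (*)) (\<lambda>x. tensor smul (vs[i := x]))"
    using A *[THEN linear_add'] *[THEN linear_scale']
    by (intro linearI' assms vector_space_tens) (auto simp: tensor_def fscale_def fun_eq_iff)
qed

lemma linear_functional_separates:
  assumes "vector_space s" "w \<noteq> 0"
  shows "\<exists>\<psi>. Vector_Spaces.linear s (*) \<psi> \<and> \<psi> w \<noteq> (0::'k::field)"
proof -
  interpret vector_space_pair s "(*) :: 'k \<Rightarrow> 'k \<Rightarrow> 'k"
    by (intro vector_space_pair.intro assms vector_space_mult)
  have ind: "vs1.independent {w}"
    using assms(2) by simp
  show ?thesis
    using linear_construct[OF ind, of "\<lambda>_. 1"] construct_basis[OF ind, of w "\<lambda>_. 1"] by force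
qed

theorem tensor_power_universal:
  fixes s :: "'k::field \<Rightarrow> 'w::ab_group_add \<Rightarrow> 'w" and smul :: "'k \<Rightarrow> 'v::ab_group_add \<Rightarrow> 'v"
  assumes "vector_space smul" "vector_space s" "multilinear smul s n f"
  shows "\<exists>L. Vector_Spaces.linear (fscale (*)) s L \<and>
    (\<forall>vs. length vs = n \<longrightarrow> L (tensor smul vs) = f vs)"
proof -
  interpret vector_space_pair "fscale (*) :: 'k \<Rightarrow> ('k, 'v) tens \<Rightarrow> ('k, 'v) tens" s
    by (intro vector_space_pair.intro assms vector_space_tens)
  define T where "T = {tensor smul vs |vs. length vs = n}"
  obtain B where B: "B \<subseteq> T" "vs1.independent B" "T \<subseteq> vs1.span B"
    using vs1.maximal_independent_subset by blast
  have "\<forall>b\<in>B. \<exists>vs. length vs = n \<and> b = tensor smul vs"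
    using B(1) by (auto simp: T_def)
  then obtain r where r: "\<And>b. b \<in> B \<Longrightarrow> length (r b) = n \<and> b = tensor smul (r b)"
    by metis
  define L where "L = construct B (\<lambda>b. f (r b))"
  have lin: "Vector_Spaces.linear (fscale (*)) s L"
    unfolding L_def by (rule linear_construct[OF B(2)])
  have LB: "L b = f (r b)" if "b \<in> B" for b
    unfolding L_def by (rule construct_basis[OF B(2) that])
  have "L (tensor smul vs) = f vs" if len: "length vs = n" for vs
  proof (rule ccontr)
    assume "L (tensor smul vs) \<noteq> f vs"
    then obtain \<psi> :: "'w \<Rightarrow> 'k" where \<psi>: "Vector_Spaces.linear s (*) \<psi>" "\<psi> (L (tensor smul vs) - f vs) \<noteq> 0"
      using linear_functional_separates[OF assms(2), of "L (tensor smul vs) - f vs"] by auto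
    define \<phi> where "\<phi> = (\<lambda>vs. \<psi> (f vs))"
    have ml: "multilinear smul (*) n \<phi>"
      unfolding multilinear_def
    proof (intro allI impI)
      fix ws :: "'v list" and i assume "length ws = n \<and> i < n"
      then have l: "Vector_Spaces.linear smul s (\<lambda>x. f (ws[i := x]))"
        using assms(3) by (auto simp: multilinear_def)
      show "Vector_Spaces.linear smul (*) (\<lambda>x. \<phi> (ws[i := x]))"
        using linear_add'[OF l] linear_scale'[OF l] linear_add'[OF \<psi>(1)] linear_scale'[OF \<psi>(1)]
        by (intro linearI' assms vector_space_mult) (auto simp: \<phi>_def)
    qed
    interpret p: vector_space_pair "fscale (*) :: 'k \<Rightarrow> ('k, 'v) tens \<Rightarrow> ('k, 'v) tens" "(*) :: 'k \<Rightarrow> 'k \<Rightarrow> 'k"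
      by (intro vector_space_pair.intro vector_space_mult vector_space_tens)
    have l1: "Vector_Spaces.linear (fscale (*)) (*) (\<lambda>t. \<psi> (L t))"
      using linear_add'[OF lin] linear_scale'[OF lin] linear_add'[OF \<psi>(1)] linear_scale'[OF \<psi>(1)]
      by (intro linearI' vector_space_mult vector_space_tens) auto
    have l2: "Vector_Spaces.linear (fscale (*)) (*) (\<lambda>t :: ('k, 'v) tens. t \<phi>)"
      by (intro linearI' vector_space_mult vector_space_tens) (auto simp: fscale_def)
    have "tensor smul vs \<in> vs1.span B"
      using B(3) len by (auto simp: T_def)
    moreover have "\<psi> (L b) = b \<phi>" if "b \<in> B" for b
    proof -
      have "b \<phi> = tensor smul (r b) \<phi>"
        using r[OF that] by simp
      also have "\<dots> = \<phi> (r b)"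
        using r[OF that] ml unfolding tensor_def by simp
      finally show ?thesis using LB[OF that] by (simp add: \<phi>_def)
    qed
    ultimately have "\<psi> (L (tensor smul vs)) = tensor smul vs \<phi>"
      using p.linear_eq_on[OF l1 l2] by blast
    also have "\<dots> = \<psi> (f vs)"
      using ml len by (simp add: tensor_def \<phi>_def)
    finally show False
      using \<psi>(2) linear_add'[OF \<psi>(1), of "L (tensor smul vs) - f vs" "f vs"] by simp
  qed
  with lin show ?thesis by blast
qed

context Z2_graded_lcs
begin

lemma component_eqI:
  assumes "x \<in> G b" "v - x \<in> G (\<not> b)" shows "component G b v = x"
proof -
  have *: "x = y" if "y \<in> G b" "v - y \<in> G (\<not> b)" for y
  proof (cases b)
    case True
    then have "v - x = v - y"
      using direct_sum[of v] that assms by (metis (full_types) diff_diff_eq2 add_diff_cancel_left')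
    then show ?thesis by simp
  next
    case False
    then show ?thesis using direct_sum[of v] that assms by auto
  qed
  show ?thesis
    unfolding component_def by (rule the_equality) (use assms * in blast)+
qed

lemma component_mem: "component G b v \<in> G b" "v - component G b v \<in> G (\<not> b)"
proof -
  obtain x where x: "x \<in> G False" "v - x \<in> G True" using direct_sum by blast
  have "component G False v = x" "component G True v = v - x"
    using x by (auto intro!: component_eqI)
  then show "component G b v \<in> G b" "v - component G b v \<in> G (\<not> b)"
    using x by (cases b; simp)+
qed

lemma component_add: "component G b (v + w) = component G b v + component G b w"
proof (rule component_eqI)
  show "component G b v + component G b w \<in> G b"
    by (intro subspace_add subspace_G component_mem)
  have "(v - component G b v) + (w - component G b w) \<in> G (\<not> b)"
    by (intro subspace_add subspace_G component_mem)
  then show "v + w - (component G b v + component G b w) \<in> G (\<not> b)"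
    by (simp only: add_diff_add)
qed

lemma component_scale: "component G b (smul c v) = smul c (component G b v)"
proof (rule component_eqI)
  show "smul c (component G b v) \<in> G b"
    by (intro subspace_scale subspace_G component_mem)
  have "smul c (v - component G b v) \<in> G (\<not> b)"
    by (intro subspace_scale subspace_G component_mem)
  then show "smul c v - smul c (component G b v) \<in> G (\<not> b)"
    by (simp only: scale_right_diff_distrib)
qed

lemma component_homogeneous:
  assumes "v \<in> G b" shows "component G b' v = (if b = b' then v else 0)"
proof (cases "b = b'")
  case True
  then show ?thesis using assms subspace_0[OF subspace_G] by (simp add: component_eqI)
next
  case False
  then have "b = (\<not> b')" by blast
  then show ?thesis using assms subspace_0[OF subspace_G] by (simp add: component_eqI)
qed

lemma finite_parities: "finite {\<epsilon> :: bool list. length \<epsilon> = n}"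
  using finite_lists_length_eq[of "UNIV :: bool set" n] by simp

lemma multilinear_component_permute:
  assumes \<sigma>: "\<sigma> permutes {..<n}" and \<phi>: "multilinear smul (*) n \<phi>"
    and len: "length \<epsilon> = n" "length vs = n" "i < n"
  shows "Vector_Spaces.linear smul (*)
    (\<lambda>x. \<phi> (permute_list \<sigma> (map2 (component G) \<epsilon> (vs[i := x]))))"
proof -
  define j where "j = inv \<sigma> i"
  have j: "j < n" "\<sigma> j = i"
    using permutes_in_image[OF permutes_inv[OF \<sigma>]] len(3) permutes_inverses[OF \<sigma>]
    by (auto simp: j_def)
  define ws where "ws = permute_list \<sigma> (map2 (component G) \<epsilon> vs)"
  have "permute_list \<sigma> (map2 (component G) \<epsilon> (vs[i := x])) = ws[j := component G (\<epsilon> ! i) x]" for x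
  proof (rule nth_equalityI)
    fix k assume "k < length (permute_list \<sigma> (map2 (component G) \<epsilon> (vs[i := x])))"
    then have k: "k < n" "\<sigma> k < n"
      using len permutes_in_image[OF \<sigma>] by auto
    have "\<sigma> k = i \<longleftrightarrow> k = j"
      using j permutes_inj[OF \<sigma>] by (auto simp: inj_def)
    then show "permute_list \<sigma> (map2 (component G) \<epsilon> (vs[i := x])) ! k = ws[j := component G (\<epsilon> ! i) x] ! k"
      using k len by (auto simp: ws_def permute_list_def nth_list_update)
  qed (use len in \<open>auto simp: ws_def\<close>)
  moreover have "Vector_Spaces.linear smul (*) (\<lambda>x. \<phi> (ws[j := x]))"
    using \<phi> j len by (auto simp: multilinear_def ws_def)
  ultimately show ?thesis
    using linear_add'[of smul "(*)" "\<lambda>x. \<phi> (ws[j := x])"]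
      linear_scale'[of smul "(*)" "\<lambda>x. \<phi> (ws[j := x])"]
    by (intro linearI' vector_space_axioms vector_space_mult)
       (auto simp: component_add component_scale)
qed

theorem linear_koszul_action:
  "Vector_Spaces.linear (fscale (*)) (fscale (*)) (koszul_action smul G n \<sigma>)"
  by (intro linearI' vector_space_tens) (auto simp: koszul_action_def fscale_def fun_eq_iff)

theorem koszul_action_tensor:
  assumes \<sigma>: "\<sigma> permutes {..<n}" and len: "length vs = n" "length \<epsilon> = n"
    and hom: "\<And>i. i < n \<Longrightarrow> vs ! i \<in> G (\<epsilon> ! i)"
  shows "koszul_action smul G n \<sigma> (tensor smul vs) =
    fscale (*) (koszul_sign \<sigma> \<epsilon>) (tensor smul (permute_list \<sigma> vs))"
proof
  fix \<phi> :: "'v list \<Rightarrow> 'k"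
  show "koszul_action smul G n \<sigma> (tensor smul vs) \<phi> =
    fscale (*) (koszul_sign \<sigma> \<epsilon>) (tensor smul (permute_list \<sigma> vs)) \<phi>"
  proof (cases "multilinear smul (*) n \<phi>")
    case True
    define \<phi>' where "\<phi>' = (\<lambda>vs. \<Sum>\<epsilon> | length \<epsilon> = n.
      koszul_sign \<sigma> \<epsilon> * \<phi> (permute_list \<sigma> (map2 (component G) \<epsilon> vs)))"
    have "multilinear smul (*) n \<phi>'"
      unfolding multilinear_def
    proof (intro allI impI)
      fix ws :: "'v list" and i assume A: "length ws = n \<and> i < n"
      have l: "Vector_Spaces.linear smul (*)
          (\<lambda>x. \<phi> (permute_list \<sigma> (map2 (component G) \<epsilon> (ws[i := x]))))" if "length \<epsilon> = n" for \<epsilon>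
        using multilinear_component_permute[OF \<sigma> True that] A by blast
      show "Vector_Spaces.linear smul (*) (\<lambda>x. \<phi>' (ws[i := x]))"
        using linear_add'[OF l] linear_scale'[OF l]
        by (intro linearI' vector_space_axioms vector_space_mult)
           (auto simp: \<phi>'_def algebra_simps sum_distrib_left simp flip: sum.distrib intro!: sum.cong)
    qed
    then have "koszul_action smul G n \<sigma> (tensor smul vs) \<phi> = \<phi>' vs"
      using True len by (simp add: koszul_action_def tensor_def \<phi>'_def)
    also have "\<dots> = (\<Sum>\<epsilon>' | length \<epsilon>' = n. if \<epsilon>' = \<epsilon> then koszul_sign \<sigma> \<epsilon> * \<phi> (permute_list \<sigma> vs) else 0)"
      unfolding \<phi>'_def
    proof (rule sum.cong[OF refl])
      fix \<epsilon>' :: "bool list" assume "\<epsilon>' \<in> {\<epsilon>'. length \<epsilon>' = n}"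
      then have e: "length \<epsilon>' = n" by simp
      show "koszul_sign \<sigma> \<epsilon>' * \<phi> (permute_list \<sigma> (map2 (component G) \<epsilon>' vs)) =
        (if \<epsilon>' = \<epsilon> then koszul_sign \<sigma> \<epsilon> * \<phi> (permute_list \<sigma> vs) else 0)"
      proof (cases "\<epsilon>' = \<epsilon>")
        case eq: True
        have "component G (\<epsilon> ! i) (vs ! i) = vs ! i" if "i < n" for i
          using component_homogeneous[OF hom[OF that], of "\<epsilon> ! i"] by simp
        then have "map2 (component G) \<epsilon> vs = vs"
          by (intro nth_equalityI) (use len in auto)
        with eq show ?thesis by simp
      next
        case False
        then obtain i where i: "i < n" "\<epsilon>' ! i \<noteq> \<epsilon> ! i"
          using e len by (auto simp: list_eq_iff_nth_eq)
        have z: "component G (\<epsilon>' ! i) (vs ! i) = 0"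
          using component_homogeneous[OF hom[OF i(1)]] i(2) by auto
        have "\<phi> (permute_list \<sigma> (map2 (component G) \<epsilon>' (vs[i := smul 0 (vs ! i)]))) =
            0 * \<phi> (permute_list \<sigma> (map2 (component G) \<epsilon>' (vs[i := vs ! i])))"
          by (rule linear_scale'[OF multilinear_component_permute[OF \<sigma> True e len(1) i(1)]])
        moreover have "map2 (component G) \<epsilon>' (vs[i := smul 0 (vs ! i)]) = map2 (component G) \<epsilon>' vs"
          using z i e len component_scale[of "\<epsilon>' ! i" 0 "vs ! i"]
          by (intro nth_equalityI) (auto simp: nth_list_update)
        ultimately show ?thesis using False by simp
      qed
    qed
    also have "\<dots> = koszul_sign \<sigma> \<epsilon> * \<phi> (permute_list \<sigma> vs)"
      using len finite_parities[of n] by simp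
    finally show ?thesis
      using True len by (simp add: fscale_def tensor_def)
  qed (use len in \<open>simp add: koszul_action_def fscale_def tensor_def\<close>)
qed

end

end

theory Submission
  imports Defs
begin

text \<open>
  Strong nuclearity asks, for every continuous seminorm \<open>p\<close>, for a larger \<open>q\<close> such that the canonical
  map between the two completions has an expansion with rapidly decreasing coefficients. The
  proof first gets rid of the completions. A vector \<open>e\<close> of the completion for \<open>p\<close> is the sum of a
  series of vectors of the space itself whose seminorms decay like \<open>2\<^sup>-\<^sup>k\<close>, and the \<open>\<alpha>\<close>-th powers of
  \<open>2\<^sup>-\<^sup>k\<close> are summable for every positive \<open>\<alpha>\<close>. So the vectors of an expansion may be taken from the
  space. What remains is a condition on pairs of seminorms, \<open>strongly_nuclear_pair\<close>: there are
  functionals \<open>f\<^sub>i\<close> with \<open>|f\<^sub>i| \<le> c\<^sub>i q\<close> and vectors \<open>e\<^sub>i\<close> such that the numbers \<open>c\<^sub>i p(e\<^sub>i)\<close> are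
  summable to every positive power and the sum of the \<open>f\<^sub>i(x) e\<^sub>i\<close> is \<open>x\<close> in the sense of \<open>p\<close>. It
  suffices to test it on a cofinal family of seminorms (\<open>strongly_nuclear_iff_pairs\<close>), and it passes
  to retracts (\<open>strongly_nuclear_pair_retract\<close>).

  From the space to its tensor algebra: let \<open>f\<^sub>i, e\<^sub>i, c\<^sub>i\<close> be such data for \<open>p\<close> and \<open>q\<close>. Expanding
  every factor of a tensor gives data indexed by words, namely the functionals
  \<open>f\<^sub>i \<otimes> f\<^sub>j \<otimes> \<dots>\<close> and the tensors \<open>e\<^sub>i \<otimes> e\<^sub>j \<otimes> \<dots>\<close>. If the tensor seminorm built from \<open>q\<close> carries
  the exponent \<open>R\<close> and that built from \<open>p\<close> the smaller exponent \<open>R'\<close>, then the coefficient of a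
  word of length \<open>n\<close> is at most the product of the \<open>c\<^sub>i p(e\<^sub>i)\<close> over its letters times
  \<open>n!\<close> to the power \<open>R' - R\<close>. The sum of the \<open>\<alpha>\<close>-th powers is bounded by a series
  \<open>\<Sum>n. M\<^sup>n / n!\<^sup>d\<close> with positive \<open>d\<close>, which converges whatever \<open>M\<close> is. This is
  \<open>strongly_nuclear_pair_tensor_algebra\<close>, and the open condition on the exponent in the topology
  leaves room for passing from \<open>R\<close> to \<open>R'\<close>.

  From the tensor algebra to its symmetric part: the permutations act on tensors, because the Koszul
  sign is a cocycle (\<open>koszul_sign_compose\<close>), so the symmetrizer is a projection. It is continuous:
  the seminorms \<open>p\<close> with \<open>p(v) = p(v\<^sub>0) + p(v\<^sub>1)\<close> are cofinal, and for them it does not increase the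
  projective seminorm (\<open>projective_power_symmetrizer_le\<close>). Hence the symmetric part is a retract.

  Back to the space: tensors of degree one are symmetric, so the space is a retract of the
  symmetric part.
\<close>

section \<open>The completion of a seminormed space\<close>

lemma UN_eq_const: "a \<in> A \<Longrightarrow> (\<And>a. a \<in> A \<Longrightarrow> f a = C) \<Longrightarrow> (\<Union>a\<in>A. f a) = C"
  by auto

lemma UN_UN_eq_const:
  "a \<in> A \<Longrightarrow> b \<in> B \<Longrightarrow> (\<And>a b. a \<in> A \<Longrightarrow> b \<in> B \<Longrightarrow> f a b = C) \<Longrightarrow> (\<Union>a\<in>A. \<Union>b\<in>B. f a b) = C"
  by (rule UN_eq_const, assumption, rule UN_eq_const, assumption)

locale seminormed_space = vector_space s
  for s :: "'k::real_or_complex \<Rightarrow> 'v::ab_group_add \<Rightarrow> 'v" +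
  fixes S :: "'v set" and p :: "'v \<Rightarrow> real"
  assumes subspace_S: "subspace S" and seminorm: "seminorm_on s S p"
begin

abbreviation "quot \<equiv> ker_quotient s S p"
abbreviation "banach \<equiv> seminorm_banach s S p"

lemma S_closed [simp]:
  "0 \<in> S" "x \<in> S \<Longrightarrow> y \<in> S \<Longrightarrow> x + y \<in> S" "x \<in> S \<Longrightarrow> y \<in> S \<Longrightarrow> x - y \<in> S" "x \<in> S \<Longrightarrow> s c x \<in> S"
  "x \<in> S \<Longrightarrow> - x \<in> S"
  "(\<And>i. i \<in> A \<Longrightarrow> g i \<in> S) \<Longrightarrow> sum g A \<in> S"
  by (rule subspace_S[THEN subspace_0] subspace_S[THEN subspace_add] subspace_S[THEN subspace_diff]
        subspace_S[THEN subspace_scale] subspace_S[THEN subspace_neg] subspace_S[THEN subspace_sum]; simp)+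

lemma nonneg [simp]: "x \<in> S \<Longrightarrow> 0 \<le> p x"
  and triangle: "x \<in> S \<Longrightarrow> y \<in> S \<Longrightarrow> p (x + y) \<le> p x + p y"
  and scale [simp]: "x \<in> S \<Longrightarrow> p (s c x) = norm c * p x"
  using seminorm by (auto simp: seminorm_on_def)

lemma zero [simp]: "p 0 = 0"
  using scale[of 0 0] by simp

lemma minus [simp]: "x \<in> S \<Longrightarrow> p (- x) = p x"
  using scale[of x "-1"] by (simp add: scale_minus_left)

lemma diff_commute: "x \<in> S \<Longrightarrow> y \<in> S \<Longrightarrow> p (x - y) = p (y - x)"
  using minus[of "x - y"] by simp

lemma triangle_mid: "x \<in> S \<Longrightarrow> y \<in> S \<Longrightarrow> z \<in> S \<Longrightarrow> p (x - z) \<le> p (x - y) + p (y - z)"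
  using triangle[of "x - y" "y - z"] by simp

lemma reverse_triangle: "x \<in> S \<Longrightarrow> y \<in> S \<Longrightarrow> \<bar>p x - p y\<bar> \<le> p (x - y)"
  using triangle[of "x - y" y] triangle[of "y - x" x] diff_commute[of x y] by simp

lemma sum_le: "(\<And>i. i \<in> A \<Longrightarrow> g i \<in> S) \<Longrightarrow> p (sum g A) \<le> (\<Sum>i\<in>A. p (g i))"
proof (induction A rule: infinite_finite_induct)
  case (insert i A)
  have "p (g i + sum g A) \<le> p (g i) + p (sum g A)"
    by (rule triangle) (use insert in auto)
  with insert show ?case by fastforce
qed auto

lemma mem_ker_coset: "x \<in> S \<Longrightarrow> y \<in> ker_coset S p x \<longleftrightarrow> y \<in> S \<and> p (y - x) = 0"
  unfolding ker_coset_def by (auto intro!: exI[of _ "y - x"])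

lemma ker_coset_eq:
  assumes "x \<in> S" "y \<in> S" "p (x - y) = 0"
  shows "ker_coset S p x = ker_coset S p y"
proof -
  have "p (z - x) = 0 \<longleftrightarrow> p (z - y) = 0" if "z \<in> S" for z
    using triangle_mid[of z x y] triangle_mid[of z y x] nonneg[of "z - x"] nonneg[of "z - y"]
      diff_commute[of x y] assms that by force
  then show ?thesis using assms by (auto simp: mem_ker_coset)
qed

lemma self_mem_ker_coset: "x \<in> S \<Longrightarrow> x \<in> ker_coset S p x"
  by (simp add: mem_ker_coset)

lemma quotient_carrier: "ns_carrier quot = ker_coset S p ` S"
  by (simp add: ker_quotient_def)

lemma quotient_add:
  assumes "x \<in> S" "y \<in> S"
  shows "ns_add quot (ker_coset S p x) (ker_coset S p y) = ker_coset S p (x + y)"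
proof -
  have "ker_coset S p (a + b) = ker_coset S p (x + y)"
    if "a \<in> ker_coset S p x" "b \<in> ker_coset S p y" for a b
  proof (rule ker_coset_eq)
    have "p (a + b - (x + y)) \<le> p (a - x) + p (b - y)"
      using triangle[of "a - x" "b - y"] that assms by (simp add: mem_ker_coset add_diff_add)
    then show "p (a + b - (x + y)) = 0"
      using that assms by (intro antisym) (auto simp: mem_ker_coset)
  qed (use that assms in \<open>auto simp: mem_ker_coset\<close>)
  then show ?thesis
    unfolding ker_quotient_def normed_sp.simps by (rule UN_UN_eq_const[OF assms[THEN self_mem_ker_coset]])
qed

lemma quotient_smul:
  assumes "x \<in> S"
  shows "ns_smul quot c (ker_coset S p x) = ker_coset S p (s c x)"
proof -
  have "ker_coset S p (s c a) = ker_coset S p (s c x)" if "a \<in> ker_coset S p x" for a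
  proof (rule ker_coset_eq)
    show "p (s c a - s c x) = 0"
      using that assms scale[of "a - x" c] by (simp add: mem_ker_coset scale_right_diff_distrib)
  qed (use that assms in \<open>auto simp: mem_ker_coset\<close>)
  then show ?thesis
    unfolding ker_quotient_def normed_sp.simps by (rule UN_eq_const[OF assms[THEN self_mem_ker_coset]])
qed

lemma quotient_norm:
  assumes "x \<in> S"
  shows "ns_norm quot (ker_coset S p x) = p x"
proof -
  have "p a = p x" if "a \<in> ker_coset S p x" for a
    using that assms reverse_triangle[of a x] by (simp add: mem_ker_coset)
  then have "p ` ker_coset S p x = (\<lambda>_. p x) ` ker_coset S p x"
    by (intro image_cong refl)
  also have "\<dots> = {p x}"
    using self_mem_ker_coset[OF assms] by blast
  finally show ?thesis by (simp add: ker_quotient_def)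
qed

lemma quotient_dist:
  assumes "x \<in> S" "y \<in> S"
  shows "ns_dist quot (ker_coset S p x) (ker_coset S p y) = p (x - y)"
  using assms by (simp add: ns_dist_def quotient_add quotient_smul quotient_norm scale_minus_left)

definition pcauchy :: "(nat \<Rightarrow> 'v) \<Rightarrow> bool" where
  "pcauchy x \<longleftrightarrow> (\<forall>n. x n \<in> S) \<and> (\<forall>e>0. \<exists>M. \<forall>m\<ge>M. \<forall>n\<ge>M. p (x m - x n) < e)"

lemma pcauchyD [simp]: "pcauchy x \<Longrightarrow> x n \<in> S"
  by (simp add: pcauchy_def)

lemma pcauchyE:
  assumes "pcauchy x" "0 < e"
  obtains M where "\<And>m n. m \<ge> M \<Longrightarrow> n \<ge> M \<Longrightarrow> p (x m - x n) < e"
  using assms unfolding pcauchy_def by blast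

lemma pcauchy_const: "x \<in> S \<Longrightarrow> pcauchy (\<lambda>_. x)"
  by (simp add: pcauchy_def)

lemma pcauchy_add:
  assumes "pcauchy x" "pcauchy y" shows "pcauchy (\<lambda>n. x n + y n)"
  unfolding pcauchy_def
proof (intro conjI allI impI)
  fix e :: real assume "0 < e"
  then have e: "0 < e / 2" by simp
  obtain M1 where M1: "\<And>m n. m \<ge> M1 \<Longrightarrow> n \<ge> M1 \<Longrightarrow> p (x m - x n) < e / 2"
    using pcauchyE[OF assms(1) e] by blast
  obtain M2 where M2: "\<And>m n. m \<ge> M2 \<Longrightarrow> n \<ge> M2 \<Longrightarrow> p (y m - y n) < e / 2"
    using pcauchyE[OF assms(2) e] by blast
  have "p (x m + y m - (x n + y n)) < e" if "m \<ge> max M1 M2" "n \<ge> max M1 M2" for m n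
    using triangle[of "x m - x n" "y m - y n"] M1[of m n] M2[of m n] assms that
    by (simp add: add_diff_add)
  then show "\<exists>M. \<forall>m\<ge>M. \<forall>n\<ge>M. p (x m + y m - (x n + y n)) < e" by blast
qed (use assms in auto)

lemma pcauchy_scale:
  assumes "pcauchy x" shows "pcauchy (\<lambda>n. s c (x n))"
  unfolding pcauchy_def
proof (intro conjI allI impI)
  fix e :: real assume "0 < e"
  then have "0 < e / (norm c + 1)" by (simp add: add_nonneg_pos)
  then obtain M where M: "\<And>m n. m \<ge> M \<Longrightarrow> n \<ge> M \<Longrightarrow> p (x m - x n) < e / (norm c + 1)"
    using pcauchyE[OF assms(1)] by blast
  have "p (s c (x m) - s c (x n)) < e" if "m \<ge> M" "n \<ge> M" for m n
  proof -
    have "p (s c (x m) - s c (x n)) = norm c * p (x m - x n)"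
      using scale[of "x m - x n" c] assms by (simp add: scale_right_diff_distrib)
    also have "\<dots> \<le> (norm c + 1) * p (x m - x n)"
      using assms by (simp add: mult_right_mono)
    also have "\<dots> < e"
      using M[OF that] by (simp add: pos_less_divide_eq add_nonneg_pos mult.commute)
    finally show ?thesis .
  qed
  then show "\<exists>M. \<forall>m\<ge>M. \<forall>n\<ge>M. p (s c (x m) - s c (x n)) < e" by blast
qed (use assms in auto)

lemma pcauchy_minus: "pcauchy x \<Longrightarrow> pcauchy (\<lambda>n. - x n)"
  using pcauchy_scale[of x "-1"] by (simp add: scale_minus_left)

lemma pcauchy_diff: "pcauchy x \<Longrightarrow> pcauchy y \<Longrightarrow> pcauchy (\<lambda>n. x n - y n)"
  using pcauchy_add[of x "\<lambda>n. - y n"] pcauchy_minus[of y] by simp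

lemma pcauchy_sum: "(\<And>i. i \<in> A \<Longrightarrow> pcauchy (x i)) \<Longrightarrow> pcauchy (\<lambda>n. \<Sum>i\<in>A. x i n)"
  by (induction A rule: infinite_finite_induct) (auto intro: pcauchy_add pcauchy_const)

lemma pcauchy_convergent:
  assumes "pcauchy x" shows "convergent (\<lambda>n. p (x n))"
proof (rule Cauchy_convergent, rule metric_CauchyI)
  fix e :: real assume "0 < e"
  then obtain M where M: "\<And>m n. m \<ge> M \<Longrightarrow> n \<ge> M \<Longrightarrow> p (x m - x n) < e"
    using pcauchyE[OF assms] by blast
  have "dist (p (x m)) (p (x n)) < e" if "m \<ge> M" "n \<ge> M" for m n
    using M[OF that] reverse_triangle[of "x m" "x n"] assms by (simp add: dist_real_def)
  then show "\<exists>M. \<forall>m\<ge>M. \<forall>n\<ge>M. dist (p (x m)) (p (x n)) < e" by blast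
qed

lemma cauchy_seqs_iff:
  assumes "\<And>n. x n \<in> S"
  shows "(\<lambda>n. ker_coset S p (x n)) \<in> cauchy_seqs quot \<longleftrightarrow> pcauchy x"
  using assms by (auto simp: cauchy_seqs_def pcauchy_def quotient_dist quotient_carrier)

lemma cauchy_seqsE:
  assumes "A \<in> cauchy_seqs quot"
  obtains x where "pcauchy x" "A = (\<lambda>n. ker_coset S p (x n))"
proof -
  have "\<forall>n. \<exists>y\<in>S. A n = ker_coset S p y"
    using assms by (simp add: cauchy_seqs_def quotient_carrier image_iff)
  then obtain x where x: "\<And>n. x n \<in> S" "\<And>n. A n = ker_coset S p (x n)" by metis
  then have "A = (\<lambda>n. ker_coset S p (x n))" by auto
  with x that assms show thesis using cauchy_seqs_iff[of x] by simp
qed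

text \<open>
  The element of the completion that a Cauchy sequence of vectors represents: the class of the
  sequence of their cosets. Every element of the completion has this form, which turns statements about
  classes of sequences of cosets into statements about sequences of vectors.
\<close>

definition cls :: "(nat \<Rightarrow> 'v) \<Rightarrow> (nat \<Rightarrow> 'v set) set" where
  "cls x = cauchy_equiv quot `` {\<lambda>n. ker_coset S p (x n)}"

lemma mem_cls_iff:
  assumes "pcauchy x"
  shows "A \<in> cls x \<longleftrightarrow> (\<exists>y. pcauchy y \<and> A = (\<lambda>n. ker_coset S p (y n)) \<and> (\<lambda>n. p (x n - y n)) \<longlonglongrightarrow> 0)"
proof
  assume A: "A \<in> cls x"
  then have "A \<in> cauchy_seqs quot"
    by (auto simp: cls_def cauchy_equiv_def)
  then obtain y where y: "pcauchy y" "A = (\<lambda>n. ker_coset S p (y n))"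
    using cauchy_seqsE by blast
  with A assms have "(\<lambda>n. p (x n - y n)) \<longlonglongrightarrow> 0"
    by (auto simp: cls_def cauchy_equiv_def quotient_dist)
  with y show "\<exists>y. pcauchy y \<and> A = (\<lambda>n. ker_coset S p (y n)) \<and> (\<lambda>n. p (x n - y n)) \<longlonglongrightarrow> 0"
    by blast
next
  assume "\<exists>y. pcauchy y \<and> A = (\<lambda>n. ker_coset S p (y n)) \<and> (\<lambda>n. p (x n - y n)) \<longlonglongrightarrow> 0"
  with assms show "A \<in> cls x"
    by (auto simp: cls_def cauchy_equiv_def quotient_dist cauchy_seqs_iff)
qed

lemma mem_clsE:
  assumes "A \<in> cls x" "pcauchy x"
  obtains y where "pcauchy y" "A = (\<lambda>n. ker_coset S p (y n))" "(\<lambda>n. p (x n - y n)) \<longlonglongrightarrow> 0"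
  using assms(1) unfolding mem_cls_iff[OF assms(2)] by (elim exE conjE)

lemma self_mem_cls: "pcauchy x \<Longrightarrow> (\<lambda>n. ker_coset S p (x n)) \<in> cls x"
  by (auto simp: mem_cls_iff intro!: exI[of _ x])

lemma cls_eq:
  assumes "pcauchy x" "pcauchy y" "(\<lambda>n. p (x n - y n)) \<longlonglongrightarrow> 0"
  shows "cls x = cls y"
proof -
  have *: "cls x \<subseteq> cls y" if xy: "pcauchy x" "pcauchy y" "(\<lambda>n. p (x n - y n)) \<longlonglongrightarrow> 0" for x y
  proof
    fix A assume "A \<in> cls x"
    then obtain z where z: "pcauchy z" "A = (\<lambda>n. ker_coset S p (z n))" "(\<lambda>n. p (x n - z n)) \<longlonglongrightarrow> 0"
      using mem_clsE xy(1) by blast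
    have "(\<lambda>n. p (y n - z n)) \<longlonglongrightarrow> 0"
    proof (rule tendsto_sandwich[OF _ _ tendsto_const])
      show "(\<lambda>n. p (x n - y n) + p (x n - z n)) \<longlonglongrightarrow> 0"
        using tendsto_add[OF xy(3) z(3)] by simp
      show "\<forall>\<^sub>F n in sequentially. p (y n - z n) \<le> p (x n - y n) + p (x n - z n)"
        using triangle_mid[of "y n" "x n" "z n" for n] diff_commute[of "y n" "x n" for n] xy z by simp
    qed (use xy z in auto)
    with z xy show "A \<in> cls y" using mem_cls_iff by blast
  qed
  have "(\<lambda>n. p (y n - x n)) \<longlonglongrightarrow> 0"
    using assms diff_commute[of "y n" "x n" for n] by simp
  with * assms show ?thesis by blast
qed

lemma carrier_completion:
  "ns_carrier banach = {cls x |x. pcauchy x}"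
proof -
  have "ns_carrier banach =
      (\<lambda>A. cauchy_equiv quot `` {A}) ` cauchy_seqs quot"
    by (auto simp: seminorm_banach_def completion_def quotient_def)
  also have "cauchy_seqs quot = {\<lambda>n. ker_coset S p (x n) |x. pcauchy x}"
    using cauchy_seqs_iff by (auto elim!: cauchy_seqsE)
  finally show ?thesis by (auto simp: cls_def)
qed

lemma completion_add:
  assumes "pcauchy x" "pcauchy y"
  shows "ns_add banach (cls x) (cls y) = cls (\<lambda>n. x n + y n)"
proof -
  have "cauchy_equiv quot `` {\<lambda>n. ns_add quot (A n) (B n)} = cls (\<lambda>n. x n + y n)"
    if AB: "A \<in> cls x" "B \<in> cls y" for A B
  proof -
    obtain a where a: "pcauchy a" "A = (\<lambda>n. ker_coset S p (a n))" "(\<lambda>n. p (x n - a n)) \<longlonglongrightarrow> 0"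
      using mem_clsE[OF AB(1) assms(1)] .
    obtain b where b: "pcauchy b" "B = (\<lambda>n. ker_coset S p (b n))" "(\<lambda>n. p (y n - b n)) \<longlonglongrightarrow> 0"
      using mem_clsE[OF AB(2) assms(2)] .
    have "(\<lambda>n. p (a n + b n - (x n + y n))) \<longlonglongrightarrow> 0"
    proof (rule tendsto_sandwich[OF _ _ tendsto_const])
      show "(\<lambda>n. p (x n - a n) + p (y n - b n)) \<longlonglongrightarrow> 0"
        using tendsto_add[OF a(3) b(3)] by simp
      have "p (a n + b n - (x n + y n)) \<le> p (x n - a n) + p (y n - b n)" for n
        using triangle[of "a n - x n" "b n - y n"] diff_commute[of "x n" "a n"] diff_commute[of "y n" "b n"]
          a b assms by (simp add: add_diff_add)
      then show "\<forall>\<^sub>F n in sequentially. p (a n + b n - (x n + y n)) \<le> p (x n - a n) + p (y n - b n)"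
        by simp
    qed (use a b assms in auto)
    then have "cls (\<lambda>n. a n + b n) = cls (\<lambda>n. x n + y n)"
      by (intro cls_eq pcauchy_add a b assms)
    then show ?thesis using a b by (simp add: quotient_add cls_def)
  qed
  then show ?thesis
    unfolding seminorm_banach_def completion_def normed_sp.simps by (rule UN_UN_eq_const[OF assms[THEN self_mem_cls]])
qed

lemma completion_smul:
  assumes "pcauchy x"
  shows "ns_smul banach c (cls x) = cls (\<lambda>n. s c (x n))"
proof -
  have "cauchy_equiv quot `` {\<lambda>n. ns_smul quot c (A n)} = cls (\<lambda>n. s c (x n))"
    if A: "A \<in> cls x" for A
  proof -
    obtain a where a: "pcauchy a" "A = (\<lambda>n. ker_coset S p (a n))" "(\<lambda>n. p (x n - a n)) \<longlonglongrightarrow> 0"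
      using mem_clsE[OF A assms] .
    have "p (s c (a n) - s c (x n)) = norm c * p (x n - a n)" for n
      using scale[of "a n - x n" c] diff_commute[of "x n" "a n"] a assms by (simp add: scale_right_diff_distrib)
    then have "(\<lambda>n. p (s c (a n) - s c (x n))) \<longlonglongrightarrow> 0"
      using tendsto_mult_left[OF a(3), of "norm c"] by simp
    then have "cls (\<lambda>n. s c (a n)) = cls (\<lambda>n. s c (x n))"
      by (intro cls_eq pcauchy_scale a assms)
    then show ?thesis using a by (simp add: quotient_smul cls_def)
  qed
  then show ?thesis
    unfolding seminorm_banach_def completion_def normed_sp.simps by (rule UN_eq_const[OF assms[THEN self_mem_cls]])
qed

lemma completion_norm:
  assumes "pcauchy x" "(\<lambda>n. p (x n)) \<longlonglongrightarrow> r"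
  shows "ns_norm banach (cls x) = r"
proof -
  have "r' = r" if A: "A \<in> cls x" "(\<lambda>n. ns_norm quot (A n)) \<longlonglongrightarrow> r'" for A r'
  proof -
    obtain a where a: "pcauchy a" "A = (\<lambda>n. ker_coset S p (a n))" "(\<lambda>n. p (x n - a n)) \<longlonglongrightarrow> 0"
      using mem_clsE[OF A(1) assms(1)] .
    have "norm (p (x n) - p (a n)) \<le> p (x n - a n)" for n
      using reverse_triangle[of "x n" "a n"] a(1) assms(1) by simp
    then have "(\<lambda>n. p (x n) - p (a n)) \<longlonglongrightarrow> 0"
      by (intro Lim_null_comparison[OF _ a(3)]) simp
    moreover have "(\<lambda>n. p (a n)) \<longlonglongrightarrow> r'"
      using that a by (simp add: quotient_norm)
    ultimately have "(\<lambda>n. (p (x n) - p (a n)) + p (a n)) \<longlonglongrightarrow> 0 + r'"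
      by (rule tendsto_add)
    then have "(\<lambda>n. p (x n)) \<longlonglongrightarrow> r'" by simp
    then show ?thesis using assms(2) by (rule LIMSEQ_unique)
  qed
  moreover have "\<exists>A\<in>cls x. (\<lambda>n. ns_norm quot (A n)) \<longlonglongrightarrow> r"
    by (rule bexI[OF _ self_mem_cls[OF assms(1)]]) (simp add: quotient_norm assms)
  ultimately show ?thesis
    unfolding seminorm_banach_def completion_def normed_sp.simps by (intro the_equality) blast+
qed

lemma completion_norm_tendsto:
  assumes "pcauchy x"
  shows "(\<lambda>n. p (x n)) \<longlonglongrightarrow> ns_norm banach (cls x)"
  using completion_norm[OF assms] pcauchy_convergent[OF assms] unfolding convergent_def by blast

lemma completion_norm_const: "x \<in> S \<Longrightarrow> ns_norm banach (cls (\<lambda>_. x)) = p x"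
  by (rule completion_norm) (auto simp: pcauchy_const)

lemma completion_norm_nonneg: "pcauchy x \<Longrightarrow> 0 \<le> ns_norm banach (cls x)"
  by (rule LIMSEQ_le_const[OF completion_norm_tendsto]) auto

lemma completion_zero: "ns_zero banach = cls (\<lambda>_. 0)"
  by (simp add: seminorm_banach_def completion_def cls_def ker_quotient_def)

lemma completion_partial_sum:
  assumes "\<And>i. pcauchy (y i)"
  shows "ns_partial_sum banach (\<lambda>i. cls (y i)) n = cls (\<lambda>k. \<Sum>i<n. y i k)"
  by (induction n) (simp_all add: completion_zero completion_add pcauchy_sum assms)

lemma completion_dist:
  assumes "pcauchy x" "pcauchy y"
  shows "(\<lambda>n. p (x n - y n)) \<longlonglongrightarrow> ns_dist banach (cls x) (cls y)"
proof -
  have "ns_dist banach (cls x) (cls y) = ns_norm banach (cls (\<lambda>n. x n - y n))"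
    using assms by (simp add: ns_dist_def completion_smul completion_add pcauchy_minus scale_minus_left)
  then show ?thesis using completion_norm_tendsto[OF pcauchy_diff[OF assms]] by simp
qed

end

section \<open>Strongly nuclear pairs of seminorms\<close>

definition functional_on :: "('k::field \<Rightarrow> 'v::ab_group_add \<Rightarrow> 'v) \<Rightarrow> 'v set \<Rightarrow> ('v \<Rightarrow> 'k) \<Rightarrow> bool" where
  "functional_on s S f \<longleftrightarrow>
     (\<forall>x\<in>S. \<forall>y\<in>S. f (x + y) = f x + f y) \<and> (\<forall>c. \<forall>x\<in>S. f (s c x) = c * f x)"

text \<open>
  Sums without an order, so that pairs and words of natural numbers may serve as indices.
\<close>

definition rapidly_summable :: "('i \<Rightarrow> real) \<Rightarrow> bool" where
  "rapidly_summable a \<longleftrightarrow> (\<forall>\<alpha>>0. (\<lambda>i. a i powr \<alpha>) summable_on UNIV)"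

text \<open>
  The completion-free content of a strongly nuclear canonical map. The numbers \<open>c i\<close> are upper bounds
  for the dual norms of the functionals, and the vectors \<open>e i\<close> belong to the space itself.
\<close>

definition strongly_nuclear_pair ::
  "('k::real_or_complex \<Rightarrow> 'v::ab_group_add \<Rightarrow> 'v) \<Rightarrow> 'v set \<Rightarrow> ('v \<Rightarrow> real) \<Rightarrow> ('v \<Rightarrow> real) \<Rightarrow> bool" where
  "strongly_nuclear_pair s S p q \<longleftrightarrow>
     (\<exists>(f :: nat \<Rightarrow> 'v \<Rightarrow> 'k) e c.
        (\<forall>i. functional_on s S (f i) \<and> e i \<in> S \<and> 0 \<le> c i) \<and>
        (\<forall>i. \<forall>x\<in>S. norm (f i x) \<le> c i * q x) \<and>
        rapidly_summable (\<lambda>i. c i * p (e i)) \<and>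
        (\<forall>x\<in>S. (\<lambda>n. p (x - (\<Sum>i<n. s (f i x) (e i)))) \<longlonglongrightarrow> 0))"

lemma rapidly_summable_reindex:
  "bij_betw h UNIV UNIV \<Longrightarrow> rapidly_summable (\<lambda>i. a (h i)) \<longleftrightarrow> rapidly_summable a"
  unfolding rapidly_summable_def
  using summable_on_reindex_bij_betw[of h UNIV UNIV "\<lambda>i. a i powr \<alpha>" for \<alpha>] by simp

lemma rapidly_summable_bound:
  assumes "rapidly_summable a" "\<And>i. 0 \<le> b i" "\<And>i. b i \<le> C * a i" "0 \<le> C" "\<And>i. 0 \<le> a i"
  shows "rapidly_summable b"
  unfolding rapidly_summable_def
proof (intro allI impI)
  fix \<alpha> :: real assume \<alpha>: "0 < \<alpha>"
  show "(\<lambda>i. b i powr \<alpha>) summable_on UNIV"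
  proof (rule summable_on_comparison_test)
    show "(\<lambda>i. C powr \<alpha> * a i powr \<alpha>) summable_on UNIV"
      using assms(1) \<alpha> by (intro summable_on_cmult_right) (simp add: rapidly_summable_def)
    show "b i powr \<alpha> \<le> C powr \<alpha> * a i powr \<alpha>" for i
      using powr_mono2[of \<alpha> "b i" "C * a i"] assms \<alpha> by (simp add: powr_mult)
  qed simp
qed

lemma rapidly_summable_summable_on:
  assumes "rapidly_summable a" "\<And>i. 0 \<le> a i"
  shows "a summable_on UNIV"
proof -
  have "(\<lambda>i. a i powr 1) summable_on UNIV"
    using assms(1) unfolding rapidly_summable_def by (rule allE[of _ 1]) simp
  with assms(2) show ?thesis by simp
qed

lemma summable_on_small_tail:
  fixes b :: "'i \<Rightarrow> real"
  assumes "b summable_on UNIV" "0 < d"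
  obtains F where "finite F" "\<And>B. finite B \<Longrightarrow> B \<inter> F = {} \<Longrightarrow> sum b B < d"
proof -
  have "(sum b \<longlongrightarrow> infsum b UNIV) (finite_subsets_at_top UNIV)"
    using has_sum_infsum[OF assms(1)] by (simp add: has_sum_def)
  then have "\<forall>\<^sub>F B in finite_subsets_at_top UNIV. dist (sum b B) (infsum b UNIV) < d / 2"
    using assms(2) by (intro tendstoD) auto
  then obtain F where F: "finite F" "\<And>B. finite B \<Longrightarrow> F \<subseteq> B \<Longrightarrow> dist (sum b B) (infsum b UNIV) < d / 2"
    unfolding eventually_finite_subsets_at_top by auto
  have "sum b B < d" if "finite B" "B \<inter> F = {}" for B
  proof -
    have "sum b (F \<union> B) = sum b F + sum b B"
      using that F by (intro sum.union_disjoint) auto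
    moreover have "dist (sum b F) (infsum b UNIV) < d / 2" "dist (sum b (F \<union> B)) (infsum b UNIV) < d / 2"
      using F(2)[of F] F(2)[of "F \<union> B"] that F(1) by auto
    ultimately show ?thesis unfolding dist_real_def by linarith
  qed
  with F(1) that show thesis by blast
qed

text \<open>
  The expansion converges absolutely with respect to \<open>p\<close>, so its sum does not depend on the order of
  the terms. Hence the terms may be indexed by any countably infinite set, and convergence need only be
  known along one exhausting sequence \<open>A\<close> of finite index sets: the partial sums over a finite set \<open>B\<close>
  and over a larger \<open>A m\<close> differ by a tail of the series of bounds.
\<close>

lemma strongly_nuclear_pair_indexed:
  fixes s :: "'k::real_or_complex \<Rightarrow> 'v::ab_group_add \<Rightarrow> 'v" and f :: "'i \<Rightarrow> 'v \<Rightarrow> 'k" and h :: "nat \<Rightarrow> 'i"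
  assumes p: "seminormed_space s S p" and h: "bij h" and q: "\<And>x. x \<in> S \<Longrightarrow> 0 \<le> q x"
    and fe: "\<And>i. functional_on s S (f i)" "\<And>i. e i \<in> S" "\<And>i. 0 \<le> c i"
      "\<And>i x. x \<in> S \<Longrightarrow> norm (f i x) \<le> c i * q x"
    and rapid: "rapidly_summable (\<lambda>i. c i * p (e i))"
    and A: "\<And>m. finite (A m)" "\<And>i. \<forall>\<^sub>F m in sequentially. i \<in> A m"
    and lim: "\<And>x. x \<in> S \<Longrightarrow> (\<lambda>m. p (x - (\<Sum>i\<in>A m. s (f i x) (e i)))) \<longlonglongrightarrow> 0"
  shows "strongly_nuclear_pair s S p q"
proof -
  interpret seminormed_space s S p by fact
  have "(\<lambda>n. p (x - (\<Sum>i<n. s (f (h i) x) (e (h i))))) \<longlonglongrightarrow> 0" if x: "x \<in> S" for x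
  proof (rule tendstoI)
    fix d :: real assume "0 < d"
    then have d: "0 < d / 2" by simp
    have "(\<lambda>i. c i * p (e i) * q x) summable_on UNIV"
      using rapid fe by (intro summable_on_cmult_left rapidly_summable_summable_on) auto
    then obtain F where F: "finite F" "\<And>B. finite B \<Longrightarrow> B \<inter> F = {} \<Longrightarrow> (\<Sum>i\<in>B. c i * p (e i) * q x) < d / 2"
      using summable_on_small_tail[OF _ d] by blast
    obtain N where N: "inv h ` F \<subseteq> {..<N}"
      using finite_nat_bounded[of "inv h ` F"] F(1) by blast
    have "p (x - (\<Sum>i<n. s (f (h i) x) (e (h i)))) < d" if n: "N \<le> n" for n
    proof -
      define B where "B = h ` {..<n}"
      have B: "finite B" "F \<subseteq> B"
      proof -
        have "i \<in> h ` {..<n}" if "i \<in> F" for i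
          using that N n h by (intro image_eqI[of _ _ "inv h i"]) (auto simp: bij_is_surj surj_f_inv_f)
        then show "F \<subseteq> B" by (auto simp: B_def)
      qed (simp add: B_def)
      have "\<forall>\<^sub>F m in sequentially. (\<forall>i\<in>B. i \<in> A m) \<and> p (x - (\<Sum>i\<in>A m. s (f i x) (e i))) < d / 2"
        using A(2) B(1) order_tendstoD(2)[OF lim[OF x] d]
        by (intro eventually_conj eventually_ball_finite) auto
      then obtain m where m: "B \<subseteq> A m" "p (x - (\<Sum>i\<in>A m. s (f i x) (e i))) < d / 2"
        using eventually_happens'[OF sequentially_bot] by blast
      have "(\<Sum>i<n. s (f (h i) x) (e (h i))) = (\<Sum>i\<in>B. s (f i x) (e i))"
        using sum.reindex[of h "{..<n}" "\<lambda>i. s (f i x) (e i)"] h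
        by (simp add: B_def bij_is_inj inj_on_subset[OF bij_is_inj])
      moreover have "(\<Sum>i\<in>A m. s (f i x) (e i)) = (\<Sum>i\<in>A m - B. s (f i x) (e i)) + (\<Sum>i\<in>B. s (f i x) (e i))"
        by (rule sum.subset_diff) (use m A in auto)
      ultimately have "x - (\<Sum>i<n. s (f (h i) x) (e (h i))) =
          (x - (\<Sum>i\<in>A m. s (f i x) (e i))) + (\<Sum>i\<in>A m - B. s (f i x) (e i))"
        by simp
      then have "p (x - (\<Sum>i<n. s (f (h i) x) (e (h i)))) \<le>
          p (x - (\<Sum>i\<in>A m. s (f i x) (e i))) + p (\<Sum>i\<in>A m - B. s (f i x) (e i))"
        by (simp only:) (rule triangle; use x fe(2) in simp)
      also have "p (\<Sum>i\<in>A m - B. s (f i x) (e i)) \<le> (\<Sum>i\<in>A m - B. p (s (f i x) (e i)))"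
        by (rule sum_le) (use fe in auto)
      also have "\<dots> \<le> (\<Sum>i\<in>A m - B. c i * p (e i) * q x)"
      proof (rule sum_mono)
        show "p (s (f i x) (e i)) \<le> c i * p (e i) * q x" for i
          using mult_right_mono[OF fe(4)[OF x], of "p (e i)" i] fe(2) by (simp add: mult_ac)
      qed
      also have "\<dots> < d / 2"
        using B A by (intro F(2)) auto
      finally show ?thesis using m(2) by simp
    qed
    then show "\<forall>\<^sub>F n in sequentially. dist (p (x - (\<Sum>i<n. s (f (h i) x) (e (h i))))) 0 < d"
      using x fe(2) by (auto simp: eventually_sequentially dist_real_def)
  qed
  then show ?thesis
    unfolding strongly_nuclear_pair_def using fe rapid rapidly_summable_reindex[OF h, of "\<lambda>i. c i * p (e i)"]
    by (intro exI[of _ "\<lambda>i. f (h i)"] exI[of _ "\<lambda>i. e (h i)"] exI[of _ "\<lambda>i. c (h i)"]) auto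
qed

lemma strongly_nuclear_pair_mono:
  assumes pq: "strongly_nuclear_pair s S p q"
    and p: "seminormed_space s S p" and p': "seminormed_space s S p'"
    and le: "\<And>x. x \<in> S \<Longrightarrow> p' x \<le> C * p x" "\<And>x. x \<in> S \<Longrightarrow> q x \<le> C' * q' x" and C: "0 \<le> C" "0 \<le> C'"
  shows "strongly_nuclear_pair s S p' q'"
proof -
  interpret p: seminormed_space s S p by fact
  interpret p': seminormed_space s S p' by fact
  obtain f e c where *: "\<And>i. functional_on s S (f i)" "\<And>i. e i \<in> S" "\<And>i. 0 \<le> c i"
      "\<And>i x. x \<in> S \<Longrightarrow> norm (f i x) \<le> c i * q x" "rapidly_summable (\<lambda>i::nat. c i * p (e i))"
      "\<And>x. x \<in> S \<Longrightarrow> (\<lambda>n. p (x - (\<Sum>i<n. s (f i x) (e i)))) \<longlonglongrightarrow> 0"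
    using pq unfolding strongly_nuclear_pair_def by blast
  have "norm (f i x) \<le> c i * C' * q' x" if "x \<in> S" for i x
    using order_trans[OF *(4)[OF that] mult_left_mono[OF le(2)[OF that] *(3)]] by (simp add: mult_ac)
  moreover have "rapidly_summable (\<lambda>i. c i * C' * p' (e i))"
  proof (rule rapidly_summable_bound[OF *(5)])
    show "c i * C' * p' (e i) \<le> C' * C * (c i * p (e i))" for i
      using mult_left_mono[OF le(1)[OF *(2)], of "c i * C'" i] *(3) C by (simp add: mult_ac)
  qed (use * C in auto)
  moreover have "(\<lambda>n. p' (x - (\<Sum>i<n. s (f i x) (e i)))) \<longlonglongrightarrow> 0" if "x \<in> S" for x
  proof (rule tendsto_sandwich[OF _ _ tendsto_const])
    show "(\<lambda>n. C * p (x - (\<Sum>i<n. s (f i x) (e i)))) \<longlonglongrightarrow> 0"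
      using tendsto_mult_left[OF *(6)[OF that], of C] by simp
    show "\<forall>\<^sub>F n in sequentially. p' (x - (\<Sum>i<n. s (f i x) (e i))) \<le> C * p (x - (\<Sum>i<n. s (f i x) (e i)))"
      using le(1) *(2) that by simp
    show "\<forall>\<^sub>F n in sequentially. 0 \<le> p' (x - (\<Sum>i<n. s (f i x) (e i)))"
      using *(2) that by simp
  qed
  ultimately show ?thesis
    unfolding strongly_nuclear_pair_def using * C
    by (intro exI[of _ f] exI[of _ e] exI[of _ "\<lambda>i. c i * C'"]) auto
qed

text \<open>
  Functionals are pulled back along \<open>i\<close> and vectors are pushed forward along \<open>r\<close>. This is how strong
  nuclearity passes to complemented subspaces; an arbitrary subspace offers no place to put the vectors
  of the expansion.
\<close>

lemma strongly_nuclear_pair_retract: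
  assumes P: "strongly_nuclear_pair s S p q"
    and i: "\<And>x. x \<in> S' \<Longrightarrow> i x \<in> S" "\<And>x y. x \<in> S' \<Longrightarrow> y \<in> S' \<Longrightarrow> i (x + y) = i x + i y"
      "\<And>c x. x \<in> S' \<Longrightarrow> i (s' c x) = s c (i x)"
    and r: "Vector_Spaces.linear s s' r" "\<And>x. x \<in> S \<Longrightarrow> r x \<in> S'" "\<And>x. x \<in> S' \<Longrightarrow> r (i x) = x"
    and p: "\<And>x. x \<in> S \<Longrightarrow> p' (r x) \<le> p x" "seminormed_space s S p" "seminormed_space s' S' p'"
    and q: "\<And>x. x \<in> S' \<Longrightarrow> q (i x) \<le> q' x"
  shows "strongly_nuclear_pair s' S' p' q'"
proof -
  interpret p: seminormed_space s S p by fact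
  interpret p': seminormed_space s' S' p' by fact
  interpret r: Vector_Spaces.linear s s' r by fact
  obtain f e c where *: "\<And>i. functional_on s S (f i)" "\<And>i. e i \<in> S" "\<And>i. 0 \<le> c i"
      "\<And>i x. x \<in> S \<Longrightarrow> norm (f i x) \<le> c i * q x" "rapidly_summable (\<lambda>i::nat. c i * p (e i))"
      "\<And>x. x \<in> S \<Longrightarrow> (\<lambda>n. p (x - (\<Sum>i<n. s (f i x) (e i)))) \<longlonglongrightarrow> 0"
    using P unfolding strongly_nuclear_pair_def by blast
  have "functional_on s' S' (\<lambda>x. f j (i x))" for j
    using *(1)[of j] i by (simp add: functional_on_def)
  moreover have "norm (f j (i x)) \<le> c j * q' x" if "x \<in> S'" for j x
    using order_trans[OF *(4)[OF i(1)[OF that]] mult_left_mono[OF q[OF that] *(3)]] .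
  moreover have "rapidly_summable (\<lambda>j. c j * p' (r (e j)))"
    by (rule rapidly_summable_bound[OF *(5), where C = 1]) (use * p r in \<open>auto intro!: mult_left_mono\<close>)
  moreover have "(\<lambda>n. p' (x - (\<Sum>j<n. s' (f j (i x)) (r (e j))))) \<longlonglongrightarrow> 0" if x: "x \<in> S'" for x
  proof (rule tendsto_sandwich[OF _ _ tendsto_const *(6)[OF i(1)[OF x]]])
    have eq: "x - (\<Sum>j<n. s' (f j (i x)) (r (e j))) = r (i x - (\<Sum>j<n. s (f j (i x)) (e j)))" for n
      by (simp add: r.diff r.sum r.scale r(3)[OF x])
    show "\<forall>\<^sub>F n in sequentially. p' (x - (\<Sum>j<n. s' (f j (i x)) (r (e j)))) \<le> p (i x - (\<Sum>j<n. s (f j (i x)) (e j)))"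
      unfolding eq using p(1) *(2) i(1)[OF x] by simp
    show "\<forall>\<^sub>F n in sequentially. 0 \<le> p' (x - (\<Sum>j<n. s' (f j (i x)) (r (e j))))"
      using *(2) r(2) x by simp
  qed
  ultimately show ?thesis
    unfolding strongly_nuclear_pair_def using * r(2)
    by (intro exI[of _ "\<lambda>j x. f j (i x)"] exI[of _ "\<lambda>j. r (e j)"] exI[of _ c]) auto
qed

section \<open>Expansions of the canonical map\<close>

text \<open>
  The field is isometric to the reals or the complex numbers, and both are closed in the complex
  numbers.
\<close>

lemma real_or_complex_complete:
  fixes z :: "nat \<Rightarrow> 'k::real_or_complex"
  assumes "Cauchy z" shows "convergent z"
proof -
  obtain \<psi> :: "'k \<Rightarrow> complex" where \<psi>: "\<And>x y. \<psi> (x + y) = \<psi> x + \<psi> y" "\<And>x. norm (\<psi> x) = norm x"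
      "range \<psi> = \<real> \<or> range \<psi> = UNIV"
    using real_or_complex by blast
  have diff: "\<psi> (x - y) = \<psi> x - \<psi> y" for x y
    using \<psi>(1)[of "x - y" y] by simp
  have dist: "dist (\<psi> x) (\<psi> y) = dist x y" for x y
    by (simp add: dist_norm \<psi>(2) flip: diff)
  have "Cauchy (\<lambda>n. \<psi> (z n))"
    using assms by (simp add: Cauchy_def dist)
  then obtain w where w: "(\<lambda>n. \<psi> (z n)) \<longlonglongrightarrow> w"
    using Cauchy_convergent convergent_def by blast
  have "closed (range \<psi>)"
    using \<psi>(3) closed_complex_Reals by (elim disjE) simp_all
  then have "w \<in> range \<psi>"
    using closed_sequentially[OF _ _ w] by blast
  then obtain l where "w = \<psi> l" by blast
  with w have "(\<lambda>n. z n) \<longlonglongrightarrow> l"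
    by (simp add: tendsto_iff dist)
  then show ?thesis by (auto simp: convergent_def)
qed

locale seminormed_pair = p: seminormed_space s S p + q: seminormed_space s S q
  for s :: "'k::real_or_complex \<Rightarrow> 'v::ab_group_add \<Rightarrow> 'v" and S p q +
  assumes le: "\<And>x. x \<in> S \<Longrightarrow> p x \<le> q x"
begin

lemma pcauchy_le: "q.pcauchy x \<Longrightarrow> p.pcauchy x"
  unfolding q.pcauchy_def p.pcauchy_def by (meson le le_less_trans q.S_closed(3))

lemma canonical_map_cls:
  assumes x: "q.pcauchy x"
  shows "canonical_map s S p (q.cls x) = p.cls x"
  unfolding canonical_map_def
proof (rule UN_eq_const[OF q.self_mem_cls[OF x]])
  fix A assume "A \<in> q.cls x"
  then obtain z where z: "q.pcauchy z" "A = (\<lambda>n. ker_coset S q (z n))" "(\<lambda>n. q (x n - z n)) \<longlonglongrightarrow> 0"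
    using q.mem_clsE x by blast
  have "(\<Union>a\<in>A n. ker_coset S p a) = ker_coset S p (z n)" for n
  proof (rule UN_eq_const)
    show "z n \<in> A n" using z by (simp add: q.self_mem_ker_coset)
    fix a assume "a \<in> A n"
    then have a: "a \<in> S" "q (a - z n) = 0"
      using z by (auto simp: q.mem_ker_coset)
    with le[of "a - z n"] z have "p (a - z n) = 0"
      by (intro antisym) auto
    with a z show "ker_coset S p a = ker_coset S p (z n)"
      by (intro p.ker_coset_eq) auto
  qed
  moreover have "p.cls z = p.cls x"
  proof (rule p.cls_eq)
    show "(\<lambda>n. p (z n - x n)) \<longlonglongrightarrow> 0"
    proof (rule tendsto_sandwich[OF _ _ tendsto_const z(3)])
      show "\<forall>\<^sub>F n in sequentially. p (z n - x n) \<le> q (x n - z n)"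
        using le x z p.diff_commute by simp
    qed (use x z in auto)
  qed (use x z pcauchy_le in auto)
  ultimately show "cauchy_equiv p.quot `` {\<lambda>n. \<Union>a\<in>A n. ker_coset S p a} = p.cls x"
    by (simp add: p.cls_def)
qed

end

context seminormed_space
begin

lemma cls_eqD:
  assumes "pcauchy x" "pcauchy y" "cls x = cls y"
  shows "(\<lambda>n. p (x n - y n)) \<longlonglongrightarrow> 0"
proof -
  have "ns_dist banach (cls x) (cls x) = 0"
    using completion_dist[of x x] assms LIMSEQ_unique[OF _ tendsto_const] by fastforce
  then show ?thesis
    using completion_dist[OF assms(1,2)] assms(3) by simp
qed

text \<open>
  The continuous extension of a bounded functional to the completion. The limit exists since the field
  is complete, and it depends on the class only, by \<open>extension_tendsto\<close>.
\<close>

definition extension :: "('v \<Rightarrow> 'k) \<Rightarrow> (nat \<Rightarrow> 'v set) set \<Rightarrow> 'k" where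
  "extension f A = (THE r. \<exists>x. pcauchy x \<and> A = cls x \<and> (\<lambda>n. f (x n)) \<longlonglongrightarrow> r)"

context
  fixes f :: "'v \<Rightarrow> 'k" and c :: real
  assumes f: "functional_on s S f" "\<And>x. x \<in> S \<Longrightarrow> norm (f x) \<le> c * p x" and c: "0 \<le> c"
begin

lemma functional_diff: "x \<in> S \<Longrightarrow> y \<in> S \<Longrightarrow> f (x - y) = f x - f y"
proof -
  assume "x \<in> S" "y \<in> S"
  then have "f (x - y + y) = f (x - y) + f y"
    using f(1) unfolding functional_on_def by (metis S_closed(3))
  then show ?thesis by simp
qed

lemma extension_tendsto:
  assumes x: "pcauchy x"
  shows "(\<lambda>n. f (x n)) \<longlonglongrightarrow> extension f (cls x)"
proof -
  have "Cauchy (\<lambda>n. f (x n))"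
  proof (rule metric_CauchyI)
    fix e :: real assume "0 < e"
    then have "0 < e / (c + 1)" using c by simp
    then obtain M where M: "\<And>m n. m \<ge> M \<Longrightarrow> n \<ge> M \<Longrightarrow> p (x m - x n) < e / (c + 1)"
      using pcauchyE[OF x] by blast
    have "dist (f (x m)) (f (x n)) < e" if "m \<ge> M" "n \<ge> M" for m n
    proof -
      have "dist (f (x m)) (f (x n)) \<le> c * p (x m - x n)"
        using f(2)[of "x m - x n"] x by (simp add: dist_norm functional_diff)
      also have "\<dots> \<le> (c + 1) * p (x m - x n)"
        using x by (simp add: mult_right_mono)
      also have "\<dots> < e"
        using M[OF that] c by (simp add: pos_less_divide_eq mult.commute)
      finally show ?thesis .
    qed
    then show "\<exists>M. \<forall>m\<ge>M. \<forall>n\<ge>M. dist (f (x m)) (f (x n)) < e" by blast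
  qed
  then obtain r where r: "(\<lambda>n. f (x n)) \<longlonglongrightarrow> r"
    using real_or_complex_complete by (auto simp: convergent_def)
  have "extension f (cls x) = r"
    unfolding extension_def
  proof (rule the_equality)
    show "\<exists>x'. pcauchy x' \<and> cls x = cls x' \<and> (\<lambda>n. f (x' n)) \<longlonglongrightarrow> r"
      using x r by blast
    fix r' assume "\<exists>x'. pcauchy x' \<and> cls x = cls x' \<and> (\<lambda>n. f (x' n)) \<longlonglongrightarrow> r'"
    then obtain x' where x': "pcauchy x'" "cls x = cls x'" "(\<lambda>n. f (x' n)) \<longlonglongrightarrow> r'" by blast
    have "(\<lambda>n. f (x n) - f (x' n)) \<longlonglongrightarrow> 0"
    proof (rule Lim_null_comparison)
      show "(\<lambda>n. c * p (x n - x' n)) \<longlonglongrightarrow> 0"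
        using tendsto_mult_left[OF cls_eqD[OF x x'(1,2)], of c] by simp
      show "\<forall>\<^sub>F n in sequentially. norm (f (x n) - f (x' n)) \<le> c * p (x n - x' n)"
        using f(2)[of "x n - x' n" for n] x x' by (simp add: functional_diff)
    qed
    from tendsto_add[OF this x'(3)] have "(\<lambda>n. f (x n)) \<longlonglongrightarrow> r'" by simp
    then show "r' = r" using r by (rule LIMSEQ_unique)
  qed
  with r show ?thesis by simp
qed

lemma extension_bound:
  assumes "pcauchy x"
  shows "norm (extension f (cls x)) \<le> c * ns_norm banach (cls x)"
  by (rule LIMSEQ_le[OF tendsto_norm[OF extension_tendsto] tendsto_mult_left[OF completion_norm_tendsto]])
     (use assms f(2) in auto)

lemma extension_dual: "extension f \<in> ns_dual banach"
proof -
  have "extension f (cls (\<lambda>n. x n + y n)) = extension f (cls x) + extension f (cls y)"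
    if "pcauchy x" "pcauchy y" for x y
  proof (rule LIMSEQ_unique[OF extension_tendsto])
    show "(\<lambda>n. f (x n + y n)) \<longlonglongrightarrow> extension f (cls x) + extension f (cls y)"
      using tendsto_add[OF that[THEN extension_tendsto]] f(1) that by (simp add: functional_on_def)
  qed (use that in \<open>auto intro: pcauchy_add\<close>)
  moreover have "extension f (cls (\<lambda>n. s a (x n))) = a * extension f (cls x)"
    if "pcauchy x" for a x
  proof (rule LIMSEQ_unique[OF extension_tendsto])
    show "(\<lambda>n. f (s a (x n))) \<longlonglongrightarrow> a * extension f (cls x)"
      using tendsto_mult_left[OF extension_tendsto[OF that], of a] f(1) that by (simp add: functional_on_def)
  qed (use that in \<open>auto intro: pcauchy_scale\<close>)
  ultimately show ?thesis
    using extension_bound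
    by (auto simp: ns_dual_def carrier_completion completion_add completion_smul intro!: exI[of _ c])
qed

end

lemma dual_norm_set:
  assumes "g \<in> ns_dual banach"
  shows "bdd_above {norm (g A) |A. A \<in> ns_carrier banach \<and> ns_norm banach A \<le> 1}"
proof -
  obtain C where C: "\<And>A. A \<in> ns_carrier banach \<Longrightarrow> norm (g A) \<le> C * ns_norm banach A"
    using assms unfolding ns_dual_def by blast
  have "norm (g A) \<le> \<bar>C\<bar>" if A: "A \<in> ns_carrier banach" "ns_norm banach A \<le> 1" for A
  proof -
    have "0 \<le> ns_norm banach A"
      using A completion_norm_nonneg by (auto simp: carrier_completion)
    then have "C * ns_norm banach A \<le> \<bar>C\<bar> * 1"
      using A by (intro mult_mono) auto
    with C[OF A(1)] show ?thesis by simp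
  qed
  then show ?thesis by (intro bdd_aboveI[where M = "\<bar>C\<bar>"]) auto
qed

lemma dual_norm_nonneg:
  assumes "g \<in> ns_dual banach"
  shows "0 \<le> ns_dual_norm banach g"
  unfolding ns_dual_norm_def
proof (rule cSup_upper2[OF _ _ dual_norm_set[OF assms]])
  show "norm (g (cls (\<lambda>_. 0))) \<in> {norm (g A) |A. A \<in> ns_carrier banach \<and> ns_norm banach A \<le> 1}"
    using completion_norm_const[of 0] pcauchy_const[of 0] by (auto simp: carrier_completion)
qed simp

lemma dual_norm_le:
  assumes "\<And>x. pcauchy x \<Longrightarrow> norm (g (cls x)) \<le> c * ns_norm banach (cls x)" "0 \<le> c"
  shows "ns_dual_norm banach g \<le> c"
  unfolding ns_dual_norm_def
proof (rule cSup_least)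
  show "{norm (g A) |A. A \<in> ns_carrier banach \<and> ns_norm banach A \<le> 1} \<noteq> {}"
    using completion_norm_const[of 0] pcauchy_const[of 0]
    by (auto simp: carrier_completion intro!: exI[of _ "cls (\<lambda>_. 0)"])
  fix r assume "r \<in> {norm (g A) |A. A \<in> ns_carrier banach \<and> ns_norm banach A \<le> 1}"
  then obtain x where "pcauchy x" "ns_norm banach (cls x) \<le> 1" "r = norm (g (cls x))"
    by (auto simp: carrier_completion)
  then show "r \<le> c"
    using assms(1)[of x] mult_left_mono[of "ns_norm banach (cls x)" 1 c] assms(2) by simp
qed

text \<open>
  If \<open>p x\<close> is not zero, scale \<open>x\<close> into the unit ball. If it is zero, the supremum that defines the
  dual norm says nothing about \<open>x\<close>, but boundedness of \<open>g\<close> makes \<open>g\<close> vanish there.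
\<close>

lemma dual_norm_bound:
  assumes g: "g \<in> ns_dual banach" and x: "x \<in> S"
  shows "norm (g (cls (\<lambda>_. x))) \<le> ns_dual_norm banach g * p x"
proof (cases "p x = 0")
  case True
  obtain C where "\<And>A. A \<in> ns_carrier banach \<Longrightarrow> norm (g A) \<le> C * ns_norm banach A"
    using g unfolding ns_dual_def by blast
  then have "norm (g (cls (\<lambda>_. x))) \<le> C * ns_norm banach (cls (\<lambda>_. x))"
    using pcauchy_const[OF x] unfolding carrier_completion by blast
  with True completion_norm_const[OF x] show ?thesis by simp
next
  case False
  with x have pos: "0 < p x" using nonneg[of x] by linarith
  define a :: 'k where "a = of_real (1 / p x)"
  have a: "norm a = 1 / p x" using pos unfolding a_def norm_of_real by simp
  have "g (ns_smul banach a (cls (\<lambda>_. x))) = a * g (cls (\<lambda>_. x))"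
    using g pcauchy_const[OF x] unfolding ns_dual_def carrier_completion by blast
  then have eq: "g (cls (\<lambda>_. s a x)) = a * g (cls (\<lambda>_. x))"
    using pcauchy_const[OF x] by (simp add: completion_smul)
  have "norm (g (cls (\<lambda>_. s a x))) \<le> ns_dual_norm banach g"
    unfolding ns_dual_norm_def
  proof (rule cSup_upper[OF _ dual_norm_set[OF g]])
    show "norm (g (cls (\<lambda>_. s a x))) \<in> {norm (g A) |A. A \<in> ns_carrier banach \<and> ns_norm banach A \<le> 1}"
      using completion_norm_const[of "s a x"] pcauchy_const[of "s a x"] x a pos
      by (auto simp: carrier_completion)
  qed
  then have "norm (g (cls (\<lambda>_. x))) / p x \<le> ns_dual_norm banach g"
    by (simp add: eq norm_mult a)
  then show ?thesis using pos by (simp add: pos_divide_le_eq)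
qed

end

context seminormed_pair
begin

text \<open>
  The functionals extend to the completion. An element of the completion is close to some vector
  \<open>y K\<close> of the space, for which the expansion is known; the errors in the coefficients are
  controlled uniformly in the number of terms, since \<open>c i * p (e i)\<close> is summable.
\<close>

lemma strongly_nuclear_pair_imp_expansion:
  assumes "strongly_nuclear_pair s S p q"
  shows "\<exists>\<epsilon> e.
    (\<forall>i::nat. \<epsilon> i \<in> ns_dual q.banach \<and> e i \<in> ns_carrier p.banach) \<and>
    (\<forall>v\<in>ns_carrier q.banach.
       ns_sums p.banach (\<lambda>i. ns_smul p.banach (\<epsilon> i v) (e i)) (canonical_map s S p v)) \<and>
    (\<forall>\<alpha>>0. summable (\<lambda>i. (ns_dual_norm q.banach (\<epsilon> i) * ns_norm p.banach (e i)) powr \<alpha>))"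
proof -
  obtain f e c where *: "\<And>i. functional_on s S (f i)" "\<And>i. e i \<in> S" "\<And>i. 0 \<le> c i"
      "\<And>i x. x \<in> S \<Longrightarrow> norm (f i x) \<le> c i * q x" "rapidly_summable (\<lambda>i::nat. c i * p (e i))"
      "\<And>x. x \<in> S \<Longrightarrow> (\<lambda>n. p (x - (\<Sum>i<n. s (f i x) (e i)))) \<longlonglongrightarrow> 0"
    using assms unfolding strongly_nuclear_pair_def by blast
  define \<epsilon> where "\<epsilon> i = q.extension (f i)" for i
  have lim: "(\<lambda>n. f i (y n)) \<longlonglongrightarrow> \<epsilon> i (q.cls y)" if "q.pcauchy y" for y i
    unfolding \<epsilon>_def by (rule q.extension_tendsto[OF *(1,4,3) that])
  have dual: "\<epsilon> i \<in> ns_dual q.banach" for i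
    unfolding \<epsilon>_def by (rule q.extension_dual[OF *(1,4,3)])
  have dn: "ns_dual_norm q.banach (\<epsilon> i) \<le> c i" for i
    unfolding \<epsilon>_def by (rule q.dual_norm_le[OF q.extension_bound[OF *(1,4,3)] *(3)])
  have sums: "ns_sums p.banach
      (\<lambda>i. ns_smul p.banach (\<epsilon> i (q.cls y)) (p.cls (\<lambda>_. e i))) (canonical_map s S p (q.cls y))"
    if y: "q.pcauchy y" for y
    unfolding ns_sums_def
  proof (rule tendstoI)
    let ?\<epsilon> = "\<lambda>i. \<epsilon> i (q.cls y)"
    let ?D = "\<lambda>n. ns_dist p.banach (ns_partial_sum p.banach
      (\<lambda>i. ns_smul p.banach (?\<epsilon> i) (p.cls (\<lambda>_. e i))) n) (canonical_map s S p (q.cls y))"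
    fix d :: real assume d: "0 < d"
    have D: "(\<lambda>k. p ((\<Sum>i<n. s (?\<epsilon> i) (e i)) - y k)) \<longlonglongrightarrow> ?D n" for n
      using p.completion_dist[OF p.pcauchy_const pcauchy_le[OF y], of "\<Sum>i<n. s (?\<epsilon> i) (e i)"]
      by (simp add: canonical_map_cls y p.completion_smul p.pcauchy_const p.completion_partial_sum *(2))
    have summ: "summable (\<lambda>i. c i * p (e i))"
      using rapidly_summable_summable_on[OF *(5)] *(2,3) by (simp add: summable_on_UNIV_nonneg_real_iff)
    define M where "M = (\<Sum>i. c i * p (e i))"
    have M: "0 \<le> M" "(\<Sum>i<n. c i * p (e i)) \<le> M" for n
      unfolding M_def using summ *(2,3) by (auto intro!: suminf_nonneg sum_le_suminf)
    \<comment> \<open>The three errors below add up to less than \<open>(M + 3) * \<eta>\<close>.\<close>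
    define \<eta> where "\<eta> = d / (M + 3)"
    have \<eta>: "0 < \<eta>" "(M + 3) * \<eta> = d" using d M by (auto simp: \<eta>_def)
    obtain K where K: "\<And>k l. k \<ge> K \<Longrightarrow> l \<ge> K \<Longrightarrow> q (y k - y l) < \<eta>"
      using q.pcauchyE[OF y \<eta>(1)] by blast
    have f_near: "norm (?\<epsilon> i - f i (y K)) \<le> c i * \<eta>" for i
    proof (rule LIMSEQ_le_const2[OF tendsto_norm[OF tendsto_diff[OF lim[OF y, of i] tendsto_const]]])
      have "norm (f i (y k) - f i (y K)) \<le> c i * \<eta>" if "k \<ge> K" for k
      proof -
        have "norm (f i (y k) - f i (y K)) = norm (f i (y k - y K))"
          using q.functional_diff[OF *(1,4,3)] y by simp
        also have "\<dots> \<le> c i * q (y k - y K)" using *(4) y by simp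
        also have "\<dots> \<le> c i * \<eta>"
          using K[OF that, of K] *(3) by (intro mult_left_mono) auto
        finally show ?thesis .
      qed
      then show "\<exists>N. \<forall>k\<ge>N. norm (f i (y k) - f i (y K)) \<le> c i * \<eta>" by blast
    qed
    have bound: "?D n \<le> M * \<eta> + p (y K - (\<Sum>i<n. s (f i (y K)) (e i))) + \<eta>" for n
    proof (rule LIMSEQ_le_const2[OF D])
      have "p ((\<Sum>i<n. s (?\<epsilon> i) (e i)) - y k) \<le> M * \<eta> + p (y K - (\<Sum>i<n. s (f i (y K)) (e i))) + \<eta>"
        if "k \<ge> K" for k
      proof -
        let ?A = "\<Sum>i<n. s (?\<epsilon> i) (e i)" and ?B = "\<Sum>i<n. s (f i (y K)) (e i)"
        have "p (?A - ?B) = p (\<Sum>i<n. s (?\<epsilon> i - f i (y K)) (e i))"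
          by (simp add: sum_subtractf p.scale_left_diff_distrib)
        also have "\<dots> \<le> (\<Sum>i<n. p (s (?\<epsilon> i - f i (y K)) (e i)))"
          using *(2) by (intro p.sum_le) auto
        also have "\<dots> \<le> (\<Sum>i<n. \<eta> * (c i * p (e i)))"
        proof (rule sum_mono)
          show "p (s (?\<epsilon> i - f i (y K)) (e i)) \<le> \<eta> * (c i * p (e i))" for i
            using mult_right_mono[OF f_near[of i], of "p (e i)"] *(2) by (simp add: mult_ac)
        qed
        also have "\<dots> \<le> M * \<eta>"
          using mult_left_mono[OF M(2)[of n], of \<eta>] \<eta> by (simp add: mult_ac flip: sum_distrib_left)
        finally have 1: "p (?A - ?B) \<le> M * \<eta>" .
        have 2: "p (?B - y K) = p (y K - ?B)"
          using y *(2) by (intro p.diff_commute) auto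
        have 3: "p (y K - y k) \<le> \<eta>"
          using K[of K k] that le[of "y K - y k"] y by simp
        have "p (?A - y k) \<le> p (?A - ?B) + p (?B - y k)" "p (?B - y k) \<le> p (?B - y K) + p (y K - y k)"
          using y *(2) by (auto intro!: p.triangle_mid)
        with 1 2 3 show ?thesis by linarith
      qed
      then show "\<exists>N. \<forall>k\<ge>N. p ((\<Sum>i<n. s (?\<epsilon> i) (e i)) - y k) \<le> M * \<eta> + p (y K - (\<Sum>i<n. s (f i (y K)) (e i))) + \<eta>"
        by blast
    qed
    have "\<forall>\<^sub>F n in sequentially. p (y K - (\<Sum>i<n. s (f i (y K)) (e i))) < \<eta>"
      using order_tendstoD(2)[OF *(6)[of "y K"] \<eta>(1)] y by simp
    then show "\<forall>\<^sub>F n in sequentially. dist (?D n) 0 < d"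
    proof eventually_elim
      case (elim n)
      have "0 \<le> ?D n"
        by (rule LIMSEQ_le_const[OF D]) (use y *(2) in auto)
      moreover have "?D n < (M + 3) * \<eta>"
        using bound[of n] elim \<eta>(1) by (simp add: algebra_simps)
      ultimately show ?case by (simp add: \<eta>(2) dist_real_def)
    qed
  qed
  have rs: "rapidly_summable (\<lambda>i. ns_dual_norm q.banach (\<epsilon> i) * ns_norm p.banach (p.cls (\<lambda>_. e i)))"
    by (rule rapidly_summable_bound[OF *(5), where C = 1])
       (use *(2,3) dn q.dual_norm_nonneg[OF dual] in \<open>auto simp: p.completion_norm_const intro!: mult_right_mono\<close>)
  have "p.cls (\<lambda>_. e i) \<in> ns_carrier p.banach" for i
    using p.pcauchy_const[OF *(2)] unfolding p.carrier_completion by blast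
  with dual sums rs show ?thesis
    by (intro exI[of _ \<epsilon>] exI[of _ "\<lambda>i. p.cls (\<lambda>_. e i)"])
       (auto simp: q.carrier_completion rapidly_summable_def summable_on_UNIV_nonneg_real_iff)
qed

end

context seminormed_space
begin

text \<open>
  The partial sums \<open>u k\<close> of a series of vectors of the space that converges to the class of \<open>y\<close>. It
  matters that the errors are relative to the norm of that class: so the terms of the series are bounded
  by multiples of this norm and vanish with it.
\<close>

lemma completion_approximation:
  assumes y: "pcauchy y"
  obtains u where "u 0 = 0" "\<And>k. u k \<in> S"
    "\<And>k. ns_norm banach (cls (\<lambda>n. y n - u k)) \<le> ns_norm banach (cls y) * (1/2) ^ k"
proof -
  define d where "d = ns_norm banach (cls y)"
  have "\<exists>u\<in>S. ns_norm banach (cls (\<lambda>n. y n - u)) \<le> d * (1/2) ^ k \<and> (k = 0 \<longrightarrow> u = 0)" for k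
  proof (cases "k = 0 \<or> d = 0")
    case True
    then show ?thesis by (intro bexI[of _ 0]) (auto simp: d_def)
  next
    case False
    then have "0 < d * (1/2) ^ k"
      using completion_norm_nonneg[OF y] by (simp add: d_def)
    then obtain M where M: "\<And>m n. m \<ge> M \<Longrightarrow> n \<ge> M \<Longrightarrow> p (y m - y n) < d * (1/2) ^ k"
      using pcauchyE[OF y] by blast
    have "ns_norm banach (cls (\<lambda>n. y n - y M)) \<le> d * (1/2) ^ k"
    proof (rule LIMSEQ_le_const2[OF completion_norm_tendsto])
      show "\<exists>N. \<forall>n\<ge>N. p (y n - y M) \<le> d * (1/2) ^ k"
        using M by (intro exI[of _ M]) (auto intro: less_imp_le)
    qed (use y in \<open>auto intro!: pcauchy_diff pcauchy_const\<close>)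
    with False y show ?thesis by (intro bexI[of _ "y M"]) auto
  qed
  then obtain u where "\<And>k. u k \<in> S" "\<And>k. k = 0 \<longrightarrow> u k = 0"
      "\<And>k. ns_norm banach (cls (\<lambda>n. y n - u k)) \<le> d * (1/2) ^ k"
    by metis
  with that show thesis by (auto simp: d_def)
qed

lemma completion_norm_triangle:
  assumes "pcauchy y" "u \<in> S" "v \<in> S"
  shows "p (u - v) \<le> ns_norm banach (cls (\<lambda>n. y n - u)) + ns_norm banach (cls (\<lambda>n. y n - v))"
proof (rule LIMSEQ_le_const[OF tendsto_add[OF completion_norm_tendsto completion_norm_tendsto]])
  have "p (u - v) \<le> p (y n - u) + p (y n - v)" for n
    using triangle_mid[of u "y n" v] diff_commute[of u "y n"] assms by simp
  then show "\<exists>N. \<forall>n\<ge>N. p (u - v) \<le> p (y n - u) + p (y n - v)" by blast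
qed (use assms in \<open>auto intro!: pcauchy_diff pcauchy_const\<close>)

end

context seminormed_pair
begin

text \<open>
  Every vector \<open>e i\<close> of the completion is replaced by a series of vectors \<open>w (i, k)\<close> of the space
  with seminorms at most \<open>2 * d i * (1/2) ^ k\<close>, where \<open>d i\<close> is the norm of \<open>e i\<close>. The new
  coefficients are still summable to every power because a product of such a sequence with a geometric
  one is. Over the square of side \<open>m\<close> the inner sums telescope to \<open>u i m\<close>, whose distance from
  \<open>e i\<close> is at most \<open>d i * (1/2) ^ m\<close>.
\<close>

lemma expansion_imp_strongly_nuclear_pair:
  assumes dual: "\<And>i::nat. \<epsilon> i \<in> ns_dual q.banach"
    and e: "\<And>i. e i \<in> ns_carrier p.banach"
    and sums: "\<And>v. v \<in> ns_carrier q.banach \<Longrightarrow>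
       ns_sums p.banach (\<lambda>i. ns_smul p.banach (\<epsilon> i v) (e i)) (canonical_map s S p v)"
    and summ: "\<And>\<alpha>. 0 < \<alpha> \<Longrightarrow> summable (\<lambda>i. (ns_dual_norm q.banach (\<epsilon> i) * ns_norm p.banach (e i)) powr \<alpha>)"
  shows "strongly_nuclear_pair s S p q"
proof -
  let ?N = "\<lambda>y. ns_norm p.banach (p.cls y)"
  define f where "f i x = \<epsilon> i (q.cls (\<lambda>_. x))" for i x
  define c where "c i = ns_dual_norm q.banach (\<epsilon> i)" for i
  have cls_q: "q.cls (\<lambda>_. x) \<in> ns_carrier q.banach" if "x \<in> S" for x
    using q.pcauchy_const[OF that] unfolding q.carrier_completion by blast
  have \<epsilon>: "A \<in> ns_carrier q.banach \<Longrightarrow> B \<in> ns_carrier q.banach \<Longrightarrow>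
        \<epsilon> i (ns_add q.banach A B) = \<epsilon> i A + \<epsilon> i B"
      "A \<in> ns_carrier q.banach \<Longrightarrow> \<epsilon> i (ns_smul q.banach a A) = a * \<epsilon> i A" for i A B a
    using dual[of i] unfolding ns_dual_def by simp_all
  have f: "functional_on s S (f i)" for i
    unfolding functional_on_def
  proof (intro conjI ballI allI)
    fix x y assume "x \<in> S" "y \<in> S"
    then have "\<epsilon> i (ns_add q.banach (q.cls (\<lambda>_. x)) (q.cls (\<lambda>_. y))) = f i x + f i y"
      by (simp add: \<epsilon>(1) cls_q f_def)
    with \<open>x \<in> S\<close> \<open>y \<in> S\<close> show "f i (x + y) = f i x + f i y"
      by (simp add: f_def q.completion_add q.pcauchy_const)
  next
    fix a x assume "x \<in> S"
    then have "\<epsilon> i (ns_smul q.banach a (q.cls (\<lambda>_. x))) = a * f i x"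
      by (simp add: \<epsilon>(2) cls_q f_def)
    with \<open>x \<in> S\<close> show "f i (s a x) = a * f i x"
      by (simp add: f_def q.completion_smul q.pcauchy_const)
  qed
  have c: "0 \<le> c i" and fc: "x \<in> S \<Longrightarrow> norm (f i x) \<le> c i * q x" for i x
    unfolding c_def f_def by (rule q.dual_norm_nonneg[OF dual], rule q.dual_norm_bound[OF dual])
  have "\<forall>i. \<exists>y. p.pcauchy y \<and> e i = p.cls y"
    using e by (auto simp: p.carrier_completion)
  then obtain y where y: "\<And>i. p.pcauchy (y i)" "\<And>i. e i = p.cls (y i)" by metis
  define d where "d i = ?N (y i)" for i
  have d: "0 \<le> d i" for i using p.completion_norm_nonneg[OF y(1)] by (simp add: d_def)
  have "\<forall>i. \<exists>u. u 0 = 0 \<and> (\<forall>k. u k \<in> S) \<and> (\<forall>k. ?N (\<lambda>n. y i n - u k) \<le> d i * (1/2) ^ k)"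
    using p.completion_approximation[OF y(1)] unfolding d_def by metis
  then obtain u where u: "\<And>i. u i 0 = 0" "\<And>i k. u i k \<in> S" "\<And>i k. ?N (\<lambda>n. y i n - u i k) \<le> d i * (1/2) ^ k"
    by metis
  define w where "w ik = u (fst ik) (Suc (snd ik)) - u (fst ik) (snd ik)" for ik
  have w: "w ik \<in> S" for ik using u(2) by (simp add: w_def)
  have pw: "p (w (i, k)) \<le> 2 * d i * (1/2) ^ k" for i k
  proof -
    have "p (w (i, k)) \<le> d i * (1/2) ^ Suc k + d i * (1/2) ^ k"
      using p.completion_norm_triangle[of "y i" "u i (Suc k)" "u i k"] u(3)[of i "Suc k"] u(3)[of i k] y(1) u(2)
      by (simp add: w_def)
    also have "\<dots> \<le> 2 * d i * (1/2) ^ k" using d[of i] by simp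
    finally show ?thesis .
  qed
  have rapid: "rapidly_summable (\<lambda>i. c i * d i)"
    using summ by (simp add: rapidly_summable_def summable_on_UNIV_nonneg_real_iff c_def d_def y(2))
  have rapid2: "rapidly_summable (\<lambda>ik. c (fst ik) * (2 * d (fst ik) * (1/2) ^ snd ik))"
    unfolding rapidly_summable_def
  proof (intro allI impI)
    fix \<alpha> :: real assume \<alpha>: "0 < \<alpha>"
    define r :: real where "r = (1/2) powr \<alpha>"
    have r: "0 \<le> r" "r < 1" using \<alpha> powr_less_mono2[of \<alpha> "1/2" 1] by (auto simp: r_def)
    have rk: "((1/2) ^ k) powr \<alpha> = r ^ k" for k :: nat
      by (simp add: r_def powr_powr mult.commute flip: powr_realpow)
    have eq: "(c i * (2 * d i * (1/2) ^ k)) powr \<alpha> = (2 powr \<alpha> * (c i * d i) powr \<alpha>) * r ^ k" for i k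
      using c[of i] d[of i] by (simp add: powr_mult rk mult_ac)
    have "(\<lambda>ik. (c (fst ik) * (2 * d (fst ik) * (1/2) ^ snd ik)) powr \<alpha>) summable_on Sigma UNIV (\<lambda>_. UNIV)"
    proof (rule summable_on_SigmaI)
      fix i
      have "(\<lambda>k. r ^ k) sums (1 / (1 - r))" using r by (intro geometric_sums) simp
      then have "((\<lambda>k. r ^ k) has_sum (1 / (1 - r))) UNIV"
        using r by (intro norm_summable_imp_has_sum) (auto simp: summable_geometric)
      from has_sum_cmult_right[OF this]
      show "((\<lambda>k. (c (fst (i, k)) * (2 * d (fst (i, k)) * (1/2) ^ snd (i, k))) powr \<alpha>) has_sum
          (2 powr \<alpha> * (c i * d i) powr \<alpha>) * (1 / (1 - r))) UNIV"
        by (simp add: eq)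
    next
      show "(\<lambda>i. (2 powr \<alpha> * (c i * d i) powr \<alpha>) * (1 / (1 - r))) summable_on UNIV"
        using rapid \<alpha> unfolding rapidly_summable_def by (intro summable_on_cmult_left summable_on_cmult_right) auto
    qed auto
    then show "(\<lambda>ik. (c (fst ik) * (2 * d (fst ik) * (1/2) ^ snd ik)) powr \<alpha>) summable_on UNIV" by simp
  qed
  have rapid3: "rapidly_summable (\<lambda>ik. c (fst ik) * p (w ik))"
    by (rule rapidly_summable_bound[OF rapid2, where C = 1])
       (use c d w pw in \<open>auto intro!: mult_left_mono mult_nonneg_nonneg\<close>)
  have lim: "(\<lambda>m. p (x - (\<Sum>ik\<in>{..<m} \<times> {..<m}. s (f (fst ik) x) (w ik)))) \<longlonglongrightarrow> 0" if x: "x \<in> S" for x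
  proof -
    let ?D = "\<lambda>n. ns_dist p.banach (ns_partial_sum p.banach
      (\<lambda>i. ns_smul p.banach (f i x) (e i)) n) (p.cls (\<lambda>_. x))"
    have D0: "?D \<longlonglongrightarrow> 0"
      using sums[of "q.cls (\<lambda>_. x)"] q.pcauchy_const[OF x]
      unfolding ns_sums_def f_def by (auto simp: q.carrier_completion canonical_map_cls)
    have D: "(\<lambda>k. p ((\<Sum>i<n. s (f i x) (y i k)) - x)) \<longlonglongrightarrow> ?D n" for n
    proof -
      have "p.pcauchy (\<lambda>k. \<Sum>i<n. s (f i x) (y i k))"
        using y(1) by (intro p.pcauchy_sum p.pcauchy_scale)
      from p.completion_dist[OF this p.pcauchy_const[OF x]] show ?thesis
        using y(1) by (simp add: y(2) p.completion_smul p.completion_partial_sum p.pcauchy_scale)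
    qed
    have summable: "summable (\<lambda>i. c i * d i)"
      using rapidly_summable_summable_on[OF rapid] c d by (simp add: summable_on_UNIV_nonneg_real_iff)
    define M where "M = (\<Sum>i. c i * d i)"
    have M: "0 \<le> M" "(\<Sum>i<n. c i * d i) \<le> M" for n
      unfolding M_def using summable c d by (auto intro!: suminf_nonneg sum_le_suminf)
    have tele: "(\<Sum>ik\<in>{..<m} \<times> {..<m}. s (f (fst ik) x) (w ik)) = (\<Sum>i<m. s (f i x) (u i m))" for m
    proof -
      have "(\<Sum>ik\<in>{..<m} \<times> {..<m}. s (f (fst ik) x) (w ik)) = (\<Sum>i<m. \<Sum>k<m. s (f i x) (w (i, k)))"
        by (simp add: sum.cartesian_product case_prod_unfold)
      also have "\<dots> = (\<Sum>i<m. s (f i x) (\<Sum>k<m. u i (Suc k) - u i k))"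
        by (simp add: w_def p.scale_sum_right)
      also have "\<dots> = (\<Sum>i<m. s (f i x) (u i m))"
        by (simp add: sum_lessThan_telescope u(1))
      finally show ?thesis .
    qed
    have bound: "p (x - (\<Sum>i<m. s (f i x) (u i m))) \<le> ?D m + M * q x * (1/2) ^ m" for m
    proof -
      have "p (x - (\<Sum>i<m. s (f i x) (u i m))) \<le> ?D m + (\<Sum>i<m. norm (f i x) * ?N (\<lambda>n. y i n - u i m))"
      proof (rule LIMSEQ_le_const)
        show "(\<lambda>k. p ((\<Sum>i<m. s (f i x) (y i k)) - x) + (\<Sum>i<m. norm (f i x) * p (y i k - u i m)))
            \<longlonglongrightarrow> ?D m + (\<Sum>i<m. norm (f i x) * ?N (\<lambda>n. y i n - u i m))"
          using y u by (intro tendsto_add D tendsto_sum tendsto_mult_left p.completion_norm_tendsto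
            p.pcauchy_diff p.pcauchy_const) auto
        have "p (x - (\<Sum>i<m. s (f i x) (u i m))) \<le>
            p ((\<Sum>i<m. s (f i x) (y i k)) - x) + (\<Sum>i<m. norm (f i x) * p (y i k - u i m))" for k
        proof -
          let ?Y = "\<Sum>i<m. s (f i x) (y i k)" and ?U = "\<Sum>i<m. s (f i x) (u i m)"
          have S: "?Y \<in> S" "?U \<in> S" using y u by auto
          have "p (?Y - ?U) = p (\<Sum>i<m. s (f i x) (y i k - u i m))"
            by (simp add: sum_subtractf p.scale_right_diff_distrib)
          also have "\<dots> \<le> (\<Sum>i<m. p (s (f i x) (y i k - u i m)))"
            using y u by (intro p.sum_le) auto
          also have "\<dots> = (\<Sum>i<m. norm (f i x) * p (y i k - u i m))"
            using y u by (intro sum.cong) auto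
          finally show ?thesis
            using p.triangle_mid[of x ?Y ?U] p.diff_commute[of x ?Y] x S by linarith
        qed
        then show "\<exists>N. \<forall>k\<ge>N. p (x - (\<Sum>i<m. s (f i x) (u i m))) \<le>
            p ((\<Sum>i<m. s (f i x) (y i k)) - x) + (\<Sum>i<m. norm (f i x) * p (y i k - u i m))" by blast
      qed
      also have "(\<Sum>i<m. norm (f i x) * ?N (\<lambda>n. y i n - u i m)) \<le> (\<Sum>i<m. (c i * q x) * (d i * (1/2) ^ m))"
        using fc[OF x] u(3) d c x y u
        by (intro sum_mono mult_mono p.completion_norm_nonneg p.pcauchy_diff p.pcauchy_const) auto
      also have "\<dots> = (\<Sum>i<m. c i * d i) * (q x * (1/2) ^ m)"
        unfolding sum_distrib_right by (simp add: mult_ac)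
      also have "\<dots> \<le> M * (q x * (1/2) ^ m)"
        using M x by (intro mult_right_mono) auto
      finally show ?thesis by (simp add: mult_ac)
    qed
    have "(\<lambda>m. ?D m + M * q x * (1/2) ^ m) \<longlonglongrightarrow> 0 + M * q x * 0"
      by (intro tendsto_add D0 tendsto_mult_left LIMSEQ_realpow_zero) auto
    then have lim0: "(\<lambda>m. ?D m + M * q x * (1/2) ^ m) \<longlonglongrightarrow> 0" by simp
    show ?thesis
      unfolding tele by (rule tendsto_sandwich[OF _ _ tendsto_const lim0]) (use bound x u in auto)
  qed
  show ?thesis
  proof (rule strongly_nuclear_pair_indexed[OF p.seminormed_space_axioms bij_prod_decode _ _ w _ _ rapid3])
    show "functional_on s S (f (fst ik))" for ik :: "nat \<times> nat" by (rule f)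
    show "\<forall>\<^sub>F m in sequentially. ik \<in> {..<m} \<times> {..<m}" for ik :: "nat \<times> nat"
      by (cases ik) (auto simp: eventually_sequentially intro!: exI[of _ "Suc (max (fst ik) (snd ik))"])
  qed (use c fc lim in simp_all)
qed

end

lemma continuous_seminorm_add:
  assumes "continuous_seminorm s X p" "continuous_seminorm s X q"
  shows "continuous_seminorm s X (\<lambda>x. p x + q x)"
  unfolding continuous_seminorm_def
proof
  have "p (x + y) + q (x + y) \<le> (p x + q x) + (p y + q y)" if "x \<in> topspace X" "y \<in> topspace X" for x y
    using assms add_mono[of "p (x + y)" "p x + p y" "q (x + y)" "q x + q y"] that
    by (simp add: continuous_seminorm_def seminorm_on_def add_ac)
  then show "seminorm_on s (topspace X) (\<lambda>x. p x + q x)"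
    using assms by (simp add: continuous_seminorm_def seminorm_on_def distrib_left)
  show "continuous_map X euclideanreal (\<lambda>x. p x + q x)"
    using assms unfolding continuous_seminorm_def by (intro continuous_map_add) simp_all
qed

text \<open>
  For the direction from right to left, the required inequality between \<open>p\<close> and \<open>q\<close> is achieved by
  adding \<open>p\<close> to \<open>q\<close>, which preserves the pair.
\<close>

theorem strongly_nuclear_iff_pairs:
  fixes s :: "'k::real_or_complex \<Rightarrow> 'v::ab_group_add \<Rightarrow> 'v"
  assumes vs: "vector_space s" and sub: "module.subspace s (topspace X)"
    and B: "\<And>b. b \<in> B \<Longrightarrow> continuous_seminorm s X b"
    and cofinal: "\<And>p. continuous_seminorm s X p \<Longrightarrow> \<exists>b\<in>B. \<exists>C\<ge>0. \<forall>x\<in>topspace X. p x \<le> C * b x"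
  shows "strongly_nuclear s X \<longleftrightarrow> (\<forall>b\<in>B. \<exists>b'\<in>B. strongly_nuclear_pair s (topspace X) b b')"
proof -
  have space: "seminormed_space s (topspace X) p" if "continuous_seminorm s X p" for p
    using vs sub that by (simp add: seminormed_space_def seminormed_space_axioms_def continuous_seminorm_def)
  have pair: "seminormed_pair s (topspace X) p q"
    if "continuous_seminorm s X p" "continuous_seminorm s X q" "\<forall>x\<in>topspace X. p x \<le> q x" for p q
    using space[OF that(1)] space[OF that(2)] that(3)
    by (simp add: seminormed_pair_def seminormed_pair_axioms_def)
  show ?thesis
  proof (intro iffI ballI)
    fix b assume sn: "strongly_nuclear s X" and b: "b \<in> B"
    obtain q \<epsilon> e where q: "continuous_seminorm s X q" "\<forall>x\<in>topspace X. b x \<le> q x"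
      and E: "\<forall>i::nat. \<epsilon> i \<in> ns_dual (seminorm_banach s (topspace X) q) \<and>
          e i \<in> ns_carrier (seminorm_banach s (topspace X) b)"
        "\<forall>v\<in>ns_carrier (seminorm_banach s (topspace X) q).
          ns_sums (seminorm_banach s (topspace X) b)
            (\<lambda>i. ns_smul (seminorm_banach s (topspace X) b) (\<epsilon> i v) (e i)) (canonical_map s (topspace X) b v)"
        "\<forall>\<alpha>>0. summable (\<lambda>i. (ns_dual_norm (seminorm_banach s (topspace X) q) (\<epsilon> i) *
          ns_norm (seminorm_banach s (topspace X) b) (e i)) powr \<alpha>)"
      using sn[unfolded strongly_nuclear_def Let_def, THEN spec, THEN mp, OF B[OF b]]
      by (elim exE conjE) (rule that)
    have bq: "strongly_nuclear_pair s (topspace X) b q"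
      by (rule seminormed_pair.expansion_imp_strongly_nuclear_pair[OF pair[OF B[OF b] q], where \<epsilon> = \<epsilon> and e = e])
         (use E in blast)+
    obtain b' C where b': "b' \<in> B" "0 \<le> C" "\<And>x. x \<in> topspace X \<Longrightarrow> q x \<le> C * b' x"
      using cofinal[OF q(1)] by blast
    have "strongly_nuclear_pair s (topspace X) b b'"
      by (rule strongly_nuclear_pair_mono[OF bq space[OF B[OF b]] space[OF B[OF b]], where C = 1 and C' = C])
         (use b' in auto)
    with b' show "\<exists>b'\<in>B. strongly_nuclear_pair s (topspace X) b b'" by blast
  next
    assume H: "\<forall>b\<in>B. \<exists>b'\<in>B. strongly_nuclear_pair s (topspace X) b b'"
    show "strongly_nuclear s X"
      unfolding strongly_nuclear_def Let_def
    proof (intro allI impI)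
      fix p assume p: "continuous_seminorm s X p"
      obtain b C where b: "b \<in> B" "0 \<le> C" "\<And>x. x \<in> topspace X \<Longrightarrow> p x \<le> C * b x"
        using cofinal[OF p] by blast
      obtain b' where b': "b' \<in> B" "strongly_nuclear_pair s (topspace X) b b'"
        using H b(1) by blast
      interpret p: seminormed_space s "topspace X" p by (rule space[OF p])
      interpret b': seminormed_space s "topspace X" b' by (rule space[OF B[OF b'(1)]])
      define q where "q x = b' x + p x" for x
      have q: "continuous_seminorm s X q"
        unfolding q_def by (rule continuous_seminorm_add[OF B[OF b'(1)] p])
      have pq: "strongly_nuclear_pair s (topspace X) p q"
        by (rule strongly_nuclear_pair_mono[OF b'(2) space[OF B[OF b(1)]] space[OF p], where C = C and C' = 1])
           (use b in \<open>auto simp: q_def\<close>)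
      show "\<exists>q. continuous_seminorm s X q \<and> (\<forall>x\<in>topspace X. p x \<le> q x) \<and>
          (\<exists>\<epsilon> e. (\<forall>i::nat. \<epsilon> i \<in> ns_dual (seminorm_banach s (topspace X) q) \<and>
                 e i \<in> ns_carrier (seminorm_banach s (topspace X) p)) \<and>
             (\<forall>v\<in>ns_carrier (seminorm_banach s (topspace X) q).
                ns_sums (seminorm_banach s (topspace X) p)
                  (\<lambda>i. ns_smul (seminorm_banach s (topspace X) p) (\<epsilon> i v) (e i)) (canonical_map s (topspace X) p v)) \<and>
             (\<forall>\<alpha>>0. summable (\<lambda>i. (ns_dual_norm (seminorm_banach s (topspace X) q) (\<epsilon> i) *
                ns_norm (seminorm_banach s (topspace X) p) (e i)) powr \<alpha>)))"
      proof (intro exI[of _ q] conjI q ballI)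
        show "p x \<le> q x" if "x \<in> topspace X" for x using that by (simp add: q_def)
        then have "seminormed_pair s (topspace X) p q" by (intro pair p q) auto
        from seminormed_pair.strongly_nuclear_pair_imp_expansion[OF this pq]
        show "\<exists>\<epsilon> e. (\<forall>i::nat. \<epsilon> i \<in> ns_dual (seminorm_banach s (topspace X) q) \<and>
                 e i \<in> ns_carrier (seminorm_banach s (topspace X) p)) \<and>
             (\<forall>v\<in>ns_carrier (seminorm_banach s (topspace X) q).
                ns_sums (seminorm_banach s (topspace X) p)
                  (\<lambda>i. ns_smul (seminorm_banach s (topspace X) p) (\<epsilon> i v) (e i)) (canonical_map s (topspace X) p v)) \<and>
             (\<forall>\<alpha>>0. summable (\<lambda>i. (ns_dual_norm (seminorm_banach s (topspace X) q) (\<epsilon> i) *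
                ns_norm (seminorm_banach s (topspace X) p) (e i)) powr \<alpha>))" .
      qed
    qed
  qed
qed

section \<open>Topologies of directed families of seminorms\<close>

locale seminorm_family = vector_space s
  for s :: "'k::real_or_complex \<Rightarrow> 'v::ab_group_add \<Rightarrow> 'v" +
  fixes S :: "'v set" and P :: "('v \<Rightarrow> real) set"
  assumes subspace_S: "subspace S" and seminorms: "p \<in> P \<Longrightarrow> seminorm_on s S p" and nonempty: "P \<noteq> {}"
    and directed: "p \<in> P \<Longrightarrow> p' \<in> P \<Longrightarrow> \<exists>r\<in>P. \<forall>x\<in>S. p x \<le> r x \<and> p' x \<le> r x"
begin

lemma space: "p \<in> P \<Longrightarrow> seminormed_space s S p"
  by unfold_locales (use subspace_S seminorms in auto)

lemma topspace_seminorm_topology: "topspace (seminorm_topology S P) = S"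
  unfolding seminorm_topology_def topology_generated_by_topspace by auto

lemma openin_ball: "p \<in> P \<Longrightarrow> x \<in> S \<Longrightarrow> 0 < d \<Longrightarrow> openin (seminorm_topology S P) {y \<in> S. p (y - x) < d}"
  unfolding seminorm_topology_def by (rule topology_generated_by_Basis) blast

text \<open>
  Directedness is what makes the balls of single seminorms, instead of finite intersections of them, a
  basis of neighbourhoods.
\<close>

lemma openin_contains_ball:
  assumes "openin (seminorm_topology S P) U" "x \<in> U"
  shows "\<exists>p\<in>P. \<exists>d>0. {y \<in> S. p (y - x) < d} \<subseteq> U"
proof -
  have "generate_topology_on (insert S {{y \<in> S. p (y - x) < e} |p x e. p \<in> P \<and> x \<in> S \<and> 0 < e}) U"
    using assms(1) unfolding seminorm_topology_def openin_topology_generated_by_iff .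
  then show ?thesis
    using assms(2)
  proof (induction arbitrary: x rule: generate_topology_on.induct)
    case (Int U V)
    obtain p d where p: "p \<in> P" "0 < d" "{y \<in> S. p (y - x) < d} \<subseteq> U"
      using Int by blast
    obtain p' d' where p': "p' \<in> P" "0 < d'" "{y \<in> S. p' (y - x) < d'} \<subseteq> V"
      using Int by blast
    obtain r where r: "r \<in> P" "\<forall>x\<in>S. p x \<le> r x \<and> p' x \<le> r x"
      using directed p p' by blast
    show ?case
    proof (cases "x \<in> S")
      case True
      have "{y \<in> S. r (y - x) < min d d'} \<subseteq> U \<inter> V"
      proof
        fix y assume y: "y \<in> {y \<in> S. r (y - x) < min d d'}"
        then have "y - x \<in> S" using True subspace_S subspace_diff by blast
        with r(2) have "p (y - x) \<le> r (y - x)" "p' (y - x) \<le> r (y - x)" by blast+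
        with y have "y \<in> {y \<in> S. p (y - x) < d}" "y \<in> {y \<in> S. p' (y - x) < d'}" by auto
        with p(3) p'(3) show "y \<in> U \<inter> V" by blast
      qed
      with r(1) p(2) p'(2) show ?thesis by (intro bexI[of _ r] exI[of _ "min d d'"]) auto
    next
      case False
      have "U \<subseteq> S"
        using Int(1) openin_subset[of "seminorm_topology S P" U] topspace_seminorm_topology
        by (simp add: seminorm_topology_def openin_topology_generated_by_iff)
      with False Int.prems show ?thesis by blast
    qed
  next
    case (UN K)
    then show ?case by (meson Union_iff Sup_upper order_trans)
  next
    case (Basis U)
    obtain p0 where p0: "p0 \<in> P" using nonempty by blast
    show ?case
    proof (cases "U = S")
      case True
      with p0 show ?thesis by (intro bexI[of _ p0] exI[of _ 1]) auto
    next
      case False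
      then obtain p z e where U: "U = {y \<in> S. p (y - z) < e}" "p \<in> P" "z \<in> S" "0 < e"
        using Basis(1) by blast
      interpret p: seminormed_space s S p by (rule space[OF U(2)])
      have x: "x \<in> S" "p (x - z) < e" using Basis.prems U(1) by auto
      have "{y \<in> S. p (y - x) < e - p (x - z)} \<subseteq> U"
      proof
        fix y assume y: "y \<in> {y \<in> S. p (y - x) < e - p (x - z)}"
        then have "p (y - z) \<le> p (y - x) + p (x - z)" using x U by (intro p.triangle_mid) auto
        with y show "y \<in> U" unfolding U(1) by auto
      qed
      with U(2) x(2) show ?thesis by (intro bexI[of _ p] exI[of _ "e - p (x - z)"]) auto
    qed
  qed simp
qed

lemma continuous_seminorm_family:
  assumes p: "p \<in> P"
  shows "continuous_seminorm s (seminorm_topology S P) p"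
proof -
  interpret p: seminormed_space s S p by (rule space[OF p])
  have "openin (seminorm_topology S P) {x \<in> S. p x \<in> U}" if U: "open U" for U
  proof (subst openin_subopen, intro ballI)
    fix x assume x: "x \<in> {x \<in> S. p x \<in> U}"
    then obtain d where d: "0 < d" "ball (p x) d \<subseteq> U"
      using U by (auto simp: open_contains_ball)
    have "{y \<in> S. p (y - x) < d} \<subseteq> {x \<in> S. p x \<in> U}"
    proof
      fix y assume y: "y \<in> {y \<in> S. p (y - x) < d}"
      then have "\<bar>p y - p x\<bar> < d" using p.reverse_triangle[of y x] x by simp
      then have "p y \<in> ball (p x) d" by (simp add: dist_real_def abs_minus_commute)
      with d y show "y \<in> {x \<in> S. p x \<in> U}" by blast
    qed
    moreover have "x \<in> {y \<in> S. p (y - x) < d}" using x d by simp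
    ultimately show "\<exists>T. openin (seminorm_topology S P) T \<and> x \<in> T \<and> T \<subseteq> {x \<in> S. p x \<in> U}"
      using openin_ball[OF p _ d(1), of x] x by blast
  qed
  then have "continuous_map (seminorm_topology S P) euclideanreal p"
    by (simp add: continuous_map topspace_seminorm_topology)
  then show ?thesis
    using seminorms[OF p] by (simp add: continuous_seminorm_def topspace_seminorm_topology)
qed

lemma topspace_subtopology_seminorm: "S' \<subseteq> S \<Longrightarrow> topspace (subtopology (seminorm_topology S P) S') = S'"
  by (auto simp: topspace_seminorm_topology)

lemma continuous_seminorm_subtopology:
  assumes p: "p \<in> P" and S': "S' \<subseteq> S"
  shows "continuous_seminorm s (subtopology (seminorm_topology S P) S') p"
  using continuous_seminorm_family[OF p] S'
  unfolding continuous_seminorm_def topspace_subtopology_seminorm[OF S'] topspace_seminorm_topology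
  by (simp add: seminorm_on_def subset_iff continuous_map_from_subtopology)

text \<open>
  The unit ball of \<open>Q\<close> contains a ball of radius \<open>d\<close> for some \<open>p\<close>, and both are homogeneous, so
  \<open>Q\<close> is at most \<open>2 / d\<close> times \<open>p\<close>.
\<close>

lemma cofinal_subtopology:
  assumes Q: "continuous_seminorm s (subtopology (seminorm_topology S P) S') Q"
    and S': "subspace S'" "S' \<subseteq> S"
  shows "\<exists>p\<in>P. \<exists>C\<ge>0. \<forall>x\<in>topspace (subtopology (seminorm_topology S P) S'). Q x \<le> C * p x"
proof -
  have top: "topspace (subtopology (seminorm_topology S P) S') = S'"
    by (rule topspace_subtopology_seminorm[OF S'(2)])
  interpret Q: seminormed_space s S' Q
    using Q S' unfolding continuous_seminorm_def top by unfold_locales blast+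
  have "openin (subtopology (seminorm_topology S P) S') {x \<in> S'. Q x \<in> {..<1}}"
    using Q unfolding continuous_seminorm_def continuous_map top by (metis open_lessThan open_openin)
  then obtain U where U: "openin (seminorm_topology S P) U" "{x \<in> S'. Q x \<in> {..<1}} = U \<inter> S'"
    unfolding openin_subtopology by blast
  have "0 \<in> U" using U(2) Q.S_closed(1) Q.zero by (metis (mono_tags, lifting) Int_iff lessThan_iff mem_Collect_eq zero_less_one)
  then obtain p d where p: "p \<in> P" "0 < d" "{y \<in> S. p (y - 0) < d} \<subseteq> U"
    using openin_contains_ball[OF U(1)] by blast
  interpret p: seminormed_space s S p by (rule space[OF p(1)])
  have "Q x \<le> 2 / d * p x" if x: "x \<in> S'" for x
  proof (rule field_le_epsilon)
    fix \<eta> :: real assume "0 < \<eta>"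
    have xS: "x \<in> S" using x S' by blast
    \<comment> \<open>The summand \<open>h\<close> keeps the denominator positive if \<open>p x = 0\<close>, and contributes \<open>\<eta>\<close> to \<open>1 / r\<close>.\<close>
    define h where "h = \<eta> * d / 2"
    define r where "r = d / (2 * (p x + h))"
    have pos: "0 < p x + h" using \<open>0 < \<eta>\<close> p(2) xS by (simp add: h_def add_nonneg_pos)
    then have r: "0 < r" using p(2) by (simp add: r_def)
    have "p x < 2 * (p x + h)" using p.nonneg[OF xS] \<open>0 < \<eta>\<close> p(2) by (simp add: h_def add_nonneg_pos)
    then have "r * p x < d" using pos p(2) by (simp add: r_def pos_divide_less_eq)
    moreover have "p (s (of_real r) x) = r * p x" "Q (s (of_real r) x) = r * Q x"
      using r x xS by simp_all
    ultimately have "s (of_real r) x \<in> {y \<in> S. p (y - 0) < d}" using xS r by simp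
    then have "s (of_real r) x \<in> U \<inter> S'" using p(3) x by auto
    then have "Q (s (of_real r) x) < 1" using U(2) by blast
    then have "r * Q x < 1" using \<open>Q (s (of_real r) x) = r * Q x\<close> r by simp
    then have "Q x < 1 / r" using r by (simp add: pos_less_divide_eq mult.commute)
    also have "1 / r = 2 / d * p x + \<eta>" using p(2) by (simp add: r_def h_def add_divide_distrib distrib_left)
    finally show "Q x \<le> 2 / d * p x + \<eta>" by simp
  qed
  with p show ?thesis unfolding top by (intro bexI[of _ p] exI[of _ "2 / d"]) auto
qed

theorem strongly_nuclear_subtopology_iff:
  assumes S': "subspace S'" "S' \<subseteq> S"
  shows "strongly_nuclear s (subtopology (seminorm_topology S P) S') \<longleftrightarrow>
    (\<forall>p\<in>P. \<exists>q\<in>P. strongly_nuclear_pair s S' p q)"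
proof -
  have top: "topspace (subtopology (seminorm_topology S P) S') = S'"
    by (rule topspace_subtopology_seminorm[OF S'(2)])
  show ?thesis
    using strongly_nuclear_iff_pairs[OF vector_space_axioms, of "subtopology (seminorm_topology S P) S'" P,
        unfolded top, OF S'(1) continuous_seminorm_subtopology[OF _ S'(2)] cofinal_subtopology[OF _ S', unfolded top]]
    by blast
qed

theorem strongly_nuclear_family_iff:
  "strongly_nuclear s (seminorm_topology S P) \<longleftrightarrow> (\<forall>p\<in>P. \<exists>q\<in>P. strongly_nuclear_pair s S p q)"
  using strongly_nuclear_subtopology_iff[OF subspace_S order_refl]
    subtopology_topspace[of "seminorm_topology S P"] by (simp add: topspace_seminorm_topology)

end

section \<open>The projective seminorms on the tensor powers\<close>

definition tensor_representation ::
  "('k::field \<Rightarrow> 'v::ab_group_add \<Rightarrow> 'v) \<Rightarrow> nat \<Rightarrow> ('k, 'v) tens \<Rightarrow> 'v list set \<Rightarrow> ('v list \<Rightarrow> 'k) \<Rightarrow> bool" where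
  "tensor_representation smul n t A c \<longleftrightarrow>
     finite A \<and> (\<forall>vs\<in>A. length vs = n) \<and> t = (\<Sum>vs\<in>A. fscale (*) (c vs) (tensor smul vs))"

definition representation_cost :: "('v \<Rightarrow> real) \<Rightarrow> 'v list set \<Rightarrow> ('v list \<Rightarrow> 'k::real_normed_field) \<Rightarrow> real" where
  "representation_cost p A c = (\<Sum>vs\<in>A. norm (c vs) * (\<Prod>v\<leftarrow>vs. p v))"

interpretation tens: vector_space "fscale (*) :: 'k::field \<Rightarrow> ('k, 'v) tens \<Rightarrow> ('k, 'v) tens"
  by (rule vector_space_tens)

lemma tensor_in_power: "length vs = n \<Longrightarrow> tensor smul vs \<in> tensor_power smul n"
  unfolding tensor_power_def by (rule tens.span_base) auto

lemma subspace_tensor_power: "tens.subspace (tensor_power smul n)"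
  unfolding tensor_power_def by (rule tens.subspace_span)

lemma tensor_representation_zero: "tensor_representation smul n 0 {} c"
  by (simp add: tensor_representation_def)

lemma tensor_representation_tensor:
  "length vs = n \<Longrightarrow> tensor_representation smul n (fscale (*) k (tensor smul vs)) {vs} (\<lambda>_. k)"
  by (simp add: tensor_representation_def)

lemma tensor_representation_scale:
  "tensor_representation smul n t A c \<Longrightarrow> tensor_representation smul n (fscale (*) k t) A (\<lambda>vs. k * c vs)"
  by (simp add: tensor_representation_def tens.scale_sum_right)

lemma tensor_representation_add:
  assumes "tensor_representation smul n t A c" "tensor_representation smul n u B d"
  shows "tensor_representation smul n (t + u) (A \<union> B)
    (\<lambda>vs. (if vs \<in> A then c vs else 0) + (if vs \<in> B then d vs else 0))"
proof -
  have fin: "finite A" "finite B" using assms by (auto simp: tensor_representation_def)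
  have "(\<Sum>vs\<in>A. fscale (*) (c vs) (tensor smul vs)) =
      (\<Sum>vs\<in>A \<union> B. fscale (*) (if vs \<in> A then c vs else 0) (tensor smul vs))"
    using fin by (intro sum.mono_neutral_cong_left) auto
  moreover have "(\<Sum>vs\<in>B. fscale (*) (d vs) (tensor smul vs)) =
      (\<Sum>vs\<in>A \<union> B. fscale (*) (if vs \<in> B then d vs else 0) (tensor smul vs))"
    using fin by (intro sum.mono_neutral_cong_left) auto
  ultimately show ?thesis
    using assms by (auto simp: tensor_representation_def tens.scale_left_distrib sum.distrib)
qed

lemma tensor_representation_exists:
  assumes "t \<in> tensor_power smul n"
  shows "\<exists>A c. tensor_representation smul n t A c"
  using assms unfolding tensor_power_def
proof (induction rule: tens.span_induct_alt)
  case base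
  show ?case using tensor_representation_zero by blast
next
  case (step k x y)
  then show ?case using tensor_representation_tensor tensor_representation_add by blast
qed

lemma projective_power_Inf:
  "projective_power smul p n t = Inf {representation_cost p A c |A c. tensor_representation smul n t A c}"
  by (simp add: projective_power_def tensor_representation_def representation_cost_def)

locale seminormed_vector_space = seminormed_space smul UNIV p
  for smul :: "'k::real_or_complex \<Rightarrow> 'v::ab_group_add \<Rightarrow> 'v" and p
begin

lemma prod_nonneg: "0 \<le> (\<Prod>v\<leftarrow>vs. p v)"
  by (induction vs) simp_all

lemma cost_nonneg: "0 \<le> representation_cost p A c"
  unfolding representation_cost_def by (intro sum_nonneg mult_nonneg_nonneg prod_nonneg) auto

lemma bdd_below_cost: "bdd_below {representation_cost p A c |A c. tensor_representation smul n t A c}"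
  using cost_nonneg by (intro bdd_belowI[of _ 0]) auto

lemma projective_power_le: "tensor_representation smul n t A c \<Longrightarrow> projective_power smul p n t \<le> representation_cost p A c"
  unfolding projective_power_Inf by (intro cInf_lower bdd_below_cost) auto

lemma projective_power_greatest:
  assumes "t \<in> tensor_power smul n" "\<And>A c. tensor_representation smul n t A c \<Longrightarrow> b \<le> representation_cost p A c"
  shows "b \<le> projective_power smul p n t"
  unfolding projective_power_Inf
proof (rule cInf_greatest)
  show "{representation_cost p A c |A c. tensor_representation smul n t A c} \<noteq> {}"
    using tensor_representation_exists[OF assms(1)] by simp
qed (use assms(2) in auto)

lemma projective_power_nonneg: "t \<in> tensor_power smul n \<Longrightarrow> 0 \<le> projective_power smul p n t"
  by (rule projective_power_greatest) (auto simp: cost_nonneg)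

lemma projective_power_approx:
  assumes "t \<in> tensor_power smul n" "0 < d"
  obtains A c where "tensor_representation smul n t A c" "representation_cost p A c < projective_power smul p n t + d"
proof -
  have "\<not> (\<forall>A c. tensor_representation smul n t A c \<longrightarrow> projective_power smul p n t + d \<le> representation_cost p A c)"
    using projective_power_greatest[OF assms(1), of "projective_power smul p n t + d"] assms(2) by force
  with that show thesis by (auto simp: not_le)
qed

lemma projective_power_zero: "projective_power smul p n 0 = 0"
  using projective_power_le[OF tensor_representation_zero, of n] projective_power_nonneg[OF tens.subspace_0[OF subspace_tensor_power], of n]
  by (simp add: representation_cost_def)

lemma projective_power_tensor_le:
  "length vs = n \<Longrightarrow> projective_power smul p n (fscale (*) k (tensor smul vs)) \<le> norm k * (\<Prod>v\<leftarrow>vs. p v)"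
  using projective_power_le[OF tensor_representation_tensor] by (simp add: representation_cost_def)

lemma projective_power_pure_tensor_le:
  "length vs = n \<Longrightarrow> projective_power smul p n (tensor smul vs) \<le> (\<Prod>v\<leftarrow>vs. p v)"
  using projective_power_tensor_le[of vs n 1] by simp

lemma projective_power_triangle:
  assumes "t \<in> tensor_power smul n" "u \<in> tensor_power smul n"
  shows "projective_power smul p n (t + u) \<le> projective_power smul p n t + projective_power smul p n u"
proof (rule field_le_epsilon)
  fix e :: real assume "0 < e"
  then have e: "0 < e / 2" by simp
  obtain A c where A: "tensor_representation smul n t A c" "representation_cost p A c < projective_power smul p n t + e / 2"
    using projective_power_approx[OF assms(1) e] .
  obtain B d where B: "tensor_representation smul n u B d" "representation_cost p B d < projective_power smul p n u + e / 2"
    using projective_power_approx[OF assms(2) e] .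
  let ?c = "\<lambda>vs. if vs \<in> A then c vs else 0" and ?d = "\<lambda>vs. if vs \<in> B then d vs else 0"
  have fin: "finite A" "finite B" using A B by (auto simp: tensor_representation_def)
  have "projective_power smul p n (t + u) \<le> representation_cost p (A \<union> B) (\<lambda>vs. ?c vs + ?d vs)"
    by (rule projective_power_le[OF tensor_representation_add[OF A(1) B(1)]])
  also have "\<dots> \<le> (\<Sum>vs\<in>A \<union> B. norm (?c vs) * (\<Prod>v\<leftarrow>vs. p v) + norm (?d vs) * (\<Prod>v\<leftarrow>vs. p v))"
    unfolding representation_cost_def
  proof (rule sum_mono)
    fix vs
    have "norm (?c vs + ?d vs) * (\<Prod>v\<leftarrow>vs. p v) \<le> (norm (?c vs) + norm (?d vs)) * (\<Prod>v\<leftarrow>vs. p v)"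
      by (intro mult_right_mono norm_triangle_ineq prod_nonneg)
    then show "norm (?c vs + ?d vs) * (\<Prod>v\<leftarrow>vs. p v) \<le> norm (?c vs) * (\<Prod>v\<leftarrow>vs. p v) + norm (?d vs) * (\<Prod>v\<leftarrow>vs. p v)"
      by (simp only: distrib_right)
  qed
  also have "\<dots> = representation_cost p (A \<union> B) ?c + representation_cost p (A \<union> B) ?d"
    by (simp only: representation_cost_def sum.distrib)
  also have "representation_cost p (A \<union> B) ?c = representation_cost p A c"
    unfolding representation_cost_def using fin by (intro sum.mono_neutral_cong_right) auto
  also have "representation_cost p (A \<union> B) ?d = representation_cost p B d"
    unfolding representation_cost_def using fin by (intro sum.mono_neutral_cong_right) auto
  finally show "projective_power smul p n (t + u) \<le> projective_power smul p n t + projective_power smul p n u + e"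
    using A(2) B(2) by linarith
qed

text \<open>
  The projective seminorm is the largest seminorm whose value on a pure tensor is at most the product
  of the values of \<open>p\<close>. So the boundedness of a linear map need only be checked on pure tensors. All
  estimates for functionals, for the symmetrizer and for the projection to degree one come from here.
\<close>

lemma projective_power_universal:
  assumes N: "seminormed_space s S N"
    and L: "Vector_Spaces.linear (fscale (*)) s L"
    and bound: "\<And>vs. length vs = n \<Longrightarrow> L (tensor smul vs) \<in> S"
      "\<And>vs. length vs = n \<Longrightarrow> N (L (tensor smul vs)) \<le> K * (\<Prod>v\<leftarrow>vs. p v)" "0 \<le> K"
    and t: "t \<in> tensor_power smul n"
  shows "N (L t) \<le> K * projective_power smul p n t"
proof (rule field_le_epsilon)
  interpret N: seminormed_space s S N by fact
  interpret L: Vector_Spaces.linear "fscale (*)" s L by fact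
  fix e :: real assume "0 < e"
  then have "0 < e / (K + 1)" using bound(3) by simp
  then obtain A c where A: "tensor_representation smul n t A c" "representation_cost p A c < projective_power smul p n t + e / (K + 1)"
    using projective_power_approx[OF t] by blast
  have len: "vs \<in> A \<Longrightarrow> length vs = n" for vs using A(1) by (simp add: tensor_representation_def)
  have "N (L t) = N (\<Sum>vs\<in>A. s (c vs) (L (tensor smul vs)))"
    using A(1) by (simp add: tensor_representation_def L.sum L.scale)
  also have "\<dots> \<le> (\<Sum>vs\<in>A. N (s (c vs) (L (tensor smul vs))))"
    by (rule N.sum_le) (use bound(1) len in simp)
  also have "\<dots> \<le> (\<Sum>vs\<in>A. K * (norm (c vs) * (\<Prod>v\<leftarrow>vs. p v)))"
  proof (rule sum_mono)
    fix vs assume "vs \<in> A"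
    then show "N (s (c vs) (L (tensor smul vs))) \<le> K * (norm (c vs) * (\<Prod>v\<leftarrow>vs. p v))"
      using mult_left_mono[OF bound(2)[OF len], of vs "norm (c vs)"] bound(1)[OF len] by (simp add: mult_ac)
  qed
  also have "\<dots> = K * representation_cost p A c"
    by (simp add: representation_cost_def sum_distrib_left)
  also have "\<dots> \<le> K * (projective_power smul p n t + e / (K + 1))"
    using A(2) bound(3) by (intro mult_left_mono) auto
  also have "\<dots> \<le> K * projective_power smul p n t + e"
    using \<open>0 < e\<close> bound(3) by (simp add: distrib_left field_simps)
  finally show "N (L t) \<le> K * projective_power smul p n t + e" .
qed

text \<open>
  This inequality for \<open>k\<close> and for its inverse gives homogeneity.
\<close>

lemma projective_power_scale_le:
  assumes "t \<in> tensor_power smul n"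
  shows "projective_power smul p n (fscale (*) k t) \<le> norm k * projective_power smul p n t"
proof (rule field_le_epsilon)
  fix e :: real assume "0 < e"
  then have "0 < e / (norm k + 1)" by (simp add: add_nonneg_pos)
  then obtain A c where A: "tensor_representation smul n t A c" "representation_cost p A c < projective_power smul p n t + e / (norm k + 1)"
    using projective_power_approx[OF assms] by blast
  have "projective_power smul p n (fscale (*) k t) \<le> representation_cost p A (\<lambda>vs. k * c vs)"
    by (rule projective_power_le[OF tensor_representation_scale[OF A(1)]])
  also have "\<dots> = norm k * representation_cost p A c"
    by (simp add: representation_cost_def sum_distrib_left norm_mult mult_ac)
  also have "\<dots> \<le> norm k * (projective_power smul p n t + e / (norm k + 1))"
    using A(2) by (intro mult_left_mono) auto
  also have "\<dots> \<le> norm k * projective_power smul p n t + e"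
  proof -
    have "norm k * (e / (norm k + 1)) = e * (norm k / (norm k + 1))" by simp
    also have "\<dots> \<le> e * 1"
      using \<open>0 < e\<close> by (intro mult_left_mono) (auto simp: divide_le_eq_1 add_nonneg_pos)
    finally show ?thesis by (simp add: distrib_left)
  qed
  finally show "projective_power smul p n (fscale (*) k t) \<le> norm k * projective_power smul p n t + e" .
qed

lemma projective_power_scale:
  assumes t: "t \<in> tensor_power smul n"
  shows "projective_power smul p n (fscale (*) k t) = norm k * projective_power smul p n t"
proof (cases "k = 0")
  case True
  then show ?thesis by (simp add: projective_power_zero)
next
  case False
  have "projective_power smul p n (fscale (*) (1 / k) (fscale (*) k t)) \<le> norm (1 / k) * projective_power smul p n (fscale (*) k t)"
    by (rule projective_power_scale_le) (rule tens.subspace_scale[OF subspace_tensor_power t])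
  then have "norm k * projective_power smul p n t \<le> projective_power smul p n (fscale (*) k t)"
    using False by (simp add: norm_divide pos_le_divide_eq mult.commute)
  with projective_power_scale_le[OF t] show ?thesis by (intro antisym) auto
qed

lemma projective_power_seminormed:
  "seminormed_space (fscale (*)) (tensor_power smul n) (projective_power smul p n)"
  by unfold_locales
    (auto simp: subspace_tensor_power seminorm_on_def projective_power_nonneg projective_power_triangle projective_power_scale)

lemma projective_power_mono:
  assumes "seminormed_vector_space smul p'" "\<And>v. p' v \<le> K * p v" "0 \<le> K" and t: "t \<in> tensor_power smul n"
  shows "projective_power smul p' n t \<le> K ^ n * projective_power smul p n t"
proof -
  interpret p': seminormed_vector_space smul p' by fact
  have prod: "(\<Prod>v\<leftarrow>vs. p' v) \<le> K ^ length vs * (\<Prod>v\<leftarrow>vs. p v)" for vs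
  proof (induction vs)
    case (Cons v vs)
    have "p' v * (\<Prod>v\<leftarrow>vs. p' v) \<le> (K * p v) * (K ^ length vs * (\<Prod>v\<leftarrow>vs. p v))"
      using Cons assms(2,3) by (intro mult_mono p'.prod_nonneg) simp_all
    then show ?case by (simp add: mult_ac)
  qed simp
  show ?thesis
    by (rule projective_power_universal[OF p'.projective_power_seminormed tens.linear_ident _ _ _ t])
       (use assms(3) order_trans[OF p'.projective_power_pure_tensor_le prod] in \<open>auto intro: tensor_in_power\<close>)
qed

lemma projective_power_evaluation:
  assumes \<phi>: "\<And>vs. length vs = n \<Longrightarrow> norm (\<phi> vs) \<le> K * (\<Prod>v\<leftarrow>vs. p v)" "multilinear smul (*) n \<phi>"
    and K: "0 \<le> K" and t: "t \<in> tensor_power smul n"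
  shows "norm (t \<phi>) \<le> K * projective_power smul p n t"
proof -
  have N: "seminormed_space ((*) :: 'k \<Rightarrow> 'k \<Rightarrow> 'k) UNIV norm"
    by (intro seminormed_space.intro vector_space_mult seminormed_space_axioms.intro)
       (auto simp: seminorm_on_def norm_triangle_ineq norm_mult module.subspace_UNIV module_iff_vector_space vector_space_mult)
  have L: "Vector_Spaces.linear (fscale (*)) (*) (\<lambda>t :: ('k, 'v) tens. t \<phi>)"
    by (intro linearI' vector_space_mult vector_space_tens) (auto simp: fscale_def)
  show ?thesis
    by (rule projective_power_universal[OF N L _ _ K t]) (use \<phi> in \<open>auto simp: tensor_def\<close>)
qed

end

section \<open>The tensor algebra\<close>

lemma vector_space_tensor_scale: "vector_space (tensor_scale :: 'k::field \<Rightarrow> (nat \<Rightarrow> ('k, 'v) tens) \<Rightarrow> _)"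
  by (intro vector_space_fscale vector_space_tens)

interpretation talg: vector_space "tensor_scale :: 'k::field \<Rightarrow> (nat \<Rightarrow> ('k, 'v) tens) \<Rightarrow> (nat \<Rightarrow> ('k, 'v) tens)"
  by (rule vector_space_tensor_scale)

definition homogeneous_tensor :: "nat \<Rightarrow> ('k::field, 'v) tens \<Rightarrow> nat \<Rightarrow> ('k, 'v) tens" where
  "homogeneous_tensor n t = (\<lambda>m. if m = n then t else 0)"

lemma homogeneous_tensor_add: "homogeneous_tensor n (t + u) = homogeneous_tensor n t + homogeneous_tensor n u"
  and homogeneous_tensor_diff: "homogeneous_tensor n (t - u) = homogeneous_tensor n t - homogeneous_tensor n u"
  and homogeneous_tensor_scale: "homogeneous_tensor n (fscale (*) k t) = tensor_scale k (homogeneous_tensor n t)"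
  and homogeneous_tensor_zero: "homogeneous_tensor n 0 = 0"
  by (auto simp: homogeneous_tensor_def fscale_def fun_eq_iff)

lemma homogeneous_tensor_sum: "homogeneous_tensor n (sum g A) = (\<Sum>a\<in>A. homogeneous_tensor n (g a))"
  by (induction A rule: infinite_finite_induct) (simp_all only: homogeneous_tensor_add homogeneous_tensor_zero sum.infinite sum.empty sum.insert not_False_eq_True)

lemma homogeneous_tensor_mem: "t \<in> tensor_power smul n \<Longrightarrow> homogeneous_tensor n t \<in> tensor_algebra smul"
  using tens.subspace_0[OF subspace_tensor_power]
  by (auto simp: tensor_algebra_def homogeneous_tensor_def intro: finite_subset[of _ "{n}"])

lemma subspace_graded:
  assumes "\<And>n. tens.subspace (W n)"
  shows "talg.subspace {t :: nat \<Rightarrow> ('k::field, 'v) tens. (\<forall>n. t n \<in> W n) \<and> finite {n. t n \<noteq> 0}}"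
  unfolding talg.subspace_def
proof (intro conjI ballI allI)
  show "0 \<in> {t. (\<forall>n. t n \<in> W n) \<and> finite {n. t n \<noteq> 0}}"
    using tens.subspace_0[OF assms] by simp
  fix t assume t: "t \<in> {t. (\<forall>n. t n \<in> W n) \<and> finite {n. t n \<noteq> 0}}"
  show "t + u \<in> {t. (\<forall>n. t n \<in> W n) \<and> finite {n. t n \<noteq> 0}}"
    if u: "u \<in> {t. (\<forall>n. t n \<in> W n) \<and> finite {n. t n \<noteq> 0}}" for u
  proof -
    have "{n. (t + u) n \<noteq> 0} \<subseteq> {n. t n \<noteq> 0} \<union> {n. u n \<noteq> 0}" by auto
    then have "finite {n. (t + u) n \<noteq> 0}" by (rule finite_subset) (use t u in auto)
    then show ?thesis using t u tens.subspace_add[OF assms] by simp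
  qed
  show "tensor_scale c t \<in> {t. (\<forall>n. t n \<in> W n) \<and> finite {n. t n \<noteq> 0}}" for c
  proof -
    have "tensor_scale c t n = fscale (*) c (t n)" for n by (simp add: fscale_def)
    moreover have "{n. fscale (*) c (t n) \<noteq> 0} \<subseteq> {n. t n \<noteq> 0}" by auto
    then have "finite {n. fscale (*) c (t n) \<noteq> 0}" by (rule finite_subset) (use t in auto)
    ultimately show ?thesis using t tens.subspace_scale[OF assms] by simp
  qed
qed

lemma subspace_tensor_algebra: "talg.subspace (tensor_algebra smul)"
  unfolding tensor_algebra_def by (intro subspace_graded subspace_tensor_power)

lemma tensor_algebra_decompose:
  assumes "finite {n. t n \<noteq> 0}"
  shows "t = (\<Sum>n | t n \<noteq> 0. homogeneous_tensor n (t n))"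
proof
  fix m
  have "(\<Sum>n\<in>A. homogeneous_tensor n (t n)) m = (\<Sum>n\<in>A. homogeneous_tensor n (t n) m)" for A
    by (induction A rule: infinite_finite_induct) auto
  then show "t m = (\<Sum>n | t n \<noteq> 0. homogeneous_tensor n (t n)) m"
    using assms by (simp add: homogeneous_tensor_def sum.If_cases)
qed

lemma tensor_algebra_induct:
  assumes t: "t \<in> tensor_algebra smul" and zero: "Q 0"
    and add: "\<And>t u. t \<in> tensor_algebra smul \<Longrightarrow> u \<in> tensor_algebra smul \<Longrightarrow> Q t \<Longrightarrow> Q u \<Longrightarrow> Q (t + u)"
    and pure: "\<And>n k vs. length vs = n \<Longrightarrow> Q (homogeneous_tensor n (fscale (*) k (tensor smul vs)))"
  shows "Q t"
proof -
  have hom: "Q (homogeneous_tensor n x)" if x: "x \<in> tensor_power smul n" for n x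
  proof -
    have "x \<in> tensor_power smul n \<and> Q (homogeneous_tensor n x)"
      using x unfolding tensor_power_def
    proof (induction rule: tens.span_induct_alt)
      case base
      show ?case using zero by (simp only: homogeneous_tensor_zero tens.span_zero simp_thms)
    next
      case (step k x y)
      then obtain vs where vs: "x = tensor smul vs" "length vs = n" by blast
      have xy: "fscale (*) k x \<in> tensor_power smul n" "y \<in> tensor_power smul n"
        using step vs tens.subspace_scale[OF subspace_tensor_power tensor_in_power] by (auto simp: tensor_power_def)
      have "Q (homogeneous_tensor n (fscale (*) k x) + homogeneous_tensor n y)"
        using xy step vs pure by (intro add homogeneous_tensor_mem) auto
      then show ?case
        using tens.subspace_add[OF subspace_tensor_power xy] by (simp only: homogeneous_tensor_add tensor_power_def)
    qed
    then show ?thesis ..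
  qed
  have mem: "t n \<in> tensor_power smul n" "finite {n. t n \<noteq> 0}" for n
    using t by (auto simp: tensor_algebra_def)
  have "Q (\<Sum>n\<in>A. homogeneous_tensor n (t n))" if "finite A" for A
    using that
  proof induction
    case (insert n A)
    have "Q (homogeneous_tensor n (t n) + (\<Sum>n\<in>A. homogeneous_tensor n (t n)))"
      by (intro add homogeneous_tensor_mem talg.subspace_sum[OF subspace_tensor_algebra] hom mem insert.IH)
    then show ?case by (simp only: sum.insert[OF insert.hyps])
  qed (simp only: sum.empty zero)
  from this[OF mem(2)] show ?thesis
    by (subst tensor_algebra_decompose[OF mem(2)])
qed

context seminormed_vector_space
begin

lemma tensor_seminorm_finite:
  assumes "finite A" "\<And>n. n \<notin> A \<Longrightarrow> t n = 0"
  shows "tensor_seminorm smul R p t = (\<Sum>n\<in>A. projective_power smul p n (t n) * fact n powr R)"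
  unfolding tensor_seminorm_def using assms by (intro suminf_finite) (auto simp: projective_power_zero)

lemma tensor_seminorm_homogeneous:
  "tensor_seminorm smul R p (homogeneous_tensor n t) = projective_power smul p n t * fact n powr R"
  using tensor_seminorm_finite[of "{n}" "homogeneous_tensor n t"] by (simp add: homogeneous_tensor_def)

lemma tensor_seminorm_seminormed:
  "seminormed_space tensor_scale (tensor_algebra smul) (tensor_seminorm smul R p)"
proof
  let ?f = "\<lambda>A t. \<Sum>n\<in>A. projective_power smul p n (t n) * fact n powr R"
  note P = seminormed_space.nonneg[OF projective_power_seminormed]
    seminormed_space.triangle[OF projective_power_seminormed] seminormed_space.scale[OF projective_power_seminormed]
  show "seminorm_on tensor_scale (tensor_algebra smul) (tensor_seminorm smul R p)"
    unfolding seminorm_on_def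
  proof (intro conjI ballI allI)
    fix t assume t: "t \<in> tensor_algebra smul"
    define A where "A = {n. t n \<noteq> 0}"
    have A: "finite A" "\<And>n. t n \<in> tensor_power smul n" using t by (auto simp: tensor_algebra_def A_def)
    show "0 \<le> tensor_seminorm smul R p t"
      using A P(1) by (subst tensor_seminorm_finite[of A]) (auto simp: A_def intro!: sum_nonneg)
    show "tensor_seminorm smul R p (tensor_scale c t) = norm c * tensor_seminorm smul R p t" for c
    proof -
      have "(tensor_scale c t) n = fscale (*) c (t n)" for n by (simp add: fscale_def)
      then have "tensor_seminorm smul R p (tensor_scale c t) = ?f A (\<lambda>n. fscale (*) c (t n))"
        by (subst tensor_seminorm_finite[of A]) (use A in \<open>auto simp: A_def\<close>)
      also have "\<dots> = norm c * ?f A t"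
        using P(3)[OF A(2)] by (simp add: sum_distrib_left mult_ac)
      finally show ?thesis
        by (subst (2) tensor_seminorm_finite[of A]) (use A in \<open>auto simp: A_def\<close>)
    qed
    fix u assume u: "u \<in> tensor_algebra smul"
    define B where "B = {n. t n \<noteq> 0} \<union> {n. u n \<noteq> 0}"
    have B: "finite B" "\<And>n. u n \<in> tensor_power smul n" using t u by (auto simp: tensor_algebra_def B_def)
    have eq: "tensor_seminorm smul R p v = ?f B v" if "v \<in> {t, u, t + u}" for v
      by (rule tensor_seminorm_finite) (use that B in \<open>auto simp: B_def\<close>)
    have "?f B (t + u) \<le> (\<Sum>n\<in>B. projective_power smul p n (t n) * fact n powr R + projective_power smul p n (u n) * fact n powr R)"
    proof (rule sum_mono)
      show "projective_power smul p n ((t + u) n) * fact n powr R \<le>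
          projective_power smul p n (t n) * fact n powr R + projective_power smul p n (u n) * fact n powr R" for n
        using mult_right_mono[OF P(2)[OF A(2) B(2)], of "fact n powr R" n] by (simp add: distrib_right)
    qed
    also have "\<dots> = ?f B t + ?f B u" by (rule sum.distrib)
    finally show "tensor_seminorm smul R p (t + u) \<le> tensor_seminorm smul R p t + tensor_seminorm smul R p u"
      using eq by simp
  qed
qed (rule subspace_tensor_algebra)

lemma projective_power_le_tensor_seminorm:
  assumes t: "t \<in> tensor_algebra smul"
  shows "projective_power smul p n (t n) * fact n powr R \<le> tensor_seminorm smul R p t"
proof -
  let ?A = "insert n {n. t n \<noteq> 0}"
  have A: "finite ?A" "\<And>n. t n \<in> tensor_power smul n" using t by (auto simp: tensor_algebra_def)
  have "tensor_seminorm smul R p t = (\<Sum>n\<in>?A. projective_power smul p n (t n) * fact n powr R)"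
    by (rule tensor_seminorm_finite) (use A in auto)
  also have "\<dots> \<ge> projective_power smul p n (t n) * fact n powr R"
    using A projective_power_nonneg by (intro member_le_sum) auto
  finally show ?thesis .
qed

text \<open>
  A map that acts degree by degree and is contractive in every degree is contractive for the tensor
  seminorms; lowering the exponent only helps, as factorials are at least one.
\<close>

lemma tensor_seminorm_le:
  assumes L: "\<And>n. L t n \<in> tensor_power smul n" "\<And>n. t n = 0 \<Longrightarrow> L t n = 0"
    and p': "seminormed_vector_space smul p'"
    and le: "\<And>n. projective_power smul p' n (L t n) \<le> projective_power smul p n (t n)" "R' \<le> R"
    and t: "t \<in> tensor_algebra smul"
  shows "tensor_seminorm smul R' p' (L t) \<le> tensor_seminorm smul R p t"
proof -
  interpret p': seminormed_vector_space smul p' by fact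
  let ?A = "{n. t n \<noteq> 0}"
  have A: "finite ?A" "\<And>n. t n \<in> tensor_power smul n" using t by (auto simp: tensor_algebra_def)
  have "tensor_seminorm smul R' p' (L t) = (\<Sum>n\<in>?A. projective_power smul p' n (L t n) * fact n powr R')"
    by (rule p'.tensor_seminorm_finite) (use A L in auto)
  also have "\<dots> \<le> (\<Sum>n\<in>?A. projective_power smul p n (t n) * fact n powr R)"
    using le A by (intro sum_mono mult_mono powr_mono projective_power_nonneg) (auto simp: fact_ge_1)
  also have "\<dots> = tensor_seminorm smul R p t"
    by (rule tensor_seminorm_finite[symmetric]) (use A in auto)
  finally show ?thesis .
qed

end

section \<open>Expansions along words\<close>

definition words :: "'a set \<Rightarrow> nat \<Rightarrow> 'a list set" where
  "words A n = {xs. set xs \<subseteq> A \<and> length xs = n}"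

lemma finite_words: "finite A \<Longrightarrow> finite (words A n)"
  unfolding words_def by (rule finite_lists_length_eq)

lemma words_0: "words A 0 = {[]}"
  by (auto simp: words_def)

lemma sum_words_Suc:
  assumes "finite A"
  shows "(\<Sum>xs\<in>words A (Suc n). g xs) = (\<Sum>a\<in>A. \<Sum>xs\<in>words A n. g (a # xs))"
proof -
  have "words A (Suc n) = (\<lambda>(a, xs). a # xs) ` (A \<times> words A n)"
    by (auto simp: words_def length_Suc_conv)
  then have "(\<Sum>xs\<in>words A (Suc n). g xs) = (\<Sum>(a, xs)\<in>A \<times> words A n. g (a # xs))"
    by (simp add: sum.reindex inj_on_def case_prod_unfold)
  then show ?thesis by (simp add: sum.cartesian_product)
qed

lemma sum_words_prod_list:
  fixes g :: "'a \<Rightarrow> real"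
  assumes "finite A"
  shows "(\<Sum>xs\<in>words A n. \<Prod>x\<leftarrow>xs. g x) = (\<Sum>a\<in>A. g a) ^ n"
proof (induction n)
  case (Suc n)
  have "(\<Sum>xs\<in>words A (Suc n). \<Prod>x\<leftarrow>xs. g x) = (\<Sum>a\<in>A. g a * (\<Sum>xs\<in>words A n. \<Prod>x\<leftarrow>xs. g x))"
    using assms by (simp add: sum_words_Suc sum_distrib_left)
  also have "\<dots> = (\<Sum>a\<in>A. g a) * (\<Sum>a\<in>A. g a) ^ n"
    unfolding Suc.IH by (rule sum_distrib_right[symmetric])
  finally show ?case by simp
qed (simp add: words_0)

lemma multilinear_slot:
  assumes "multilinear smul s n \<Phi>" "length us + length vs + 1 = n"
  shows "Vector_Spaces.linear smul s (\<lambda>x. \<Phi> (us @ x # vs))"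
proof -
  have "Vector_Spaces.linear smul s (\<lambda>x. \<Phi> ((us @ 0 # vs)[length us := x]))"
    using assms(2) assms(1)[unfolded multilinear_def, rule_format, of "us @ 0 # vs" "length us"] by simp
  then show ?thesis by simp
qed

lemma multilinear_sum:
  assumes \<Phi>: "multilinear smul s n \<Phi>" and A: "finite A" and len: "length us + length vs = n"
  shows "\<Phi> (us @ map (\<lambda>v. \<Sum>a\<in>A. g a v) vs) = (\<Sum>as\<in>words A (length vs). \<Phi> (us @ map2 g as vs))"
  using len
proof (induction vs arbitrary: us)
  case Nil
  then show ?case by (simp add: words_0)
next
  case (Cons v vs)
  interpret Vector_Spaces.linear smul s "\<lambda>x. \<Phi> (us @ x # map (\<lambda>v. \<Sum>a\<in>A. g a v) vs)"
    by (rule multilinear_slot[OF \<Phi>]) (use Cons.prems in simp)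
  have "\<Phi> (us @ map (\<lambda>v. \<Sum>a\<in>A. g a v) (v # vs)) = (\<Sum>a\<in>A. \<Phi> (us @ g a v # map (\<lambda>v. \<Sum>a\<in>A. g a v) vs))"
    by (simp add: sum)
  also have "\<dots> = (\<Sum>a\<in>A. \<Sum>as\<in>words A (length vs). \<Phi> (us @ g a v # map2 g as vs))"
    using Cons.IH[of "us @ [g a v]" for a] Cons.prems by simp
  also have "\<dots> = (\<Sum>as\<in>words A (length (v # vs)). \<Phi> (us @ map2 g as (v # vs)))"
    using A by (simp add: sum_words_Suc)
  finally show ?case .
qed

lemma multilinear_scale:
  assumes \<Phi>: "multilinear smul s n \<Phi>" and len: "length as = length vs" "length us + length vs = n"
    and s: "vector_space s"
  shows "\<Phi> (us @ map2 (\<lambda>a v. smul (h a v) (k a)) as vs) = s (\<Prod>(a, v)\<leftarrow>zip as vs. h a v) (\<Phi> (us @ map k as))"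
  using len
proof (induction as vs arbitrary: us rule: list_induct2)
  case Nil
  interpret vector_space s by fact
  show ?case by simp
next
  case (Cons a as v vs)
  interpret s: vector_space s by fact
  have lin: "Vector_Spaces.linear smul s (\<lambda>x. \<Phi> (us @ x # map2 (\<lambda>a v. smul (h a v) (k a)) as vs))"
    by (rule multilinear_slot[OF \<Phi>]) (use Cons in simp)
  have "\<Phi> (us @ map2 (\<lambda>a v. smul (h a v) (k a)) (a # as) (v # vs)) =
      s (h a v) (\<Phi> (us @ k a # map2 (\<lambda>a v. smul (h a v) (k a)) as vs))"
    using linear_scale'[OF lin] by simp
  also have "\<Phi> (us @ k a # map2 (\<lambda>a v. smul (h a v) (k a)) as vs) =
      s (\<Prod>(a, v)\<leftarrow>zip as vs. h a v) (\<Phi> (us @ k a # map k as))"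
    using Cons.IH[of "us @ [k a]"] Cons.prems by simp
  finally show ?case by simp
qed

lemma prod_list_nth: "prod_list xs = (\<Prod>i<length xs. xs ! i)"
  by (simp add: prod.list_conv_set_nth atLeast0LessThan)

lemma multilinear_prod:
  assumes smul: "vector_space smul" and g: "\<And>j. j < n \<Longrightarrow> functional_on smul UNIV (g j)"
  shows "multilinear smul (*) n (\<lambda>vs. \<Prod>j<n. g j (vs ! j))"
  unfolding multilinear_def
proof (intro allI impI)
  fix vs :: "'b list" and i assume i: "length vs = n \<and> i < n"
  have "(\<Prod>j<n. g j (vs[i := x] ! j)) = g i x * (\<Prod>j\<in>{..<n} - {i}. g j (vs ! j))" for x
    using i by (subst prod.remove[of _ i]) (auto intro!: prod.cong)
  then show "Vector_Spaces.linear smul (*) (\<lambda>x. \<Prod>j<n. g j (vs[i := x] ! j))"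
    using i g[of i] unfolding functional_on_def
    by (intro linearI' smul vector_space_mult) (simp_all add: distrib_right)
qed

context seminormed_vector_space
begin

text \<open>
  Tensor products are jointly continuous. The factors are replaced by their approximations one at a
  time, from the left: those in \<open>us\<close> have been replaced already, and replacing the next factor
  costs a product in which one factor tends to zero and the others stay bounded.
\<close>

lemma pure_tensor_tendsto:
  assumes T: "\<And>v. (\<lambda>m. p (v - T m v)) \<longlonglongrightarrow> 0"
  shows "(\<lambda>m. projective_power smul p (length us + length vs)
    (tensor smul (map (T m) us @ vs) - tensor smul (map (T m) us @ map (T m) vs))) \<longlonglongrightarrow> 0"
proof (induction vs arbitrary: us)
  case Nil
  show ?case by (simp only: list.map diff_self projective_power_zero tendsto_const)
next
  case (Cons v vs)
  let ?n = "length us + length (v # vs)"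
  interpret P: seminormed_space "fscale (*)" "tensor_power smul ?n" "projective_power smul p ?n"
    by (rule projective_power_seminormed)
  let ?X = "\<lambda>m. tensor smul (map (T m) us @ (v - T m v) # vs)"
  let ?Y = "\<lambda>m. tensor smul (map (T m) (us @ [v]) @ vs) - tensor smul (map (T m) (us @ [v]) @ map (T m) vs)"
  have lim: "(\<lambda>m. p (T m u)) \<longlonglongrightarrow> p u" for u
  proof (rule Lim_transform[OF tendsto_const])
    show "(\<lambda>m. p (T m u) - p u) \<longlonglongrightarrow> 0"
      by (rule Lim_null_comparison[OF _ T[of u]]) (use reverse_triangle[of u "T m u" for m] in \<open>simp add: abs_minus_commute\<close>)
  qed
  have lim_prod: "(\<lambda>m. \<Prod>u\<leftarrow>us. p (T m u)) \<longlonglongrightarrow> (\<Prod>u\<leftarrow>us. p u)" for us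
    by (induction us) (auto intro!: tendsto_mult lim)
  have X: "(\<lambda>m. projective_power smul p ?n (?X m)) \<longlonglongrightarrow> 0"
  proof (rule tendsto_sandwich[OF _ _ tendsto_const])
    show "\<forall>\<^sub>F m in sequentially. 0 \<le> projective_power smul p ?n (?X m)"
      by (intro always_eventually allI projective_power_nonneg tensor_in_power) simp
    show "\<forall>\<^sub>F m in sequentially. projective_power smul p ?n (?X m) \<le> (\<Prod>u\<leftarrow>us. p (T m u)) * (p (v - T m v) * (\<Prod>u\<leftarrow>vs. p u))"
      using projective_power_pure_tensor_le[of "map (T m) us @ (v - T m v) # vs" ?n for m]
      by (intro always_eventually allI) (simp add: o_def)
    show "(\<lambda>m. (\<Prod>u\<leftarrow>us. p (T m u)) * (p (v - T m v) * (\<Prod>u\<leftarrow>vs. p u))) \<longlonglongrightarrow> 0"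
      using tendsto_mult[OF lim_prod tendsto_mult[OF T[of v] tendsto_const]] by simp
  qed
  have n: "length (us @ [v]) + length vs = ?n" by simp
  have Y: "(\<lambda>m. projective_power smul p ?n (?Y m)) \<longlonglongrightarrow> 0"
    using Cons.IH[of "us @ [v]"] unfolding n .
  have eq: "tensor smul (map (T m) us @ v # vs) - tensor smul (map (T m) us @ map (T m) (v # vs)) = ?X m + ?Y m" for m
  proof -
    interpret Vector_Spaces.linear smul "fscale (*)" "\<lambda>x. tensor smul (map (T m) us @ x # vs)"
      by (rule multilinear_slot[OF multilinear_tensor[OF vector_space_axioms]]) simp
    have "?X m = tensor smul (map (T m) us @ v # vs) - tensor smul (map (T m) us @ T m v # vs)"
      by (rule diff)
    then show ?thesis by (simp only: map_append list.map append.simps append_assoc) (simp only: diff_add_eq_diff_diff_swap diff_diff_eq2 add_diff_eq diff_add_cancel)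
  qed
  show ?case
  proof (rule tendsto_sandwich[OF _ _ tendsto_const])
    show "(\<lambda>m. projective_power smul p ?n (?X m) + projective_power smul p ?n (?Y m)) \<longlonglongrightarrow> 0"
      using tendsto_add[OF X Y] by simp
    have mem: "?X m \<in> tensor_power smul ?n" "?Y m \<in> tensor_power smul ?n" for m
      by (auto intro!: tensor_in_power tens.subspace_diff[OF subspace_tensor_power])
    show "\<forall>\<^sub>F m in sequentially. 0 \<le> projective_power smul p ?n
        (tensor smul (map (T m) us @ v # vs) - tensor smul (map (T m) us @ map (T m) (v # vs)))"
      unfolding eq by (intro always_eventually allI projective_power_nonneg tens.subspace_add[OF subspace_tensor_power] mem)
    show "\<forall>\<^sub>F m in sequentially. projective_power smul p ?n
        (tensor smul (map (T m) us @ v # vs) - tensor smul (map (T m) us @ map (T m) (v # vs)))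
        \<le> projective_power smul p ?n (?X m) + projective_power smul p ?n (?Y m)"
      unfolding eq by (intro always_eventually allI projective_power_triangle mem)
  qed
qed

end

text \<open>
  Every positive power of the factorial outgrows every geometric sequence. This is where the strict
  gap between the exponents on the two sides is needed.
\<close>

lemma summable_power_fact_powr:
  fixes M d :: real
  assumes "0 \<le> M" "0 < d"
  shows "summable (\<lambda>n. M ^ n * fact n powr (- d))"
proof -
  have "((\<lambda>n. M * real (Suc n) powr (- d)) \<longlongrightarrow> M * 0) sequentially"
    by (intro tendsto_mult_left tendsto_neg_powr filterlim_compose[OF filterlim_real_sequentially filterlim_Suc]) (use assms in simp)
  then have "\<forall>\<^sub>F n in sequentially. M * real (Suc n) powr (- d) < 1/2"
    by (intro order_tendstoD) auto
  then obtain N where N: "\<And>n. n \<ge> N \<Longrightarrow> M * real (Suc n) powr (- d) < 1/2"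
    by (auto simp: eventually_sequentially)
  show ?thesis
  proof (rule summable_ratio_test[of "1/2" N])
    fix n assume "N \<le> n"
    have "M ^ Suc n * fact (Suc n) powr (- d) = (M * real (Suc n) powr (- d)) * (M ^ n * fact n powr (- d))"
      by (simp add: powr_mult fact_Suc del: of_nat_Suc)
    also have "\<dots> \<le> 1/2 * (M ^ n * fact n powr (- d))"
      using N[OF \<open>N \<le> n\<close>] assms by (intro mult_right_mono) auto
    finally show "norm (M ^ Suc n * fact (Suc n) powr (- d)) \<le> 1/2 * norm (M ^ n * fact n powr (- d))"
      using assms by simp
  qed simp
qed

text \<open>
  Up to the factorial weight, the words of length \<open>n\<close> contribute the \<open>n\<close>-th power of the sum of
  \<open>b\<close>.
\<close>

lemma summable_on_words:
  fixes b :: "nat \<Rightarrow> real"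
  assumes b: "b summable_on UNIV" "\<And>i. 0 \<le> b i" and d: "0 < d"
  shows "(\<lambda>is. (\<Prod>i\<leftarrow>is. b i) * fact (length is) powr (- d)) summable_on UNIV"
proof (rule nonneg_bdd_above_summable_on)
  have prod: "0 \<le> (\<Prod>i\<leftarrow>is. b i)" for "is"
    by (induction "is") (simp_all add: b)
  then show "0 \<le> (\<Prod>i\<leftarrow>is. b i) * fact (length is) powr (- d)" for "is" by simp
  define M where "M = infsum b UNIV"
  have M: "(\<Sum>i\<in>A. b i) \<le> M" if "finite A" for A
    unfolding M_def using that b by (intro finite_sum_le_infsum) auto
  have M0: "0 \<le> M" using M[of "{}"] by simp
  have summ: "summable (\<lambda>n. M ^ n * fact n powr (- d))"
    by (rule summable_power_fact_powr[OF M0 d])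
  have "(\<Sum>is\<in>F. (\<Prod>i\<leftarrow>is. b i) * fact (length is) powr (- d)) \<le> (\<Sum>n. M ^ n * fact n powr (- d))"
    if F: "finite F" for F
  proof -
    define A where "A = (\<Union>is\<in>F. set is)"
    define N where "N = Suc (Max (insert 0 (length ` F)))"
    have A: "finite A" using F by (simp add: A_def)
    have "length xs < N" if "xs \<in> F" for xs
      using F that unfolding N_def by (intro le_imp_less_Suc Max_ge) auto
    then have sub: "F \<subseteq> (\<Union>n<N. words A n)"
      by (auto simp: words_def A_def)
    have "(\<Sum>is\<in>F. (\<Prod>i\<leftarrow>is. b i) * fact (length is) powr (- d)) \<le>
        (\<Sum>is\<in>(\<Union>n<N. words A n). (\<Prod>i\<leftarrow>is. b i) * fact (length is) powr (- d))"
      by (rule sum_mono2[OF _ sub]) (use A prod in \<open>auto simp: finite_words\<close>)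
    also have "\<dots> = (\<Sum>n<N. \<Sum>is\<in>words A n. (\<Prod>i\<leftarrow>is. b i) * fact (length is) powr (- d))"
      by (rule sum.UNION_disjoint) (use A in \<open>auto simp: finite_words\<close>, auto simp: words_def)
    also have "\<dots> = (\<Sum>n<N. (\<Sum>is\<in>words A n. \<Prod>i\<leftarrow>is. b i) * fact n powr (- d))"
      by (simp add: sum_distrib_right words_def)
    also have "\<dots> \<le> (\<Sum>n<N. M ^ n * fact n powr (- d))"
      using A M b(2) by (intro sum_mono mult_right_mono) (auto simp: sum_words_prod_list intro!: power_mono sum_nonneg)
    also have "\<dots> \<le> (\<Sum>n. M ^ n * fact n powr (- d))"
      using M0 by (intro sum_le_suminf[OF summ]) auto
    finally show ?thesis .
  qed
  then show "bdd_above (sum (\<lambda>is. (\<Prod>i\<leftarrow>is. b i) * fact (length is) powr (- d)) ` {F. F \<subseteq> UNIV \<and> finite F})"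
    by (intro bdd_aboveI2) auto
qed

lemma rapidly_summable_words:
  fixes a :: "nat \<Rightarrow> real"
  assumes a: "rapidly_summable a" "\<And>i. 0 \<le> a i" and d: "0 < d"
  shows "rapidly_summable (\<lambda>is. (\<Prod>i\<leftarrow>is. a i) * fact (length is) powr (- d))"
  unfolding rapidly_summable_def
proof (intro allI impI)
  fix \<alpha> :: real assume \<alpha>: "0 < \<alpha>"
  have "0 \<le> (\<Prod>i\<leftarrow>is. a i) \<and> (\<Prod>i\<leftarrow>is. a i) powr \<alpha> = (\<Prod>i\<leftarrow>is. a i powr \<alpha>)" for "is"
    by (induction "is") (simp_all add: powr_mult a)
  then have "((\<Prod>i\<leftarrow>is. a i) * fact (length is) powr (- d)) powr \<alpha> = (\<Prod>i\<leftarrow>is. a i powr \<alpha>) * fact (length is) powr (- (d * \<alpha>))" for "is"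
    by (simp add: powr_mult powr_powr)
  then show "(\<lambda>is. ((\<Prod>i\<leftarrow>is. a i) * fact (length is) powr (- d)) powr \<alpha>) summable_on UNIV"
    using summable_on_words[of "\<lambda>i. a i powr \<alpha>" "d * \<alpha>"] a(1) \<alpha> d by (simp add: rapidly_summable_def)
qed

text \<open>
  The functional of a word \<open>is\<close> is evaluation at the product form \<open>\<phi> is\<close> in degree \<open>length is\<close>, and
  its vector is the pure tensor of the \<open>e i\<close>. Along the words of length at most \<open>m\<close> with letters
  below \<open>m\<close>, the expansion of a pure tensor of degree at most \<open>m\<close> is the tensor of the \<open>m\<close>-th
  partial sums \<open>T m\<close> of its factors, by multilinearity, so that it converges by joint continuity.
  Pure tensors suffice since the coefficients are linear.
\<close>

theorem strongly_nuclear_pair_tensor_algebra: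
  fixes smul :: "'k::real_or_complex \<Rightarrow> 'v::ab_group_add \<Rightarrow> 'v"
  assumes p: "seminormed_vector_space smul p" and q: "seminormed_vector_space smul q"
    and pair: "strongly_nuclear_pair smul UNIV p q" and R: "R' < R"
  shows "strongly_nuclear_pair tensor_scale (tensor_algebra smul) (tensor_seminorm smul R' p) (tensor_seminorm smul R q)"
proof -
  interpret p: seminormed_vector_space smul p by fact
  interpret q: seminormed_vector_space smul q by fact
  let ?TA = "tensor_algebra smul" and ?P = "tensor_seminorm smul R' p" and ?Q = "tensor_seminorm smul R q"
  interpret P: seminormed_space tensor_scale ?TA ?P by (rule p.tensor_seminorm_seminormed)
  obtain f e c where *: "\<And>i. functional_on smul UNIV (f i)" "\<And>i. 0 \<le> c i"
      "\<And>i x. norm (f i x) \<le> c i * q x" "rapidly_summable (\<lambda>i::nat. c i * p (e i))"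
      "\<And>x. (\<lambda>n. p (x - (\<Sum>i<n. smul (f i x) (e i)))) \<longlonglongrightarrow> 0"
    using pair unfolding strongly_nuclear_pair_def by auto
  define \<phi> where "\<phi> is vs = (\<Prod>j<length is. f (is ! j) (vs ! j))" for "is" vs
  define F where "F is t = t (length is) (\<phi> is)" for "is" and t :: "nat \<Rightarrow> ('k, 'v) tens"
  define E where "E is = homogeneous_tensor (length is) (tensor smul (map e is))" for "is"
  define C where "C is = (\<Prod>i\<leftarrow>is. c i) * fact (length is) powr (- R)" for "is"
  define A where "A m = (\<Union>n\<le>m. words {..<m::nat} n)" for m
  define T where "T m v = (\<Sum>i<m. smul (f i v) (e i))" for m v
  have \<phi>: "multilinear smul (*) (length is) (\<phi> is)" for "is"
    unfolding \<phi>_def by (intro multilinear_prod p.vector_space_axioms *(1))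
  have c: "0 \<le> (\<Prod>i\<leftarrow>is. c i)" for "is" by (induction "is") (simp_all add: *(2))
  have F_add: "F is (t + u) = F is t + F is u" and F_zero: "F is 0 = 0"
    and F_scale: "F is (tensor_scale a t) = a * F is t" for "is" t u a
    by (simp_all add: F_def fscale_def)
  have F: "functional_on tensor_scale ?TA (F is)" for "is"
    unfolding functional_on_def by (intro conjI ballI allI F_add F_scale)
  have E: "E is \<in> ?TA" for "is"
    unfolding E_def by (intro homogeneous_tensor_mem tensor_in_power) simp
  have bound: "norm (F is t) \<le> C is * ?Q t" if t: "t \<in> ?TA" for "is" t
  proof -
    let ?n = "length is"
    have "norm (\<phi> is vs) \<le> (\<Prod>i\<leftarrow>is. c i) * (\<Prod>v\<leftarrow>vs. q v)" if "length vs = ?n" for vs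
    proof -
      have "norm (\<phi> is vs) = (\<Prod>j<?n. norm (f (is ! j) (vs ! j)))"
        by (simp add: \<phi>_def prod_norm)
      also have "\<dots> \<le> (\<Prod>j<?n. c (is ! j) * q (vs ! j))"
        by (intro prod_mono conjI *(3)) auto
      also have "\<dots> = (\<Prod>i\<leftarrow>is. c i) * (\<Prod>v\<leftarrow>vs. q v)"
        using that by (simp add: prod_list_nth prod.distrib)
      finally show ?thesis .
    qed
    then have le: "norm (F is t) \<le> (\<Prod>i\<leftarrow>is. c i) * projective_power smul q ?n (t ?n)"
      unfolding F_def using t by (intro q.projective_power_evaluation \<phi> c) (auto simp: tensor_algebra_def)
    have "projective_power smul q ?n (t ?n) \<le> fact ?n powr (- R) * ?Q t"
      using q.projective_power_le_tensor_seminorm[OF t, of ?n R]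
      by (simp add: powr_minus field_simps)
    from order_trans[OF le mult_left_mono[OF this c]] show ?thesis by (simp add: C_def mult_ac)
  qed
  have rapid: "rapidly_summable (\<lambda>is. C is * ?P (E is))"
  proof (rule rapidly_summable_bound[where C = 1])
    show "rapidly_summable (\<lambda>is. (\<Prod>i\<leftarrow>is. c i * p (e i)) * fact (length is) powr (- (R - R')))"
      using R *(2,4) by (intro rapidly_summable_words) auto
    show "0 \<le> (\<Prod>i\<leftarrow>is. c i * p (e i)) * fact (length is) powr (- (R - R'))" for "is"
      by (induction "is") (simp_all add: *(2) zero_le_mult_iff)
    show "0 \<le> C is * ?P (E is)" for "is"
      using c E by (simp add: C_def)
    show "C is * ?P (E is) \<le> 1 * ((\<Prod>i\<leftarrow>is. c i * p (e i)) * fact (length is) powr (- (R - R')))" for "is"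
    proof -
      have "projective_power smul p (length is) (tensor smul (map e is)) \<le> (\<Prod>i\<leftarrow>is. p (e i))"
        using p.projective_power_pure_tensor_le[of "map e is"] by (simp add: o_def)
      then have "?P (E is) \<le> (\<Prod>i\<leftarrow>is. p (e i)) * fact (length is) powr R'"
        unfolding E_def p.tensor_seminorm_homogeneous by (intro mult_right_mono) auto
      then have "C is * ?P (E is) \<le> C is * ((\<Prod>i\<leftarrow>is. p (e i)) * fact (length is) powr R')"
        using c by (intro mult_left_mono) (auto simp: C_def)
      also have "\<dots> = ((\<Prod>i\<leftarrow>is. c i) * (\<Prod>i\<leftarrow>is. p (e i))) * (fact (length is) powr (- R) * fact (length is) powr R')"
        by (simp add: C_def mult_ac)
      also have "fact (length is) powr (- R) * fact (length is) powr R' = fact (length is) powr (- (R - R'))"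
        by (simp flip: powr_add)
      also have "(\<Prod>i\<leftarrow>is. c i) * (\<Prod>i\<leftarrow>is. p (e i)) = (\<Prod>i\<leftarrow>is. c i * p (e i))"
        by (induction "is") (simp_all add: mult_ac)
      finally show ?thesis by simp
    qed
  qed simp
  define D where "D m t = t - (\<Sum>is\<in>A m. tensor_scale (F is t) (E is))" for m t
  have D_mem: "D m t \<in> ?TA" if "t \<in> ?TA" for m t
    unfolding D_def using that E by (intro P.S_closed)
  have lim: "(\<lambda>m. ?P (D m t)) \<longlonglongrightarrow> 0" if t: "t \<in> ?TA" for t
    using t
  proof (rule tensor_algebra_induct)
    have "D m 0 = 0" for m
      unfolding D_def by (simp only: F_zero talg.scale_zero_left sum.neutral_const diff_self)
    then show "(\<lambda>m. ?P (D m 0)) \<longlonglongrightarrow> 0" by (simp only: P.zero tendsto_const)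
  next
    fix t u assume tu: "t \<in> ?TA" "u \<in> ?TA" and lim: "(\<lambda>m. ?P (D m t)) \<longlonglongrightarrow> 0" "(\<lambda>m. ?P (D m u)) \<longlonglongrightarrow> 0"
    have D: "D m (t + u) = D m t + D m u" for m
      unfolding D_def by (simp only: F_add talg.scale_left_distrib sum.distrib add_diff_add)
    show "(\<lambda>m. ?P (D m (t + u))) \<longlonglongrightarrow> 0"
    proof (rule tendsto_sandwich[OF _ _ tendsto_const])
      show "(\<lambda>m. ?P (D m t) + ?P (D m u)) \<longlonglongrightarrow> 0"
        using tendsto_add[OF lim] by simp
      show "\<forall>\<^sub>F m in sequentially. 0 \<le> ?P (D m (t + u))"
        by (intro always_eventually allI P.nonneg D_mem P.S_closed tu)
      show "\<forall>\<^sub>F m in sequentially. ?P (D m (t + u)) \<le> ?P (D m t) + ?P (D m u)"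
        unfolding D by (intro always_eventually allI P.triangle D_mem tu)
    qed
  next
    fix n k vs assume len: "length (vs :: 'v list) = n"
    let ?t = "homogeneous_tensor n (fscale (*) k (tensor smul vs))"
    have Ft: "F is ?t = (if length is = n then k * (\<Prod>(i, v)\<leftarrow>zip is vs. f i v) else 0)" for "is"
      using \<phi>[of "is"] len by (cases "length is = n") (simp_all add: F_def homogeneous_tensor_def fscale_def tensor_def \<phi>_def prod_list_nth)
    have D: "D m ?t = homogeneous_tensor n (fscale (*) k (tensor smul vs - tensor smul (map (T m) vs)))" if m: "n \<le> m" for m
    proof -
      have ml: "multilinear smul (fscale (*)) n (tensor smul)"
        by (rule multilinear_tensor[OF p.vector_space_axioms])
      have "tensor smul (map (T m) vs) = (\<Sum>is\<in>words {..<m} n. tensor smul (map2 (\<lambda>i v. smul (f i v) (e i)) is vs))"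
        using multilinear_sum[OF ml, of "{..<m}" "[]" vs "\<lambda>i v. smul (f i v) (e i)"] len
        unfolding T_def by simp
      also have "\<dots> = (\<Sum>is\<in>words {..<m} n. fscale (*) (\<Prod>(i, v)\<leftarrow>zip is vs. f i v) (tensor smul (map e is)))"
      proof (rule sum.cong[OF refl])
        fix "is" assume "is \<in> words {..<m} n"
        then show "tensor smul (map2 (\<lambda>i v. smul (f i v) (e i)) is vs) =
            fscale (*) (\<Prod>(i, v)\<leftarrow>zip is vs. f i v) (tensor smul (map e is))"
          using multilinear_scale[OF ml, of "is" vs "[]" f e] len vector_space_tens by (simp add: words_def)
      qed
      finally have "homogeneous_tensor n (fscale (*) k (tensor smul (map (T m) vs))) =
          (\<Sum>is\<in>words {..<m} n. tensor_scale (k * (\<Prod>(i, v)\<leftarrow>zip is vs. f i v)) (homogeneous_tensor n (tensor smul (map e is))))"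
        by (simp only: homogeneous_tensor_scale homogeneous_tensor_sum talg.scale_sum_right talg.scale_scale)
      also have "\<dots> = (\<Sum>is\<in>words {..<m} n. tensor_scale (F is ?t) (E is))"
        by (rule sum.cong[OF refl]) (simp add: words_def Ft E_def)
      also have "\<dots> = (\<Sum>is\<in>A m. tensor_scale (F is ?t) (E is))"
      proof (rule sum.mono_neutral_left)
        show "finite (A m)" "words {..<m} n \<subseteq> A m"
          using m by (auto simp: A_def finite_words)
        show "\<forall>is\<in>A m - words {..<m} n. tensor_scale (F is ?t) (E is) = 0"
        proof
          fix "is" assume "is \<in> A m - words {..<m} n"
          then have "length is \<noteq> n" by (auto simp: A_def words_def)
          then have "F is ?t = 0" by (simp add: Ft)
          then show "tensor_scale (F is ?t) (E is) = 0" by (simp only: talg.scale_zero_left)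
        qed
      qed
      finally show ?thesis
        unfolding D_def by (simp only: tens.scale_right_diff_distrib homogeneous_tensor_diff)
    qed
    have "(\<lambda>m. norm k * projective_power smul p n (tensor smul vs - tensor smul (map (T m) vs)) * fact n powr R') \<longlonglongrightarrow> norm k * 0 * fact n powr R'"
      using p.pure_tensor_tendsto[of T "[]" vs] *(5) len unfolding T_def
      by (intro tendsto_mult tendsto_const) simp
    then have lim0: "(\<lambda>m. norm k * projective_power smul p n (tensor smul vs - tensor smul (map (T m) vs)) * fact n powr R') \<longlonglongrightarrow> 0"
      by (simp only: mult_zero_left mult_zero_right)
    have "?P (D m ?t) = norm k * projective_power smul p n (tensor smul vs - tensor smul (map (T m) vs)) * fact n powr R'"
      if m: "n \<le> m" for m
      unfolding D[OF m] p.tensor_seminorm_homogeneous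
      by (subst p.projective_power_scale)
         (auto intro!: tens.subspace_diff[OF subspace_tensor_power] tensor_in_power simp: len)
    then have "\<forall>\<^sub>F m in sequentially. norm k * projective_power smul p n (tensor smul vs - tensor smul (map (T m) vs)) * fact n powr R' = ?P (D m ?t)"
      unfolding eventually_sequentially by (intro exI[of _ n]) simp
    then show "(\<lambda>m. ?P (D m ?t)) \<longlonglongrightarrow> 0"
      by (rule Lim_transform_eventually[OF lim0])
  qed
  show ?thesis
  proof (rule strongly_nuclear_pair_indexed[where f = F and e = E and c = C and A = A,
        OF P.seminormed_space_axioms bij_list_decode _ F E _ bound rapid])
    show "0 \<le> ?Q t" if "t \<in> ?TA" for t
      using seminormed_space.nonneg[OF q.tensor_seminorm_seminormed that] .
    show "0 \<le> C is" for "is" using c by (simp add: C_def)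
    show "finite (A m)" for m by (auto simp: A_def finite_words)
    show "\<forall>\<^sub>F m in sequentially. is \<in> A m" for "is"
    proof -
      have "is \<in> A m" if "max (length is) (Suc (Max (insert 0 (set is)))) \<le> m" for m
      proof -
        have "i < m" if "i \<in> set is" for i
        proof -
          have "i \<le> Max (insert 0 (set is))" using that by (intro Max_ge) auto
          with \<open>max _ _ \<le> m\<close> show ?thesis by simp
        qed
        then show ?thesis using that by (auto simp: A_def words_def)
      qed
      then show ?thesis unfolding eventually_sequentially by blast
    qed
    show "(\<lambda>m. ?P (t - (\<Sum>is\<in>A m. tensor_scale (F is t) (E is)))) \<longlonglongrightarrow> 0" if "t \<in> ?TA" for t
      using lim[OF that] unfolding D_def .
  qed
qed

section \<open>The Koszul sign and the graded symmetrizer\<close>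

definition order_pairs :: "nat \<Rightarrow> (nat \<times> nat) set" where
  "order_pairs n = {(i, j). i < j \<and> j < n}"

text \<open>
  The contribution of a pair of positions to the Koszul sign. For \<open>i < j\<close> and injective \<open>\<sigma>\<close> it is
  \<open>-1\<close> under the condition in \<open>koszul_sign\<close>, but it is symmetric in \<open>i\<close> and \<open>j\<close>. So it is a function
  of the unordered pair, and products over pairs can be reindexed along a permutation.
\<close>

definition pair_sign :: "(nat \<Rightarrow> nat) \<Rightarrow> bool list \<Rightarrow> nat \<Rightarrow> nat \<Rightarrow> 'k::field" where
  "pair_sign \<sigma> \<epsilon> i j = (if (i < j) \<noteq> (\<sigma> i < \<sigma> j) \<and> \<epsilon> ! \<sigma> i \<and> \<epsilon> ! \<sigma> j then -1 else 1)"

lemma finite_order_pairs: "finite (order_pairs n)"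
  by (rule finite_subset[of _ "{..<n} \<times> {..<n}"]) (auto simp: order_pairs_def)

lemma pair_sign_commute:
  assumes "inj \<sigma>" "i \<noteq> j"
  shows "pair_sign \<sigma> \<epsilon> i j = pair_sign \<sigma> \<epsilon> j i"
proof -
  have "\<sigma> i \<noteq> \<sigma> j" using assms by (auto simp: inj_def)
  with assms(2) show ?thesis by (auto simp: pair_sign_def)
qed

lemma koszul_sign_prod:
  assumes "inj \<sigma>" "length \<epsilon> = n"
  shows "koszul_sign \<sigma> \<epsilon> = (\<Prod>(i, j)\<in>order_pairs n. pair_sign \<sigma> \<epsilon> i j)"
proof -
  let ?I = "{(i, j). i < j \<and> j < length \<epsilon> \<and> \<sigma> j < \<sigma> i \<and> \<epsilon> ! \<sigma> i \<and> \<epsilon> ! \<sigma> j}"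
  have "(\<Prod>(i, j)\<in>order_pairs n. pair_sign \<sigma> \<epsilon> i j) = (\<Prod>ij\<in>order_pairs n. if ij \<in> ?I then -1 else 1 :: 'a)"
  proof (rule prod.cong[OF refl], clarify)
    fix i j assume ij: "(i, j) \<in> order_pairs n"
    then have "\<sigma> i \<noteq> \<sigma> j" using assms(1) by (auto simp: inj_def order_pairs_def)
    with ij assms(2) show "pair_sign \<sigma> \<epsilon> i j = (if (i, j) \<in> ?I then -1 else 1 :: 'a)"
      by (auto simp: pair_sign_def order_pairs_def)
  qed
  also have "\<dots> = (-1) ^ card (order_pairs n \<inter> ?I)"
    using prod.If_cases[OF finite_order_pairs, of "\<lambda>ij. ij \<in> ?I" "\<lambda>_. -1 :: 'a" "\<lambda>_. 1" n] by simp
  also have "order_pairs n \<inter> ?I = ?I"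
    using assms(2) by (auto simp: order_pairs_def)
  finally show ?thesis by (simp add: koszul_sign_def)
qed

lemma prod_order_pairs_permute:
  fixes g :: "nat \<Rightarrow> nat \<Rightarrow> 'a::comm_monoid_mult"
  assumes \<tau>: "\<tau> permutes {..<n}" and g: "\<And>i j. i \<noteq> j \<Longrightarrow> g i j = g j i"
  shows "(\<Prod>(i, j)\<in>order_pairs n. g (\<tau> i) (\<tau> j)) = (\<Prod>(i, j)\<in>order_pairs n. g i j)"
proof -
  \<comment> \<open>The action of a permutation on unordered pairs, represented as increasing ones.\<close>
  define h where "h \<pi> ij = (min (\<pi> (fst ij)) (\<pi> (snd ij)), max (\<pi> (fst ij)) (\<pi> (snd ij)))"
    for \<pi> :: "nat \<Rightarrow> nat" and ij :: "nat \<times> nat"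
  have maps: "h \<pi> ij \<in> order_pairs n" if \<pi>: "\<pi> permutes {..<n}" "ij \<in> order_pairs n" for \<pi> ij
  proof -
    obtain i j where ij: "ij = (i, j)" "i < j" "j < n" using \<pi>(2) by (auto simp: order_pairs_def)
    have "\<pi> i < n" "\<pi> j < n" using permutes_in_image[OF \<pi>(1)] ij by auto
    moreover have "\<pi> i \<noteq> \<pi> j" using permutes_inj[OF \<pi>(1)] ij by (auto simp: inj_def)
    ultimately show ?thesis by (auto simp: h_def ij(1) order_pairs_def min_def max_def)
  qed
  have inverse: "h \<pi>' (h \<pi> ij) = ij" if "\<And>i. \<pi>' (\<pi> i) = i" "ij \<in> order_pairs n" for \<pi> \<pi>' ij
    using that by (auto simp: h_def order_pairs_def min_def max_def)
  show ?thesis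
  proof (rule prod.reindex_bij_witness[where i = "h (inv \<tau>)" and j = "h \<tau>"])
    fix ij assume ij: "ij \<in> order_pairs n"
    show "h (inv \<tau>) (h \<tau> ij) = ij" "h \<tau> (h (inv \<tau>) ij) = ij"
      using ij permutes_inverses[OF \<tau>] by (auto intro: inverse)
    show "h \<tau> ij \<in> order_pairs n" "h (inv \<tau>) ij \<in> order_pairs n"
      using maps ij \<tau> permutes_inv by blast+
    obtain i j where "ij = (i, j)" "i \<noteq> j" using ij by (auto simp: order_pairs_def)
    moreover from this have "\<tau> i \<noteq> \<tau> j" using permutes_inj[OF \<tau>] by (auto simp: inj_def)
    ultimately show "(case h \<tau> ij of (i, j) \<Rightarrow> g i j) = (case ij of (i, j) \<Rightarrow> g (\<tau> i) (\<tau> j))"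
      using g by (auto simp: h_def min_def max_def)
  qed
qed

text \<open>
  A pair of odd vectors changes its order under \<open>\<sigma> \<circ> \<tau>\<close> if and only if exactly one of \<open>\<tau>\<close>, at
  \<open>(i, j)\<close>, and \<open>\<sigma>\<close>, at \<open>(\<tau> i, \<tau> j)\<close>, changes it. So the identity holds pair by pair, up to
  reindexing one of the two products along \<open>\<tau>\<close>.
\<close>

lemma koszul_sign_compose:
  assumes \<sigma>: "\<sigma> permutes {..<n}" and \<tau>: "\<tau> permutes {..<n}" and len: "length \<epsilon> = n"
  shows "koszul_sign (\<sigma> \<circ> \<tau>) \<epsilon> = koszul_sign \<sigma> \<epsilon> * koszul_sign \<tau> (permute_list \<sigma> \<epsilon>)"
proof -
  have inj: "inj \<sigma>" "inj \<tau>" "inj (\<sigma> \<circ> \<tau>)"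
    using permutes_inj[OF \<sigma>] permutes_inj[OF \<tau>] by (auto intro: inj_compose)
  have split: "pair_sign (\<sigma> \<circ> \<tau>) \<epsilon> i j = pair_sign \<sigma> \<epsilon> (\<tau> i) (\<tau> j) * pair_sign \<tau> (permute_list \<sigma> \<epsilon>) i j"
    if "(i, j) \<in> order_pairs n" for i j
  proof -
    have "\<tau> i < n" "\<tau> j < n" using that permutes_in_image[OF \<tau>] by (auto simp: order_pairs_def)
    then have "permute_list \<sigma> \<epsilon> ! \<tau> i = \<epsilon> ! \<sigma> (\<tau> i)" "permute_list \<sigma> \<epsilon> ! \<tau> j = \<epsilon> ! \<sigma> (\<tau> j)"
      using len \<sigma> by (auto intro!: permute_list_nth)
    then show ?thesis by (auto simp: pair_sign_def)
  qed
  have "koszul_sign (\<sigma> \<circ> \<tau>) \<epsilon> = (\<Prod>(i, j)\<in>order_pairs n. pair_sign \<sigma> \<epsilon> (\<tau> i) (\<tau> j) * pair_sign \<tau> (permute_list \<sigma> \<epsilon>) i j)"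
    unfolding koszul_sign_prod[OF inj(3) len] by (intro prod.cong refl) (use split in auto)
  also have "\<dots> = (\<Prod>(i, j)\<in>order_pairs n. pair_sign \<sigma> \<epsilon> (\<tau> i) (\<tau> j)) * (\<Prod>(i, j)\<in>order_pairs n. pair_sign \<tau> (permute_list \<sigma> \<epsilon>) i j)"
    by (simp add: prod.distrib case_prod_unfold)
  also have "(\<Prod>(i, j)\<in>order_pairs n. pair_sign \<sigma> \<epsilon> (\<tau> i) (\<tau> j)) = koszul_sign \<sigma> \<epsilon>"
    unfolding koszul_sign_prod[OF inj(1) len]
    by (rule prod_order_pairs_permute[OF \<tau> pair_sign_commute[OF inj(1)]])
  also have "(\<Prod>(i, j)\<in>order_pairs n. pair_sign \<tau> (permute_list \<sigma> \<epsilon>) i j) = koszul_sign \<tau> (permute_list \<sigma> \<epsilon>)"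
    by (rule koszul_sign_prod[symmetric]) (use inj len in auto)
  finally show ?thesis .
qed

lemma koszul_sign_id: "koszul_sign id \<epsilon> = 1"
proof -
  have "{(i, j). i < j \<and> j < length \<epsilon> \<and> id j < id i \<and> \<epsilon> ! id i \<and> \<epsilon> ! id j} = {}" by auto
  then have "card {(i, j). i < j \<and> j < length \<epsilon> \<and> id j < id i \<and> \<epsilon> ! id i \<and> \<epsilon> ! id j} = 0"
    by (simp only: card.empty)
  then show ?thesis unfolding koszul_sign_def by (simp only: power_0)
qed

lemma sum_words_prod_list_map2:
  fixes g :: "'a \<Rightarrow> 'b \<Rightarrow> real"
  assumes "finite A"
  shows "(\<Sum>as\<in>words A (length vs). \<Prod>(a, v)\<leftarrow>zip as vs. g a v) = (\<Prod>v\<leftarrow>vs. \<Sum>a\<in>A. g a v)"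
proof (induction vs)
  case (Cons v vs)
  have "(\<Sum>as\<in>words A (length (v # vs)). \<Prod>(a, v)\<leftarrow>zip as (v # vs). g a v) =
      (\<Sum>a\<in>A. g a v * (\<Sum>as\<in>words A (length vs). \<Prod>(a, v)\<leftarrow>zip as vs. g a v))"
    using assms by (simp add: sum_words_Suc sum_distrib_left)
  then show ?case unfolding Cons.IH by (simp add: sum_distrib_right)
qed (simp add: words_0)

context Z2_graded_lcs
begin

lemma component_sum: "(\<Sum>b\<in>UNIV. component G b v) = v"
proof -
  have "component G True v = v - component G False v"
    using component_mem[where b = False and v = v] by (intro component_eqI) simp_all
  then show ?thesis by (simp add: UNIV_bool)
qed

lemma component_component: "component G b' (component G b v) = (if b = b' then component G b v else 0)"
  by (rule component_homogeneous[OF component_mem(1)])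

lemma tensor_homogeneous_decomposition:
  assumes "length vs = n"
  shows "tensor smul vs = (\<Sum>\<epsilon>\<in>words UNIV n. tensor smul (map2 (component G) \<epsilon> vs))"
  using multilinear_sum[OF multilinear_tensor[OF vector_space_axioms], of UNIV "[]" vs n "component G"] assms
  by (simp add: component_sum)

lemma components_homogeneous:
  assumes "length vs = n" "length \<epsilon> = n" "i < n"
  shows "map2 (component G) \<epsilon> vs ! i \<in> G (\<epsilon> ! i)"
  using assms component_mem(1) by simp

text \<open>
  Splitting every factor into its even and its odd component shows that the tensors of homogeneous
  vectors span the tensor power.
\<close>

lemma linear_eq_on_tensor_power:
  assumes L: "Vector_Spaces.linear (fscale (*)) (fscale (*)) L" "Vector_Spaces.linear (fscale (*)) (fscale (*)) M"
    and eq: "\<And>vs \<epsilon>. length vs = n \<Longrightarrow> length \<epsilon> = n \<Longrightarrow> (\<And>i. i < n \<Longrightarrow> vs ! i \<in> G (\<epsilon> ! i)) \<Longrightarrow> L (tensor smul vs) = M (tensor smul vs)"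
    and t: "t \<in> tensor_power smul n"
  shows "L t = M t"
proof -
  interpret L: Vector_Spaces.linear "fscale (*)" "fscale (*)" L by fact
  interpret M: Vector_Spaces.linear "fscale (*)" "fscale (*)" M by fact
  have pure: "L (tensor smul vs) = M (tensor smul vs)" if len: "length vs = n" for vs
    unfolding tensor_homogeneous_decomposition[OF len] L.sum M.sum
  proof (rule sum.cong[OF refl])
    fix \<epsilon> assume "\<epsilon> \<in> words (UNIV :: bool set) n"
    then have "length \<epsilon> = n" by (simp add: words_def)
    then show "L (tensor smul (map2 (component G) \<epsilon> vs)) = M (tensor smul (map2 (component G) \<epsilon> vs))"
      using len by (intro eq[of _ \<epsilon>] components_homogeneous) auto
  qed
  obtain A c where A: "tensor_representation smul n t A c"
    using tensor_representation_exists[OF t] by blast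
  then have "t = (\<Sum>vs\<in>A. fscale (*) (c vs) (tensor smul vs))" "\<And>vs. vs \<in> A \<Longrightarrow> length vs = n"
    by (auto simp: tensor_representation_def)
  then show ?thesis
    by (simp only: L.sum M.sum L.scale M.scale) (intro sum.cong refl arg_cong[of _ _ "fscale (*) _"] pure)
qed

lemma koszul_action_pure:
  assumes \<sigma>: "\<sigma> permutes {..<n}" and len: "length vs = n"
  shows "koszul_action smul G n \<sigma> (tensor smul vs) =
    (\<Sum>\<epsilon>\<in>words UNIV n. fscale (*) (koszul_sign \<sigma> \<epsilon>) (tensor smul (permute_list \<sigma> (map2 (component G) \<epsilon> vs))))"
proof -
  interpret K: Vector_Spaces.linear "fscale (*)" "fscale (*)" "koszul_action smul G n \<sigma>" by (rule linear_koszul_action)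
  show ?thesis
    unfolding tensor_homogeneous_decomposition[OF len] K.sum
  proof (rule sum.cong[OF refl])
    fix \<epsilon> assume "\<epsilon> \<in> words (UNIV :: bool set) n"
    then have "length \<epsilon> = n" by (simp add: words_def)
    then show "koszul_action smul G n \<sigma> (tensor smul (map2 (component G) \<epsilon> vs)) =
        fscale (*) (koszul_sign \<sigma> \<epsilon>) (tensor smul (permute_list \<sigma> (map2 (component G) \<epsilon> vs)))"
      using len by (intro koszul_action_tensor[OF \<sigma>] components_homogeneous) auto
  qed
qed

lemma koszul_action_pure_in_power:
  assumes \<sigma>: "\<sigma> permutes {..<n}" and len: "length vs = n"
  shows "koszul_action smul G n \<sigma> (tensor smul vs) \<in> tensor_power smul n"
  unfolding koszul_action_pure[OF assms] using len
  by (intro tens.subspace_sum[OF subspace_tensor_power] tens.subspace_scale[OF subspace_tensor_power] tensor_in_power)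
     (simp add: words_def)

lemma koszul_action_in_power:
  assumes \<sigma>: "\<sigma> permutes {..<n}" and t: "t \<in> tensor_power smul n"
  shows "koszul_action smul G n \<sigma> t \<in> tensor_power smul n"
proof -
  interpret K: Vector_Spaces.linear "fscale (*)" "fscale (*)" "koszul_action smul G n \<sigma>" by (rule linear_koszul_action)
  obtain A c where A: "tensor_representation smul n t A c"
    using tensor_representation_exists[OF t] by blast
  then have t': "t = (\<Sum>vs\<in>A. fscale (*) (c vs) (tensor smul vs))" and len: "\<And>vs. vs \<in> A \<Longrightarrow> length vs = n"
    by (auto simp: tensor_representation_def)
  show ?thesis
    unfolding t' K.sum K.scale
    by (intro tens.subspace_sum[OF subspace_tensor_power] tens.subspace_scale[OF subspace_tensor_power]
        koszul_action_pure_in_power \<sigma> len)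
qed

lemma koszul_action_compose:
  assumes \<sigma>: "\<sigma> permutes {..<n}" and \<tau>: "\<tau> permutes {..<n}" and t: "t \<in> tensor_power smul n"
  shows "koszul_action smul G n \<tau> (koszul_action smul G n \<sigma> t) = koszul_action smul G n (\<sigma> \<circ> \<tau>) t"
proof (rule linear_eq_on_tensor_power[OF _ linear_koszul_action _ t])
  show "Vector_Spaces.linear (fscale (*)) (fscale (*)) (\<lambda>t. koszul_action smul G n \<tau> (koszul_action smul G n \<sigma> t))"
    by (intro linearI' vector_space_tens)
       (simp_all only: linear_add'[OF linear_koszul_action] linear_scale'[OF linear_koszul_action])
  fix vs \<epsilon> assume len: "length vs = n" "length \<epsilon> = n" and hom: "\<And>i. i < n \<Longrightarrow> vs ! i \<in> G (\<epsilon> ! i)"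
  have "permute_list \<sigma> vs ! i \<in> G (permute_list \<sigma> \<epsilon> ! i)" if "i < n" for i
    using that hom[of "\<sigma> i"] permutes_in_image[OF \<sigma>] \<sigma> len by (simp add: permute_list_nth)
  then have "koszul_action smul G n \<tau> (tensor smul (permute_list \<sigma> vs)) =
      fscale (*) (koszul_sign \<tau> (permute_list \<sigma> \<epsilon>)) (tensor smul (permute_list \<tau> (permute_list \<sigma> vs)))"
    using len by (intro koszul_action_tensor[OF \<tau>]) auto
  moreover have "permute_list \<tau> (permute_list \<sigma> vs) = permute_list (\<sigma> \<circ> \<tau>) vs"
    using permute_list_compose[of \<tau> vs \<sigma>] \<tau> len by simp
  moreover have "koszul_action smul G n (\<sigma> \<circ> \<tau>) (tensor smul vs) =
      fscale (*) (koszul_sign (\<sigma> \<circ> \<tau>) \<epsilon>) (tensor smul (permute_list (\<sigma> \<circ> \<tau>) vs))"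
    by (rule koszul_action_tensor[OF permutes_compose[OF \<tau> \<sigma>] len hom])
  ultimately show "koszul_action smul G n \<tau> (koszul_action smul G n \<sigma> (tensor smul vs)) =
      koszul_action smul G n (\<sigma> \<circ> \<tau>) (tensor smul vs)"
    by (simp only: koszul_action_tensor[OF \<sigma> len hom] linear_scale'[OF linear_koszul_action]
        tens.scale_scale koszul_sign_compose[OF \<sigma> \<tau> len(2)])
qed

lemma koszul_action_id:
  assumes t: "t \<in> tensor_power smul n"
  shows "koszul_action smul G n id t = t"
proof (rule linear_eq_on_tensor_power[OF linear_koszul_action tens.linear_ident _ t])
  fix vs \<epsilon> assume "length vs = n" "length \<epsilon> = n" and "\<And>i. i < n \<Longrightarrow> vs ! i \<in> G (\<epsilon> ! i)"
  from koszul_action_tensor[OF permutes_id this]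
  show "koszul_action smul G n id (tensor smul vs) = tensor smul vs"
    by (simp only: koszul_sign_id permute_list_id tens.scale_one)
qed

lemma linear_symmetrizer: "Vector_Spaces.linear (fscale (*)) (fscale (*)) (symmetrizer smul G n)"
  unfolding symmetrizer_def
  by (intro linearI' vector_space_tens)
     (simp_all only: linear_add'[OF linear_koszul_action] linear_scale'[OF linear_koszul_action]
       sum.distrib tens.scale_right_distrib tens.scale_left_commute flip: tens.scale_sum_right)

lemma card_perms: "card {\<sigma>. \<sigma> permutes {..<n::nat}} = fact n"
  by (rule card_permutations) simp_all

lemma symmetrizer_in_power: "t \<in> tensor_power smul n \<Longrightarrow> symmetrizer smul G n t \<in> tensor_power smul n"
  unfolding symmetrizer_def
  by (intro tens.subspace_scale[OF subspace_tensor_power] tens.subspace_sum[OF subspace_tensor_power]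
      koszul_action_in_power) simp_all

lemma symmetrizer_idem:
  assumes t: "t \<in> tensor_power smul n"
  shows "symmetrizer smul G n (symmetrizer smul G n t) = symmetrizer smul G n t"
proof -
  let ?P = "{\<sigma>. \<sigma> permutes {..<n}}" and ?K = "koszul_action smul G n"
  have inner: "?K \<tau> (symmetrizer smul G n t) = symmetrizer smul G n t" if \<tau>: "\<tau> permutes {..<n}" for \<tau>
  proof -
    interpret K: Vector_Spaces.linear "fscale (*)" "fscale (*)" "?K \<tau>" by (rule linear_koszul_action)
    have "?K \<tau> (symmetrizer smul G n t) = fscale (*) (1 / fact n) (\<Sum>\<sigma>\<in>?P. ?K \<tau> (?K \<sigma> t))"
      unfolding symmetrizer_def K.scale K.sum ..
    also have "(\<Sum>\<sigma>\<in>?P. ?K \<tau> (?K \<sigma> t)) = (\<Sum>\<sigma>\<in>?P. ?K (\<sigma> \<circ> \<tau>) t)"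
      using t \<tau> by (intro sum.cong refl koszul_action_compose) auto
    also have "\<dots> = (\<Sum>\<sigma>\<in>?P. ?K \<sigma> t)"
      by (rule sum_permutations_compose_right[OF \<tau>, symmetric])
    finally show ?thesis by (simp only: symmetrizer_def)
  qed
  have "symmetrizer smul G n (symmetrizer smul G n t) =
      fscale (*) (1 / fact n) (\<Sum>\<tau>\<in>?P. ?K \<tau> (symmetrizer smul G n t))"
    by (simp only: symmetrizer_def)
  also have "(\<Sum>\<tau>\<in>?P. ?K \<tau> (symmetrizer smul G n t)) = (\<Sum>\<tau>\<in>?P. symmetrizer smul G n t)"
    using inner by (intro sum.cong refl) auto
  also have "\<dots> = fscale (*) (fact n) (symmetrizer smul G n t)"
    by (simp only: tens.sum_constant_scale card_perms of_nat_fact)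
  finally show ?thesis by (simp only: tens.scale_scale) simp
qed

lemma symmetrizer_1:
  assumes t: "t \<in> tensor_power smul 1"
  shows "symmetrizer smul G 1 t = t"
proof -
  have "{\<sigma>. \<sigma> permutes {..<1::nat}} = {id}" by (simp add: lessThan_Suc)
  then show ?thesis
    unfolding symmetrizer_def using koszul_action_id[OF t]
    by (simp only: sum.insert finite.emptyI empty_iff not_False_eq_True sum.empty add_0_right fact_1 div_by_1 tens.scale_one)
qed

lemma symmetric_power_iff:
  "t \<in> symmetric_power smul G n \<longleftrightarrow> t \<in> tensor_power smul n \<and> symmetrizer smul G n t = t"
  unfolding symmetric_power_def using symmetrizer_in_power symmetrizer_idem by (auto intro: image_eqI[OF sym])

lemma subspace_symmetric_power: "tens.subspace (symmetric_power smul G n)"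
  unfolding symmetric_power_def
  by (rule module_hom.subspace_image[OF _ subspace_tensor_power])
     (use linear_symmetrizer in \<open>simp add: Vector_Spaces.linear_def\<close>)

lemma subspace_symmetric_algebra: "talg.subspace (symmetric_algebra smul G)"
  unfolding symmetric_algebra_def by (intro subspace_graded subspace_symmetric_power)

lemma symmetric_algebra_subset: "symmetric_algebra smul G \<subseteq> tensor_algebra smul"
  by (auto simp: symmetric_algebra_def tensor_algebra_def symmetric_power_iff)

lemma norm_koszul_sign: "norm (koszul_sign \<sigma> \<epsilon> :: 'k) = 1"
  by (simp add: koszul_sign_def norm_power)

text \<open>
  Up to signs, a permutation maps \<open>v\<^sub>1 \<otimes> \<dots> \<otimes> v\<^sub>n\<close> to the sum, over all choices of parities, of the
  permuted tensors of the components. Their costs add up to the product of the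
  \<open>p(v\<^sub>i\<^sub>0) + p(v\<^sub>i\<^sub>1) = p(v\<^sub>i)\<close>, so each permutation acts contractively, and so does their average.
\<close>

lemma projective_power_symmetrizer_le:
  assumes p: "seminormed_vector_space smul p"
    and graded: "\<And>v. p v = p (component G False v) + p (component G True v)"
    and t: "t \<in> tensor_power smul n"
  shows "projective_power smul p n (symmetrizer smul G n t) \<le> projective_power smul p n t"
proof -
  interpret p: seminormed_vector_space smul p by fact
  interpret P: seminormed_space "fscale (*)" "tensor_power smul n" "projective_power smul p n"
    by (rule p.projective_power_seminormed)
  let ?N = "projective_power smul p n" and ?P = "{\<sigma>. \<sigma> permutes {..<n}}"
  have pure: "?N (koszul_action smul G n \<sigma> (tensor smul vs)) \<le> 1 * (\<Prod>v\<leftarrow>vs. p v)"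
    if \<sigma>: "\<sigma> permutes {..<n}" and len: "length vs = n" for \<sigma> vs
  proof -
    have "?N (koszul_action smul G n \<sigma> (tensor smul vs)) \<le>
        (\<Sum>\<epsilon>\<in>words UNIV n. ?N (fscale (*) (koszul_sign \<sigma> \<epsilon>) (tensor smul (permute_list \<sigma> (map2 (component G) \<epsilon> vs)))))"
      unfolding koszul_action_pure[OF \<sigma> len] using len
      by (intro P.sum_le tens.subspace_scale[OF subspace_tensor_power] tensor_in_power) (simp add: words_def)
    also have "\<dots> \<le> (\<Sum>\<epsilon>\<in>words UNIV (length vs). \<Prod>(b, v)\<leftarrow>zip \<epsilon> vs. p (component G b v))"
      unfolding len
    proof (rule sum_mono)
      fix \<epsilon> assume "\<epsilon> \<in> words (UNIV :: bool set) n"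
      then have \<epsilon>: "length \<epsilon> = n" by (simp add: words_def)
      let ?ws = "map2 (component G) \<epsilon> vs"
      have "?N (fscale (*) (koszul_sign \<sigma> \<epsilon>) (tensor smul (permute_list \<sigma> ?ws))) \<le> norm (koszul_sign \<sigma> \<epsilon> :: 'k) * (\<Prod>v\<leftarrow>permute_list \<sigma> ?ws. p v)"
        using len \<epsilon> by (intro p.projective_power_tensor_le) simp
      also have "(\<Prod>v\<leftarrow>permute_list \<sigma> ?ws. p v) = (\<Prod>v\<leftarrow>?ws. p v)"
      proof -
        have "mset (permute_list \<sigma> ?ws) = mset ?ws"
          by (rule mset_permute_list) (use \<sigma> len \<epsilon> in simp)
        then have "mset (map p (permute_list \<sigma> ?ws)) = mset (map p ?ws)"
          by (simp only: mset_map)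
        then show ?thesis by (metis prod_mset_prod_list)
      qed
      finally show "?N (fscale (*) (koszul_sign \<sigma> \<epsilon>) (tensor smul (permute_list \<sigma> ?ws))) \<le> (\<Prod>(b, v)\<leftarrow>zip \<epsilon> vs. p (component G b v))"
        by (simp add: norm_koszul_sign o_def case_prod_unfold)
    qed
    also have "\<dots> = (\<Prod>v\<leftarrow>vs. \<Sum>b\<in>UNIV. p (component G b v))"
      by (rule sum_words_prod_list_map2) simp
    also have "\<dots> = (\<Prod>v\<leftarrow>vs. p v)"
    proof -
      have "(\<Sum>b\<in>UNIV. p (component G b v)) = p v" for v
        unfolding graded[of v] UNIV_bool by (simp add: add.commute)
      then show ?thesis by (simp only:)
    qed
    finally show ?thesis by simp
  qed
  have K: "?N (koszul_action smul G n \<sigma> t) \<le> ?N t" if "\<sigma> permutes {..<n}" for \<sigma>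
    using p.projective_power_universal[where L = "koszul_action smul G n \<sigma>" and N = ?N and n = n and K = 1,
        OF p.projective_power_seminormed linear_koszul_action
        koszul_action_pure_in_power[OF that] pure[OF that] zero_le_one t] by simp
  have mem: "koszul_action smul G n \<sigma> t \<in> tensor_power smul n" if "\<sigma> \<in> ?P" for \<sigma>
    using koszul_action_in_power that t by simp
  have "?N (symmetrizer smul G n t) = 1 / fact n * ?N (\<Sum>\<sigma>\<in>?P. koszul_action smul G n \<sigma> t)"
    unfolding symmetrizer_def using mem
    by (subst P.scale) (auto intro!: tens.subspace_sum[OF subspace_tensor_power] simp: norm_divide)
  also have "\<dots> \<le> 1 / fact n * (\<Sum>\<sigma>\<in>?P. ?N (koszul_action smul G n \<sigma> t))"
    using mem by (intro mult_left_mono P.sum_le) auto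
  also have "\<dots> \<le> 1 / fact n * (\<Sum>\<sigma>\<in>?P. ?N t)"
    using K by (intro mult_left_mono sum_mono) auto
  also have "\<dots> = ?N t"
    by (simp add: card_perms)
  finally show ?thesis .
qed

end

section \<open>Strong nuclearity of the tensor algebra and of its symmetric part\<close>

context hausdorff_lcs
begin

definition tensor_seminorms :: "real \<Rightarrow> ((nat \<Rightarrow> ('k, 'v) tens) \<Rightarrow> real) set" where
  "tensor_seminorms R = {tensor_seminorm smul (R - \<epsilon>) p |\<epsilon> p. 0 < \<epsilon> \<and> continuous_seminorm smul X p}"

lemma continuous_seminorm_space: "continuous_seminorm smul X p \<Longrightarrow> seminormed_vector_space smul p"
  unfolding seminormed_vector_space_def
  by unfold_locales (simp_all add: subspace_UNIV continuous_seminorm_def topspace_UNIV)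

lemma tensor_topology_eq: "tensor_topology smul X R = seminorm_topology (tensor_algebra smul) (tensor_seminorms R)"
  by (simp add: tensor_topology_def tensor_seminorms_def)

lemma tensor_seminorms_directed:
  assumes "r \<in> tensor_seminorms R" "r' \<in> tensor_seminorms R"
  shows "\<exists>u\<in>tensor_seminorms R. \<forall>t\<in>tensor_algebra smul. r t \<le> u t \<and> r' t \<le> u t"
proof -
  obtain \<epsilon> p where p: "r = tensor_seminorm smul (R - \<epsilon>) p" "0 < \<epsilon>" "continuous_seminorm smul X p"
    using assms(1) by (auto simp: tensor_seminorms_def)
  obtain \<epsilon>' p' where p': "r' = tensor_seminorm smul (R - \<epsilon>') p'" "0 < \<epsilon>'" "continuous_seminorm smul X p'"
    using assms(2) by (auto simp: tensor_seminorms_def)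
  define q where "q x = p x + p' x" for x
  have q: "continuous_seminorm smul X q"
    unfolding q_def by (rule continuous_seminorm_add[OF p(3) p'(3)])
  interpret p: seminormed_vector_space smul p by (rule continuous_seminorm_space[OF p(3)])
  interpret p': seminormed_vector_space smul p' by (rule continuous_seminorm_space[OF p'(3)])
  interpret q: seminormed_vector_space smul q by (rule continuous_seminorm_space[OF q])
  let ?u = "tensor_seminorm smul (R - min \<epsilon> \<epsilon>') q"
  have le: "tensor_seminorm smul (R - \<delta>) r t \<le> ?u t"
    if t: "t \<in> tensor_algebra smul" and r: "seminormed_vector_space smul r" "\<And>v. r v \<le> q v" and \<delta>: "min \<epsilon> \<epsilon>' \<le> \<delta>"
    for t r \<delta>
  proof (rule q.tensor_seminorm_le[where L = "\<lambda>t. t", OF _ _ r(1) _ _ t])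
    show mem: "t n \<in> tensor_power smul n" for n using t by (simp add: tensor_algebra_def)
    show "projective_power smul r n (t n) \<le> projective_power smul q n (t n)" for n
      using q.projective_power_mono[OF r(1), of 1] r(2) mem by simp
  qed (use \<delta> in auto)
  have "?u \<in> tensor_seminorms R"
    using q p(2) p'(2) unfolding tensor_seminorms_def by force
  moreover have "r t \<le> ?u t \<and> r' t \<le> ?u t" if "t \<in> tensor_algebra smul" for t
    unfolding p(1) p'(1) using p.nonneg p'.nonneg
    by (intro conjI le that p.seminormed_vector_space_axioms p'.seminormed_vector_space_axioms) (auto simp: q_def)
  ultimately show ?thesis by blast
qed

lemma seminorm_family_tensor: "seminorm_family tensor_scale (tensor_algebra smul) (tensor_seminorms R)"
proof
  show "seminorm_on tensor_scale (tensor_algebra smul) r" if "r \<in> tensor_seminorms R" for r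
    using that seminormed_vector_space.tensor_seminorm_seminormed[OF continuous_seminorm_space]
    by (auto simp: tensor_seminorms_def intro: seminormed_space.seminorm)
  have "continuous_seminorm smul X (\<lambda>_. 0)"
    by (simp add: continuous_seminorm_def seminorm_on_def)
  then show "tensor_seminorms R \<noteq> {}"
    unfolding tensor_seminorms_def using zero_less_one by blast
  show "\<exists>u\<in>tensor_seminorms R. \<forall>t\<in>tensor_algebra smul. r t \<le> u t \<and> r' t \<le> u t"
    if "r \<in> tensor_seminorms R" "r' \<in> tensor_seminorms R" for r r'
    using tensor_seminorms_directed that .
qed (rule subspace_tensor_algebra)

lemma strongly_nuclear_iff:
  "strongly_nuclear smul X \<longleftrightarrow> (\<forall>p. continuous_seminorm smul X p \<longrightarrow>
     (\<exists>q. continuous_seminorm smul X q \<and> strongly_nuclear_pair smul UNIV p q))"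
proof -
  have "\<exists>b\<in>{p. continuous_seminorm smul X p}. \<exists>C\<ge>0. \<forall>x\<in>topspace X. p x \<le> C * b x"
    if "continuous_seminorm smul X p" for p
    using that by (intro bexI[of _ p] exI[of _ 1]) auto
  then show ?thesis
    using strongly_nuclear_iff_pairs[OF vector_space_axioms, of X "{p. continuous_seminorm smul X p}"]
      subspace_UNIV by (simp add: topspace_UNIV)
qed

lemma strongly_nuclear_tensor_iff:
  "strongly_nuclear tensor_scale (tensor_topology smul X R) \<longleftrightarrow>
    (\<forall>r\<in>tensor_seminorms R. \<exists>u\<in>tensor_seminorms R. strongly_nuclear_pair tensor_scale (tensor_algebra smul) r u)"
  unfolding tensor_topology_eq by (rule seminorm_family.strongly_nuclear_family_iff[OF seminorm_family_tensor])

text \<open>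
  The seminorms in the topology have exponents strictly below \<open>R\<close>, so \<open>R - \<epsilon>\<close> can be raised to
  \<open>R - \<epsilon> / 2\<close>.
\<close>

theorem strongly_nuclear_tensor:
  assumes "strongly_nuclear smul X"
  shows "strongly_nuclear tensor_scale (tensor_topology smul X R)"
  unfolding strongly_nuclear_tensor_iff
proof
  fix r assume "r \<in> tensor_seminorms R"
  then obtain \<epsilon> p where p: "r = tensor_seminorm smul (R - \<epsilon>) p" "0 < \<epsilon>" "continuous_seminorm smul X p"
    by (auto simp: tensor_seminorms_def)
  obtain q where q: "continuous_seminorm smul X q" "strongly_nuclear_pair smul UNIV p q"
    using assms p(3) unfolding strongly_nuclear_iff by blast
  have "strongly_nuclear_pair tensor_scale (tensor_algebra smul) r (tensor_seminorm smul (R - \<epsilon> / 2) q)"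
    unfolding p(1)
    by (rule strongly_nuclear_pair_tensor_algebra[OF continuous_seminorm_space[OF p(3)] continuous_seminorm_space[OF q(1)] q(2)])
       (use p(2) in simp)
  moreover have "tensor_seminorm smul (R - \<epsilon> / 2) q \<in> tensor_seminorms R"
    using p(2) q(1) half_gt_zero[OF p(2)] unfolding tensor_seminorms_def by blast
  ultimately show "\<exists>u\<in>tensor_seminorms R. strongly_nuclear_pair tensor_scale (tensor_algebra smul) r u" by blast
qed

end

context Z2_graded_lcs
begin

lemma strongly_nuclear_weyl_iff:
  "strongly_nuclear tensor_scale (weyl_topology smul X G R) \<longleftrightarrow>
    (\<forall>r\<in>tensor_seminorms R. \<exists>u\<in>tensor_seminorms R. strongly_nuclear_pair tensor_scale (symmetric_algebra smul G) r u)"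
  unfolding weyl_topology_def tensor_topology_eq
  by (rule seminorm_family.strongly_nuclear_subtopology_iff[OF seminorm_family_tensor
        subspace_symmetric_algebra symmetric_algebra_subset])

lemma seminormed_space_symmetric:
  assumes "r \<in> tensor_seminorms R"
  shows "seminormed_space tensor_scale (symmetric_algebra smul G) r"
proof
  show "seminorm_on tensor_scale (symmetric_algebra smul G) r"
    using seminorm_family.seminorms[OF seminorm_family_tensor assms] symmetric_algebra_subset
    unfolding seminorm_on_def by blast
qed (rule subspace_symmetric_algebra)

text \<open>
  Graded seminorms are cofinal, because the projections to the two components are continuous.
\<close>

lemma graded_seminorm:
  assumes p: "continuous_seminorm smul X p"
  defines "p' \<equiv> \<lambda>v. p (component G False v) + p (component G True v)"
  shows "continuous_seminorm smul X p'" "p v \<le> p' v" "p' v = p' (component G False v) + p' (component G True v)"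
proof -
  interpret p: seminormed_vector_space smul p by (rule continuous_seminorm_space[OF p])
  have "continuous_seminorm smul X (\<lambda>v. p (component G b v))" for b
    using p continuous_map_compose[OF continuous_component[of b], of euclideanreal p] p.triangle
    by (simp add: continuous_seminorm_def seminorm_on_def topspace_UNIV component_add component_scale o_def)
  then show "continuous_seminorm smul X p'"
    unfolding p'_def by (intro continuous_seminorm_add)
  have "v = component G False v + component G True v"
    using component_sum[of v] by (simp add: UNIV_bool add.commute)
  then have "p v \<le> p (component G False v) + p (component G True v)"
    using p.triangle[of "component G False v" "component G True v"] by simp
  then show "p v \<le> p' v" by (simp add: p'_def)
  show "p' v = p' (component G False v) + p' (component G True v)"
    by (simp add: p'_def component_component)
qed

theorem strongly_nuclear_weyl:
  assumes "strongly_nuclear tensor_scale (tensor_topology smul X R)"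
  shows "strongly_nuclear tensor_scale (weyl_topology smul X G R)"
  unfolding strongly_nuclear_weyl_iff
proof
  let ?W = "symmetric_algebra smul G"
  fix r assume r: "r \<in> tensor_seminorms R"
  then obtain \<epsilon> p where p: "r = tensor_seminorm smul (R - \<epsilon>) p" "0 < \<epsilon>" "continuous_seminorm smul X p"
    by (auto simp: tensor_seminorms_def)
  define p' where "p' v = p (component G False v) + p (component G True v)" for v
  note p' = graded_seminorm[OF p(3), folded p'_def]
  define r' where "r' = tensor_seminorm smul (R - \<epsilon>) p'"
  have r': "r' \<in> tensor_seminorms R"
    using p(2) p'(1) unfolding tensor_seminorms_def r'_def by blast
  obtain u where u: "u \<in> tensor_seminorms R" "strongly_nuclear_pair tensor_scale (tensor_algebra smul) r' u"
    using assms r' unfolding strongly_nuclear_tensor_iff by blast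
  interpret p': seminormed_vector_space smul p' by (rule continuous_seminorm_space[OF p'(1)])
  define S where "S t n = symmetrizer smul G n (t n)" for t :: "nat \<Rightarrow> ('k, 'v) tens" and n
  have S0: "symmetrizer smul G n 0 = 0" for n
    using linear_scale'[OF linear_symmetrizer, of n 0 0] by (simp only: tens.scale_zero_left)
  have S_mem: "S t \<in> ?W" if "t \<in> tensor_algebra smul" for t
  proof -
    have t: "\<And>n. t n \<in> tensor_power smul n" "finite {n. t n \<noteq> 0}" using that by (auto simp: tensor_algebra_def)
    have "finite {n. S t n \<noteq> 0}"
      by (rule finite_subset[OF _ t(2)]) (use S0 in \<open>auto simp: S_def\<close>)
    with t(1) show ?thesis
      by (auto simp: symmetric_algebra_def S_def symmetric_power_def)
  qed
  have pair: "strongly_nuclear_pair tensor_scale ?W r' u"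
  proof (rule strongly_nuclear_pair_retract[OF u(2), where i = "\<lambda>t. t" and r = S])
    show "Vector_Spaces.linear tensor_scale tensor_scale S"
    proof (intro linearI' vector_space_tensor_scale)
      show "S (t + u) = S t + S u" for t u
        by (rule ext) (simp only: S_def plus_fun_apply linear_add'[OF linear_symmetrizer])
      show "S (tensor_scale c t) = tensor_scale c (S t)" for c t
        by (rule ext) (simp only: S_def fscale_def[of "fscale (*)"] linear_scale'[OF linear_symmetrizer])
    qed
    show "S t = t" if "t \<in> ?W" for t
      using that by (auto simp: S_def symmetric_algebra_def symmetric_power_iff)
    show "r' (S t) \<le> r' t" if t: "t \<in> tensor_algebra smul" for t
      unfolding r'_def
    proof (rule p'.tensor_seminorm_le[OF _ _ p'.seminormed_vector_space_axioms _ order_refl t])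
      show "S t n \<in> tensor_power smul n" for n
        using t by (simp add: S_def symmetrizer_in_power tensor_algebra_def)
      show "t n = 0 \<Longrightarrow> S t n = 0" for n
        using S0 by (simp only: S_def)
      show "projective_power smul p' n (S t n) \<le> projective_power smul p' n (t n)" for n
        unfolding S_def using t
        by (intro projective_power_symmetrizer_le p'.seminormed_vector_space_axioms p'(3)) (simp add: tensor_algebra_def)
    qed
    show "seminormed_space tensor_scale (tensor_algebra smul) r'"
      by (rule seminorm_family.space[OF seminorm_family_tensor r'])
    show "seminormed_space tensor_scale ?W r'" by (rule seminormed_space_symmetric[OF r'])
  qed (use S_mem symmetric_algebra_subset in auto)
  have "strongly_nuclear_pair tensor_scale ?W r u"
  proof (rule strongly_nuclear_pair_mono[OF pair seminormed_space_symmetric[OF r'] seminormed_space_symmetric[OF r], where C = 1 and C' = 1])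
    fix t assume "t \<in> ?W"
    then have t: "t \<in> tensor_algebra smul" using symmetric_algebra_subset by blast
    have "r t \<le> r' t"
      unfolding p(1) r'_def
    proof (rule p'.tensor_seminorm_le[where L = "\<lambda>t. t", OF _ _ continuous_seminorm_space[OF p(3)] _ order_refl t])
      show mem: "t n \<in> tensor_power smul n" for n using t by (simp add: tensor_algebra_def)
      show "projective_power smul p n (t n) \<le> projective_power smul p' n (t n)" for n
        using p'.projective_power_mono[OF continuous_seminorm_space[OF p(3)], of 1] p'(2) mem by simp
    qed
    then show "r t \<le> 1 * r' t" by simp
  qed auto
  with u(1) show "\<exists>u\<in>tensor_seminorms R. strongly_nuclear_pair tensor_scale ?W r u" by blast
qed

theorem strongly_nuclear_base:
  assumes "strongly_nuclear tensor_scale (weyl_topology smul X G R)"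
  shows "strongly_nuclear smul X"
  unfolding strongly_nuclear_iff
proof (intro allI impI)
  let ?W = "symmetric_algebra smul G"
  fix p assume p: "continuous_seminorm smul X p"
  \<comment> \<open>Any exponent below \<open>R\<close> would do, as the factorial weight in degree one is \<open>1\<close>.\<close>
  define r where "r = tensor_seminorm smul (R - 1) p"
  have r: "r \<in> tensor_seminorms R"
    using p zero_less_one unfolding tensor_seminorms_def r_def by blast
  obtain u where u: "u \<in> tensor_seminorms R" "strongly_nuclear_pair tensor_scale ?W r u"
    using assms r unfolding strongly_nuclear_weyl_iff by blast
  obtain \<epsilon> q where q: "u = tensor_seminorm smul (R - \<epsilon>) q" "0 < \<epsilon>" "continuous_seminorm smul X q"
    using u(1) by (auto simp: tensor_seminorms_def)
  interpret p: seminormed_vector_space smul p by (rule continuous_seminorm_space[OF p])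
  interpret q: seminormed_vector_space smul q by (rule continuous_seminorm_space[OF q(3)])
  have "multilinear smul smul 1 (\<lambda>vs. vs ! 0)"
    unfolding multilinear_def by (auto intro: linear_ident)
  then obtain L :: "('k, 'v) tens \<Rightarrow> 'v" where L: "Vector_Spaces.linear (fscale (*)) smul L"
      "\<And>vs. length vs = 1 \<Longrightarrow> L (tensor smul vs) = vs ! 0"
    using tensor_power_universal[OF vector_space_axioms vector_space_axioms] by blast
  define i where "i v = homogeneous_tensor 1 (tensor smul [v])" for v
  have lin: "Vector_Spaces.linear smul (fscale (*)) (\<lambda>v. tensor smul [v])"
    using multilinear_slot[OF multilinear_tensor[OF vector_space_axioms], of "[]" "[]" 1] by simp
  have "strongly_nuclear_pair smul UNIV p q"
  proof (rule strongly_nuclear_pair_retract[OF u(2), where i = i and r = "\<lambda>t. L (t 1)"])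
    show "i v \<in> ?W" for v
    proof -
      have mem: "tensor smul [v] \<in> tensor_power smul 1"
        by (rule tensor_in_power) simp
      have "tensor smul [v] \<in> symmetric_power smul G 1"
        unfolding symmetric_power_iff by (rule conjI[OF mem symmetrizer_1[OF mem]])
      moreover have "0 \<in> symmetric_power smul G n" for n
        by (rule tens.subspace_0[OF subspace_symmetric_power])
      ultimately show ?thesis
        by (auto simp: symmetric_algebra_def i_def homogeneous_tensor_def intro: finite_subset[of _ "{1}"])
    qed
    show "i (v + w) = i v + i w" for v w
      by (simp only: i_def linear_add'[OF lin] homogeneous_tensor_add)
    show "i (smul c v) = tensor_scale c (i v)" for c v
      by (simp only: i_def linear_scale'[OF lin] homogeneous_tensor_scale)
    show "Vector_Spaces.linear tensor_scale smul (\<lambda>t. L (t 1))"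
      by (intro linearI' vector_space_tensor_scale vector_space_axioms)
         (simp_all only: plus_fun_apply fscale_def[of "fscale (*)"] linear_add'[OF L(1)] linear_scale'[OF L(1)])
    show "L (i v 1) = v" for v
      by (simp add: i_def homogeneous_tensor_def L(2))
    show "p (L (t 1)) \<le> r t" if "t \<in> ?W" for t
    proof -
      have t: "t \<in> tensor_algebra smul" using that symmetric_algebra_subset by blast
      have "p (L (t 1)) \<le> 1 * projective_power smul p 1 (t 1)"
      proof (rule p.projective_power_universal[OF p.seminormed_space_axioms L(1)])
        show "p (L (tensor smul vs)) \<le> 1 * (\<Prod>v\<leftarrow>vs. p v)" if "length vs = 1" for vs
        proof -
          obtain v where "vs = [v]" using \<open>length vs = 1\<close> by (auto simp: length_Suc_conv)
          then show ?thesis by (simp add: L(2))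
        qed
      qed (use t in \<open>auto simp: tensor_algebra_def\<close>)
      also have "\<dots> \<le> r t"
        using p.projective_power_le_tensor_seminorm[OF t, of 1 "R - 1"] by (simp add: r_def)
      finally show ?thesis .
    qed
    show "seminormed_space tensor_scale ?W r" by (rule seminormed_space_symmetric[OF r])
    show "seminormed_space smul UNIV p" by (rule p.seminormed_space_axioms)
    show "u (i v) \<le> q v" for v
      using q.projective_power_pure_tensor_le[of "[v]" 1]
      by (simp add: q(1) i_def q.tensor_seminorm_homogeneous)
  qed auto
  with q(3) show "\<exists>q. continuous_seminorm smul X q \<and> strongly_nuclear_pair smul UNIV p q" by blast
qed

end

theorem theorem4p11:
  fixes smul :: "'k::real_or_complex \<Rightarrow> 'v::ab_group_add \<Rightarrow> 'v"
    and X :: "'v topology" and G :: "bool \<Rightarrow> 'v set" and R :: real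
  assumes "Z2_graded_lcs smul X G" and "0 \<le> R"
  shows "(strongly_nuclear smul X \<longleftrightarrow> strongly_nuclear tensor_scale (tensor_topology smul X R)) \<and>
    (strongly_nuclear tensor_scale (tensor_topology smul X R) \<longleftrightarrow>
     strongly_nuclear tensor_scale (weyl_topology smul X G R))"
proof -
  interpret Z2_graded_lcs smul X G by fact
  show ?thesis
    using strongly_nuclear_tensor strongly_nuclear_weyl strongly_nuclear_base by blast
qed

end
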